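(* Let $G=(V,E)$ be a directed graph with $n$ vertices and $m$ edges and let $v\in V$. All the $2$-vertex-connected components of $G$ that contain $v$ can be computed in $O(nm)$ time.
   Context: For a directed graph $G=(V,E)$ and $U\subseteq V$, $G[U]$ denotes the subgraph induced by $U$. A directed graph $G=(V,E)$ is $k$-vertex-connected if it has at least $k+1$ vertices and $G[V\setminus X]$ is strongly connected for every $X\subset V$ with $|X|<k$. The $k$-vertex-connected components ($k$-vccs) of $G$ are its maximal $k$-vertex-connected subgraphs (identified with their vertex sets $C$, the subgraph being $G[C]$). *)

theory Defs
  imports "Graph_Theory.Graph_Theory"
begin

section \<open>Vertex-connected components of a directed graph\<close>

text \<open>The first conjunct forces the vertex set to be finite (the cardinality of an infinite set is
  \<open>0\<close>), so \<open>card X\<close> is the true size of \<open>X\<close>.\<close>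

definition k_vertex_connected :: "nat \<Rightarrow> ('a, 'b) pre_digraph \<Rightarrow> bool" where
  "k_vertex_connected k G \<longleftrightarrow>
     card (verts G) \<ge> k + 1 \<and>
     (\<forall>X. X \<subset> verts G \<and> card X < k \<longrightarrow> strongly_connected (G \<restriction> (verts G - X)))"

definition kvccs :: "nat \<Rightarrow> ('a, 'b) pre_digraph \<Rightarrow> 'a set set" where
  "kvccs k G = verts ` {H. pre_digraph.max_subgraph G (k_vertex_connected k) H}"

text \<open>A component is identified with its vertex set. This loses nothing: a maximal
  \<open>k\<close>-vertex-connected subgraph is the subgraph induced by its vertices.\<close>

lemma reachable_arc_mono:
  assumes "u \<rightarrow>\<^sup>*\<^bsub>G\<^esub> v" "verts G = verts H" "arcs G \<subseteq> arcs H" "tail G = tail H" "head G = head H"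
  shows "u \<rightarrow>\<^sup>*\<^bsub>H\<^esub> v"
proof -
  have "arcs_ends G \<subseteq> arcs_ends H"
    using assms(3-5) by (auto simp: arcs_ends_def arc_to_ends_def)
  with assms(1,2) show ?thesis
    unfolding reachable_def by (auto intro: rtrancl_on_mono)
qed

lemma max_k_vertex_connected_imp_induced:
  assumes "pre_digraph.max_subgraph G (k_vertex_connected k) H"
  shows "H = G \<restriction> verts H"
proof -
  from assms have HG: "subgraph H G" and kH: "k_vertex_connected k H"
    and mx: "\<And>H'. H' \<noteq> H \<Longrightarrow> subgraph H H' \<Longrightarrow> subgraph H' G \<Longrightarrow> \<not> k_vertex_connected k H'"
    by (auto simp: pre_digraph.max_subgraph_def)
  from HG have wf: "wf_digraph G" and sub: "verts H \<subseteq> verts G" "arcs H \<subseteq> arcs G"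
    and eq: "tail H = tail G" "head H = head G" and wfH: "wf_digraph H"
    by (auto simp: subgraph_def compatible_def)
  let ?I = "G \<restriction> verts H"
  have sHI: "subgraph H ?I" using HG by (rule subgraph_induce_subgraphI2)
  have sIG: "subgraph ?I G"
    using sub(1) wf by (simp add: wf_digraph.subgraph_induce_subgraphI)
  have "k_vertex_connected k ?I"
    unfolding k_vertex_connected_def
  proof (intro conjI allI impI)
    show "k + 1 \<le> card (verts ?I)" using kH by (simp add: k_vertex_connected_def)
    fix X assume X: "X \<subset> verts ?I \<and> card X < k"
    let ?A = "H \<restriction> (verts H - X)" and ?B = "?I \<restriction> (verts ?I - X)"
    have A: "strongly_connected ?A" using X kH by (simp add: k_vertex_connected_def)
    have "arcs ?A \<subseteq> arcs ?B"
      using sub(2) eq by (auto simp: wf_digraph.tail_in_verts[OF wfH] wf_digraph.head_in_verts[OF wfH])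
    then have "\<And>u v. u \<rightarrow>\<^sup>*\<^bsub>?A\<^esub> v \<Longrightarrow> u \<rightarrow>\<^sup>*\<^bsub>?B\<^esub> v"
      using eq by (rule_tac G = ?A in reachable_arc_mono) auto
    with A show "strongly_connected ?B" by (auto simp: strongly_connected_def)
  qed
  with mx[OF _ sHI sIG] show ?thesis by fastforce
qed


section \<open>Random access machine\<close>

text \<open>
  Machine programs, written as while programs over finitely many registers (\<open>V\<close>) and finitely many
  random-access arrays (\<open>A a e\<close> reads cell \<open>e\<close> of array \<open>a\<close>). Every executed assignment, store and
  test costs one unit; an expression of a fixed program has constant size, so charging for each of
  its operations would change running times by a constant factor only. The arithmetic is addition
  and truncated subtraction.

  The parameter \<open>W\<close> of the semantics bounds the machine word: storing a value, or addressing a cell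
  to be written, of size \<open>W\<close> or more makes the execution get stuck. Intermediate values of
  expressions then stay below a constant multiple of \<open>W\<close> (for \<open>W > 0\<close>), so unit cost is justified as
  soon as \<open>W\<close> is polynomial in the size of the input.
\<close>

datatype aexp = N nat | V string | A string aexp | Plus aexp aexp | Minus aexp aexp

datatype bexp = Less aexp aexp | Eq aexp aexp | Not bexp | And bexp bexp

datatype com =
    Skip
  | Assign string aexp
  | Store string aexp aexp
  | Seq com com
  | If bexp com com
  | While bexp com

record state =
  regs :: "string \<Rightarrow> nat"
  arrs :: "string \<Rightarrow> nat \<Rightarrow> nat"

primrec aval :: "aexp \<Rightarrow> state \<Rightarrow> nat" where
  "aval (N k) s = k"
| "aval (V x) s = regs s x"
| "aval (A a e) s = arrs s a (aval e s)"
| "aval (Plus e f) s = aval e s + aval f s"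
| "aval (Minus e f) s = aval e s - aval f s"

primrec bval :: "bexp \<Rightarrow> state \<Rightarrow> bool" where
  "bval (Less e f) s \<longleftrightarrow> aval e s < aval f s"
| "bval (Eq e f) s \<longleftrightarrow> aval e s = aval f s"
| "bval (Not b) s \<longleftrightarrow> \<not> bval b s"
| "bval (And b c) s \<longleftrightarrow> bval b s \<and> bval c s"

text \<open>\<open>exec W c s t s'\<close>: with word bound \<open>W\<close>, program \<open>c\<close> started in \<open>s\<close> halts in \<open>s'\<close> after
  exactly \<open>t\<close> steps.\<close>

inductive exec :: "nat \<Rightarrow> com \<Rightarrow> state \<Rightarrow> nat \<Rightarrow> state \<Rightarrow> bool" for W where
  Skip: "exec W Skip s 1 s"
| Assign: "aval e s < W \<Longrightarrow>
    exec W (Assign x e) s 1 (s\<lparr>regs := (regs s)(x := aval e s)\<rparr>)"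
| Store: "aval i s < W \<Longrightarrow> aval e s < W \<Longrightarrow>
    exec W (Store a i e) s 1 (s\<lparr>arrs := (arrs s)(a := (arrs s a)(aval i s := aval e s))\<rparr>)"
| Seq: "exec W c\<^sub>1 s t\<^sub>1 s' \<Longrightarrow> exec W c\<^sub>2 s' t\<^sub>2 s'' \<Longrightarrow> exec W (Seq c\<^sub>1 c\<^sub>2) s (t\<^sub>1 + t\<^sub>2) s''"
| IfTrue: "bval b s \<Longrightarrow> exec W c\<^sub>1 s t s' \<Longrightarrow> exec W (If b c\<^sub>1 c\<^sub>2) s (1 + t) s'"
| IfFalse: "\<not> bval b s \<Longrightarrow> exec W c\<^sub>2 s t s' \<Longrightarrow> exec W (If b c\<^sub>1 c\<^sub>2) s (1 + t) s'"
| WhileFalse: "\<not> bval b s \<Longrightarrow> exec W (While b c) s 1 s"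
| WhileTrue: "bval b s \<Longrightarrow> exec W c s t\<^sub>1 s' \<Longrightarrow> exec W (While b c) s' t\<^sub>2 s'' \<Longrightarrow>
    exec W (While b c) s (1 + t\<^sub>1 + t\<^sub>2) s''"

inductive_cases exec_SkipE: "exec W Skip s t s'"
inductive_cases exec_AssignE: "exec W (Assign x e) s t s'"
inductive_cases exec_StoreE: "exec W (Store a i e) s t s'"
inductive_cases exec_SeqE: "exec W (Seq c\<^sub>1 c\<^sub>2) s t s'"
inductive_cases exec_IfE: "exec W (If b c\<^sub>1 c\<^sub>2) s t s'"
inductive_cases exec_WhileE: "exec W (While b c) s t s'"

text \<open>Programs are deterministic, so there is one running time and one result per input.\<close>

lemma exec_deterministic:
  "exec W c s t s' \<Longrightarrow> exec W c s u r \<Longrightarrow> u = t \<and> r = s'"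
proof (induction arbitrary: u r rule: exec.induct)
  case (Skip s)
  then show ?case by (auto elim: exec_SkipE)
next
  case (Assign e s x)
  from Assign.prems show ?case by (auto elim: exec_AssignE)
next
  case (Store i s e a)
  from Store.prems show ?case by (auto elim: exec_StoreE)
next
  case (Seq c\<^sub>1 s t\<^sub>1 s' c\<^sub>2 t\<^sub>2 s'')
  from Seq.prems obtain u\<^sub>1 u\<^sub>2 q where
    *: "u = u\<^sub>1 + u\<^sub>2" "exec W c\<^sub>1 s u\<^sub>1 q" "exec W c\<^sub>2 q u\<^sub>2 r"
    by (rule exec_SeqE)
  from Seq.IH(1)[OF *(2)] * have "u\<^sub>1 = t\<^sub>1" "exec W c\<^sub>2 s' u\<^sub>2 r" by auto
  with Seq.IH(2) *(1) show ?case by simp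
next
  case (IfTrue b s c\<^sub>1 t s' c\<^sub>2)
  from IfTrue.prems IfTrue.hyps obtain u\<^sub>1 where "u = 1 + u\<^sub>1" "exec W c\<^sub>1 s u\<^sub>1 r"
    by (auto elim: exec_IfE)
  with IfTrue.IH show ?case by simp
next
  case (IfFalse b s c\<^sub>2 t s' c\<^sub>1)
  from IfFalse.prems IfFalse.hyps obtain u\<^sub>1 where "u = 1 + u\<^sub>1" "exec W c\<^sub>2 s u\<^sub>1 r"
    by (auto elim: exec_IfE)
  with IfFalse.IH show ?case by simp
next
  case (WhileFalse b s c)
  from WhileFalse.prems show ?case
    by (rule exec_WhileE) (simp_all add: WhileFalse.hyps)
next
  case (WhileTrue b s c t\<^sub>1 s' t\<^sub>2 s'')
  from WhileTrue.prems obtain u\<^sub>1 u\<^sub>2 q where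
    *: "u = 1 + u\<^sub>1 + u\<^sub>2" "exec W c s u\<^sub>1 q" "exec W (While b c) q u\<^sub>2 r"
    by (rule exec_WhileE) (simp_all add: WhileTrue.hyps(1))
  from WhileTrue.IH(1)[OF *(2)] * have "u\<^sub>1 = t\<^sub>1" "exec W (While b c) s' u\<^sub>2 r" by auto
  with WhileTrue.IH(2) *(1) show ?case by simp
qed


section \<open>Input and output\<close>

text \<open>A graph with vertex set \<open>{..<n}\<close> is given by \<open>n\<close>, its number of edges \<open>m\<close> and the list of its
  edges, in any order, as two arrays. All other cells are initially \<open>0\<close>.\<close>

definition initial_state :: "nat \<Rightarrow> (nat \<times> nat) list \<Rightarrow> nat \<Rightarrow> state" where
  "initial_state n es v =
     \<lparr>regs = (\<lambda>_. 0)(''n'' := n, ''m'' := length es, ''v'' := v),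
      arrs = (\<lambda>_ _. 0)
        (''src'' := (\<lambda>i. if i < length es then fst (es ! i) else 0),
         ''dst'' := (\<lambda>i. if i < length es then snd (es ! i) else 0))\<rparr>"

text \<open>A finite family of finite sets is written to the array \<open>out\<close> as the number of sets, followed,
  for each set, by its size and its elements; neither a set nor an element of a set is repeated.\<close>

definition encode_lists :: "nat list list \<Rightarrow> nat list" where
  "encode_lists xss = length xss # concat (map (\<lambda>xs. length xs # xs) xss)"

definition outputs_family :: "state \<Rightarrow> nat set set \<Rightarrow> bool" where
  "outputs_family s F \<longleftrightarrow>
     (\<exists>xss. set (map set xss) = F \<and> distinct (map set xss) \<and> (\<forall>xs \<in> set xss. distinct xs) \<and>
        (\<forall>i < length (encode_lists xss). arrs s ''out'' i = encode_lists xss ! i))"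

end

theory Submission
  imports Defs
begin

text \<open>
  Every vertex set of a 2-vertex-connected component containing \<open>v\<close> is \<open>v\<close> together with a part of
  one strongly connected component of \<open>G - v\<close>. Moreover, if some \<open>a \<noteq> v\<close> dominates \<open>w\<close> from \<open>v\<close> (or in
  the reversed graph), then no such component contains \<open>w\<close>, so that \<open>w\<close> can be discarded. Splitting
  classes into strongly connected ones and discarding dominated vertices, as long as possible, leaves
  the components.

  Linear-time dominator algorithms are avoided by a local search. Order the vertices by a search from
  \<open>v\<close>. If \<open>a\<close> dominates something, let \<open>h\<close> be the first vertex of the set \<open>D\<close> that it dominates. Then
  a backward search from \<open>h\<close> which stops at vertices preceding \<open>h\<close> stays in \<open>D\<close>, and it meets no other
  preceding vertex than \<open>a\<close>. All these searches are run with an edge budget \<open>s = 1, 2, 4, \<dots>\<close>, at cost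
  \<open>O(n s)\<close> per round, in both directions. A success at budget \<open>s\<close> discards vertices with \<open>\<Omega>(s)\<close>
  incident edges, since the previous budget did not suffice. Hence all successful rounds together
  take \<open>O(n m)\<close> steps, and so does the final unsuccessful one; the remaining work is \<open>O(n + m)\<close> for
  each of the \<open>O(min(n, m))\<close> splits and discards.
\<close>

section \<open>Reasoning about programs\<close>

text \<open>The bound \<open>n * m\<close> instead of \<open>n * (n + m)\<close> shapes the
  bookkeeping. Vertices other than \<open>v\<close> without an incoming edge are discarded at the
  start, which leaves at most \<open>m\<close> vertices alive, and without edges the program stops
  at once. Two measures pay for the refinement. The \<open>potential\<close>, alive vertices plus
  alive non-representatives, is initially at most twice the minimum of \<open>n\<close> and
  \<open>m\<close> and drops with every split and cut; it pays the linear part of each round. The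
  \<open>total_volume\<close>, the in- and out-degrees of alive vertices, is at most
  \<open>2 * m\<close> and drops with every cut by at least the volume that justified its budget; it
  pays the local searches. Trying every vertex as first vertex \<open>h\<close> is complete: if
  \<open>a\<close> cuts something off, let \<open>D\<close> be all it cuts off in the class and
  \<open>h\<close> the first vertex of \<open>D\<close>. Then \<open>a\<close> precedes
  \<open>h\<close>, since otherwise search parents would lead from \<open>h\<close> back to
  \<open>v\<close> avoiding \<open>a\<close>. Once nothing changes, a class with two or more
  vertices is biconnected together with \<open>v\<close>: after deleting \<open>a\<close> other than
  \<open>v\<close> all vertices are connected through \<open>v\<close>, and after deleting
  \<open>v\<close> the strongly connected class remains.\<close>

definition runs :: "nat \<Rightarrow> com \<Rightarrow> state \<Rightarrow> (nat \<Rightarrow> state \<Rightarrow> bool) \<Rightarrow> bool" where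
  "runs W c s Q \<longleftrightarrow> (\<exists>t s'. exec W c s t s' \<and> Q t s')"

text \<open>The simp equations from here on evaluate \<open>runs\<close> on loop-free code like a
  weakest-precondition calculus; the time argument of \<open>Q\<close> accumulates on the
  way.\<close>

lemma runs_Skip [simp]: "runs W Skip s Q \<longleftrightarrow> Q 1 s"
  unfolding runs_def by (auto intro: exec.Skip[unfolded One_nat_def] elim: exec_SkipE)

lemma runs_Assign [simp]: "runs W (Assign x e) s Q \<longleftrightarrow>
    aval e s < W \<and> Q 1 (s\<lparr>regs := (regs s)(x := aval e s)\<rparr>)"
  unfolding runs_def by (auto intro: exec.Assign[unfolded One_nat_def] elim: exec_AssignE)

lemma runs_Store [simp]: "runs W (Store a i e) s Q \<longleftrightarrow>
    aval i s < W \<and> aval e s < W \<and>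
    Q 1 (s\<lparr>arrs := (arrs s)(a := (arrs s a)(aval i s := aval e s))\<rparr>)"
  unfolding runs_def by (auto intro: exec.Store[unfolded One_nat_def] elim: exec_StoreE)

lemma runs_Seq [simp]:
  "runs W (Seq c d) s Q \<longleftrightarrow> runs W c s (\<lambda>t s'. runs W d s' (\<lambda>u. Q (t + u)))"
  unfolding runs_def by (blast intro: exec.Seq elim: exec_SeqE)

lemma runs_If [simp]: "runs W (If b c d) s Q \<longleftrightarrow>
    (if bval b s then runs W c s (\<lambda>t. Q (1 + t)) else runs W d s (\<lambda>t. Q (1 + t)))"
  unfolding runs_def
  by (auto intro: exec.IfTrue[simplified] exec.IfFalse[simplified] elim!: exec_IfE;
    blast intro: exec.IfTrue[simplified] exec.IfFalse[simplified])

text \<open>A normal form for record updates, so that states computed by the simplifier agree with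
  those written out in the proofs.\<close>

lemma update_swap [simp]: "s\<lparr>arrs := a, regs := r\<rparr> = s\<lparr>regs := r, arrs := a\<rparr>" for s :: state
  by (cases s) simp

primrec mod_regs :: "com \<Rightarrow> string set" where
  "mod_regs Skip = {}"
| "mod_regs (Assign x e) = {x}"
| "mod_regs (Store a i e) = {}"
| "mod_regs (Seq c d) = mod_regs c \<union> mod_regs d"
| "mod_regs (If b c d) = mod_regs c \<union> mod_regs d"
| "mod_regs (While b c) = mod_regs c"

primrec mod_arrs :: "com \<Rightarrow> string set" where
  "mod_arrs Skip = {}"
| "mod_arrs (Assign x e) = {}"
| "mod_arrs (Store a i e) = {a}"
| "mod_arrs (Seq c d) = mod_arrs c \<union> mod_arrs d"
| "mod_arrs (If b c d) = mod_arrs c \<union> mod_arrs d"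
| "mod_arrs (While b c) = mod_arrs c"

text \<open>The frame is read off the program text; specifications then mention only what a program
  changes.\<close>

definition unchanged :: "com \<Rightarrow> state \<Rightarrow> state \<Rightarrow> bool" where
  "unchanged c s s' \<longleftrightarrow> (\<forall>x. x \<notin> mod_regs c \<longrightarrow> regs s' x = regs s x) \<and>
     (\<forall>a. a \<notin> mod_arrs c \<longrightarrow> arrs s' a = arrs s a)"

lemma exec_unchanged: "exec W c s t s' \<Longrightarrow> unchanged c s s'"
  by (induction rule: exec.induct) (auto simp: unchanged_def)

lemma unchanged_regs: "unchanged c s s' \<Longrightarrow> x \<notin> mod_regs c \<Longrightarrow> regs s' x = regs s x"
  and unchanged_arrs: "unchanged c s s' \<Longrightarrow> a \<notin> mod_arrs c \<Longrightarrow> arrs s' a = arrs s a"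
  by (auto simp: unchanged_def)

lemma unchanged_refl [simp]: "unchanged c s s"
  and unchanged_trans: "unchanged c s s' \<Longrightarrow> unchanged c s' s'' \<Longrightarrow> unchanged c s s''"
  by (auto simp: unchanged_def)

text \<open>The frame is available in every weakening, because \<open>exec_unchanged\<close> holds
  for any execution.\<close>

lemma runs_conseq:
  assumes "runs W c s Q" "\<And>t s'. Q t s' \<Longrightarrow> unchanged c s s' \<Longrightarrow> R t s'"
  shows "runs W c s R"
  using assms exec_unchanged unfolding runs_def by meson

lemma runs_SeqI:
  assumes "runs W c s (\<lambda>t r. t \<le> a \<and> P r)" "\<And>r. P r \<Longrightarrow> runs W d r (\<lambda>t r. t \<le> b \<and> Q r)"
  shows "runs W (Seq c d) s (\<lambda>t r. t \<le> a + b \<and> Q r)"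
  unfolding runs_Seq
proof (rule runs_conseq[OF assms(1)])
  fix t r assume "t \<le> a \<and> P r"
  with assms(2)[of r] show "runs W d r (\<lambda>u r. t + u \<le> a + b \<and> Q r)"
    by (auto elim!: runs_conseq)
qed

text \<open>For amortised bounds: the time allowed to the last component depends on its final state,
  so a fixed sum as in \<open>runs_SeqI\<close> does not fit. The time already spent is passed on as
  a delay \<open>u\<close> of which only an upper bound is known.\<close>

lemma runs_SeqI_delay:
  assumes "runs W c s (\<lambda>t r. t \<le> a \<and> P r)"
    and "\<And>r. P r \<Longrightarrow> runs W d r (\<lambda>t r. \<forall>u. u \<le> a + b \<longrightarrow> Q (u + t) r)"
  shows "runs W (Seq c d) s (\<lambda>t r. \<forall>u. u \<le> b \<longrightarrow> Q (u + t) r)"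
  unfolding runs_Seq
proof (rule runs_conseq[OF assms(1)], elim conjE)
  fix t r assume t: "t \<le> a" and "P r"
  show "runs W d r (\<lambda>u r. \<forall>w. w \<le> b \<longrightarrow> Q (w + (t + u)) r)"
  proof (rule runs_conseq[OF assms(2)[OF \<open>P r\<close>]], intro allI impI)
    fix u r w assume *: "\<forall>u'. u' \<le> a + b \<longrightarrow> Q (u' + u) r" and "w \<le> b"
    then have "Q ((w + t) + u) r" using t by simp
    then show "Q (w + (t + u)) r" by (simp add: add.assoc)
  qed
qed

text \<open>The invariant carries the elapsed time \<open>t\<close>, which grows by at least one in
  each iteration. Hence the time bound \<open>U\<close> also proves termination, with measure
  \<open>U - t\<close>.\<close>

lemma runs_While:
  assumes "I 0 s"
    and bound: "\<And>t r. I t r \<Longrightarrow> unchanged c s r \<Longrightarrow> t \<le> U"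
    and step: "\<And>t r. I t r \<Longrightarrow> unchanged c s r \<Longrightarrow> bval b r \<Longrightarrow> runs W c r (\<lambda>u. I (t + u + 1))"
    and exit: "\<And>t r. I t r \<Longrightarrow> unchanged c s r \<Longrightarrow> \<not> bval b r \<Longrightarrow> Q (t + 1) r"
  shows "runs W (While b c) s Q"
proof -
  have "\<exists>u s'. exec W (While b c) r u s' \<and> Q (t + u) s'"
    if "I t r" "unchanged c s r" for t r
    using that
  proof (induction "U - t" arbitrary: t r rule: less_induct)
    case less
    show ?case
    proof (cases "bval b r")
      case True
      from step[OF less.prems this] obtain u r' where
        u: "exec W c r u r'" "I (t + u + 1) r'"
        by (auto simp: runs_def)
      have r': "unchanged c s r'"
        using exec_unchanged[OF u(1)] less.prems(2) by (rule unchanged_trans[rotated])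
      have "t + u + 1 \<le> U" using bound[OF u(2) r'] .
      with less.hyps[OF _ u(2) r'] obtain u' s' where
        u': "exec W (While b c) r' u' s'" "Q (t + u + 1 + u') s'"
        by fastforce
      have "t + (1 + u + u') = t + u + 1 + u'" by simp
      with exec.WhileTrue[OF True u(1) u'(1)] u'(2) show ?thesis by metis
    next
      case False
      with exit[OF less.prems] show ?thesis
        by (intro exI[of _ 1] exI[of _ r]) (auto intro: exec.WhileFalse[unfolded One_nat_def])
    qed
  qed
  from this[OF assms(1)] show ?thesis by (simp add: runs_def)
qed

abbreviation "inc x \<equiv> Assign x (Plus (V x) (N 1))"

definition For :: "string \<Rightarrow> aexp \<Rightarrow> com \<Rightarrow> com" where
  "For i e c = Seq (Assign i (N 0)) (While (Less (V i) e) (Seq c (inc i)))"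

lemma mod_For [simp]: "mod_regs (For i e c) = insert i (mod_regs c)" "mod_arrs (For i e c) = mod_arrs c"
  by (auto simp: For_def)

text \<open>In the bound, \<open>2 * n\<close> pays for test and increment of each iteration, and
  the last \<open>2\<close> for the initial assignment and the failing test. Letting
  \<open>B\<close> depend on \<open>k\<close> matters for the output, where only few iterations are
  expensive.\<close>

lemma runs_For:
  assumes "n < W" "0 < W"
    and bnd: "\<And>r. unchanged (For i e c) s r \<Longrightarrow> aval e r = n"
    and init: "I 0 (s\<lparr>regs := (regs s)(i := 0)\<rparr>)"
    and step: "\<And>k r. k < n \<Longrightarrow> I k r \<Longrightarrow> regs r i = k \<Longrightarrow> unchanged (For i e c) s r \<Longrightarrow>
      runs W c r (\<lambda>u r'. u \<le> B k \<and> regs r' i = k \<and> I (Suc k) (r'\<lparr>regs := (regs r')(i := Suc k)\<rparr>))"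
    and exit: "\<And>t r. I n r \<Longrightarrow> regs r i = n \<Longrightarrow> unchanged (For i e c) s r \<Longrightarrow>
      t \<le> (\<Sum>k<n. B k) + 2 * n + 2 \<Longrightarrow> Q t r"
  shows "runs W (For i e c) s Q"
proof -
  let ?s = "s\<lparr>regs := (regs s)(i := 0)\<rparr>"
  let ?b = "Seq c (inc i)"
  have un: "unchanged (For i e c) s r" if "unchanged ?b ?s r" for r
    using that by (auto simp: unchanged_def)
  have "runs W (While (Less (V i) e) ?b) ?s (\<lambda>t. Q (1 + t))"
  proof (rule runs_While[where U = "(\<Sum>k<n. B k) + 2 * n" and
      I = "\<lambda>t r. \<exists>k\<le>n. regs r i = k \<and> I k r \<and> t \<le> (\<Sum>k<k. B k) + 2 * k"])
    show "\<exists>k\<le>n. regs ?s i = k \<and> I k ?s \<and> 0 \<le> (\<Sum>k<k. B k) + 2 * k" using init by auto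
    show "t \<le> (\<Sum>k<n. B k) + 2 * n"
      if "\<exists>k\<le>n. regs r i = k \<and> I k r \<and> t \<le> (\<Sum>k<k. B k) + 2 * k" for t r
    proof -
      from that obtain k where "k \<le> n" "t \<le> (\<Sum>k<k. B k) + 2 * k" by auto
      moreover from this have "(\<Sum>k<k. B k) \<le> (\<Sum>k<n. B k)" by (intro sum_mono2) auto
      ultimately show ?thesis by simp
    qed
  next
    fix t r
    assume A: "\<exists>k\<le>n. regs r i = k \<and> I k r \<and> t \<le> (\<Sum>k<k. B k) + 2 * k"
      and u: "unchanged ?b ?s r" and b: "bval (Less (V i) e) r"
    from A obtain k where k: "k \<le> n" "regs r i = k" "I k r" "t \<le> (\<Sum>k<k. B k) + 2 * k" by auto
    have kN: "k < n" using b bnd[OF un[OF u]] k(2) by simp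
    show "runs W ?b r (\<lambda>u r. \<exists>k\<le>n. regs r i = k \<and> I k r \<and> t + u + 1 \<le> (\<Sum>k<k. B k) + 2 * k)"
      unfolding runs_Seq
      by (rule runs_conseq[OF step[OF kN k(3,2) un[OF u]]]) (use kN k assms(1) in auto)
  next
    fix t r
    assume A: "\<exists>k\<le>n. regs r i = k \<and> I k r \<and> t \<le> (\<Sum>k<k. B k) + 2 * k"
      and u: "unchanged ?b ?s r" and b: "\<not> bval (Less (V i) e) r"
    from A obtain k where k: "k \<le> n" "regs r i = k" "I k r" "t \<le> (\<Sum>k<k. B k) + 2 * k" by auto
    have "k = n" using b bnd[OF un[OF u]] k(1,2) by simp
    with k exit[OF _ _ un[OF u]] show "Q (1 + (t + 1)) r" by auto
  qed
  with assms(2) show ?thesis by (simp add: For_def)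
qed

section \<open>Biconnected vertex sets\<close>

definition sconn :: "'a rel \<Rightarrow> 'a set \<Rightarrow> bool" where
  "sconn E S \<longleftrightarrow> S \<noteq> {} \<and> (\<forall>x\<in>S. \<forall>y\<in>S. (x, y) \<in> rtrancl_on S E)"

definition biconn :: "'a rel \<Rightarrow> 'a set \<Rightarrow> bool" where
  "biconn E C \<longleftrightarrow> 3 \<le> card C \<and> sconn E C \<and> (\<forall>a\<in>C. sconn E (C - {a}))"

lemma sconnD: "sconn E S \<Longrightarrow> x \<in> S \<Longrightarrow> y \<in> S \<Longrightarrow> (x, y) \<in> rtrancl_on S E"
  by (simp add: sconn_def)

lemma biconn_minus: "biconn E C \<Longrightarrow> sconn E (C - {a})"
  by (cases "a \<in> C") (auto simp: biconn_def)

lemma rtrancl_on_subset: "(x, y) \<in> rtrancl_on S E \<Longrightarrow> S \<subseteq> T \<Longrightarrow> (x, y) \<in> rtrancl_on T E"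
  by (induction rule: rtrancl_on_induct) (auto intro: rtrancl_on_into_rtrancl_on)

lemma sconn_converse [simp]: "sconn (E\<inverse>) S = sconn E S"
  unfolding sconn_def by (meson rtrancl_on_converseD rtrancl_on_converseI)

lemma biconn_converse [simp]: "biconn (E\<inverse>) C = biconn E C"
  by (simp add: biconn_def)

lemma sconn_mono:
  assumes "sconn E S" "\<And>x y. (x, y) \<in> E \<Longrightarrow> x \<in> S \<Longrightarrow> y \<in> S \<Longrightarrow> (x, y) \<in> F"
  shows "sconn F S"
proof -
  have "(x, y) \<in> rtrancl_on S F" if "(x, y) \<in> rtrancl_on S E" for x y
    using that by (induction rule: rtrancl_on_induct) (auto intro: rtrancl_on_into_rtrancl_on assms(2))
  with assms(1) show ?thesis by (auto simp: sconn_def)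
qed

lemma strongly_connected_iff_sconn: "strongly_connected H \<longleftrightarrow> sconn (arcs_ends H) (verts H)"
  by (auto simp: strongly_connected_def sconn_def reachable_def)

text \<open>Having three vertices makes the vertex set finite, so \<open>card X < 2\<close> really
  leaves only the empty set and the singletons.\<close>

lemma k_vertex_connected_2_iff:
  "k_vertex_connected 2 H \<longleftrightarrow> biconn (arcs_ends H) (verts H)"
proof -
  have *: "strongly_connected (H \<restriction> S) \<longleftrightarrow> sconn (arcs_ends H) S" for S
    unfolding strongly_connected_iff_sconn induce_subgraph_verts
    by (rule iffI; erule sconn_mono) (auto simp: arcs_ends_def arc_to_ends_def)
  have "(\<forall>X. X \<subset> verts H \<and> card X < 2 \<longrightarrow> sconn (arcs_ends H) (verts H - X)) \<longleftrightarrow>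
      sconn (arcs_ends H) (verts H) \<and> (\<forall>a\<in>verts H. sconn (arcs_ends H) (verts H - {a}))"
    (is "?L \<longleftrightarrow> ?R") if c: "3 \<le> card (verts H)"
  proof
    assume L: ?L
    \<comment> \<open>Only proper subsets may be deleted; a singleton is proper as there are three
      vertices.\<close>
    have "{a} \<noteq> verts H" for a
    proof
      assume "{a} = verts H"
      from c[folded this] show False by simp
    qed
    with c L[rule_format, of "{}"] L show ?R by (auto simp: psubset_eq)
  next
    assume R: ?R
    show ?L
    proof (intro allI impI)
      fix X assume X: "X \<subset> verts H \<and> card X < 2"
      have "finite (verts H)" using c by (intro card_ge_0_finite) simp
      with X have "finite X" by (meson finite_subset psubset_imp_subset)
      with X have "X = {} \<or> (\<exists>a. X = {a})"
        by (metis One_nat_def card_0_eq card_1_singletonE less_2_cases_iff)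
      with X R show "sconn (arcs_ends H) (verts H - X)" by auto
    qed
  qed
  then show ?thesis unfolding k_vertex_connected_def * biconn_def by auto
qed

text \<open>Adding arcs on the same vertices preserves biconnectivity, so each 2-connected subgraph
  may be replaced by the induced one and maximality becomes a matter of vertex sets.\<close>

lemma (in pair_wf_digraph) kvccs_2_iff:
  "C \<in> kvccs 2 (with_proj G) \<longleftrightarrow> C \<subseteq> pverts G \<and> biconn (parcs G) C \<and>
    (\<forall>C'. C \<subseteq> C' \<and> C' \<subseteq> pverts G \<and> biconn (parcs G) C' \<longrightarrow> C' = C)" (is "_ \<longleftrightarrow> ?R")
proof -
  have ind: "k_vertex_connected 2 (with_proj G \<restriction> S) \<longleftrightarrow> biconn (parcs G) S" for S
  proof -
    have "sconn (arcs_ends (with_proj G \<restriction> S)) T \<longleftrightarrow> sconn (parcs G) T" if "T \<subseteq> S" for T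
      by (rule iffI; erule sconn_mono) (use that in \<open>force simp: arcs_ends_def arc_to_ends_def\<close>)+
    then show ?thesis unfolding k_vertex_connected_2_iff biconn_def induce_subgraph_verts
      by (metis Diff_subset order_refl)
  qed
  have sub: "biconn (parcs G) (verts H)" if "subgraph H (with_proj G)" "k_vertex_connected 2 H" for H
  proof -
    have "sconn (parcs G) T" if "sconn (arcs_ends H) T" for T
      using that by (rule sconn_mono)
        (use \<open>subgraph H _\<close> in \<open>auto simp: arcs_ends_def arc_to_ends_def subgraph_def compatible_def\<close>)
    with that(2) show ?thesis by (auto simp: k_vertex_connected_2_iff biconn_def)
  qed
  have sg: "subgraph (with_proj G \<restriction> S) (with_proj G)" if "S \<subseteq> pverts G" for S
    using that subgraph_induce_subgraphI by simp
  show ?thesis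
  proof
    assume "C \<in> kvccs 2 (with_proj G)"
    then obtain H where H: "pre_digraph.max_subgraph (with_proj G) (k_vertex_connected 2) H" "C = verts H"
      by (auto simp: kvccs_def)
    note HC = max_k_vertex_connected_imp_induced[OF H(1)]
    from H(1) have HG: "subgraph H (with_proj G)" "k_vertex_connected 2 H"
      and mx: "\<And>H'. H' \<noteq> H \<Longrightarrow> subgraph H H' \<Longrightarrow> subgraph H' (with_proj G) \<Longrightarrow> \<not> k_vertex_connected 2 H'"
      by (auto simp: pre_digraph.max_subgraph_def)
    have C: "C \<subseteq> pverts G" using HG(1) H(2) by (auto simp: subgraph_def)
    show ?R
    proof (intro conjI allI impI)
      show "C \<subseteq> pverts G" by (rule C)
      show "biconn (parcs G) C" using sub[OF HG] H(2) by simp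
      fix C' assume C': "C \<subseteq> C' \<and> C' \<subseteq> pverts G \<and> biconn (parcs G) C'"
      have "subgraph H (with_proj G \<restriction> C')"
      proof (subst HC)
        have "wf_digraph (with_proj G)" by unfold_locales
        then show "subgraph (with_proj G \<restriction> verts H) (with_proj G \<restriction> C')"
          using C' H(2) by (auto simp: subgraph_def compatible_def wf_digraph.wellformed_induce_subgraph)
      qed
      with mx[of "with_proj G \<restriction> C'"] sg[of C'] ind[of C'] C' have "with_proj G \<restriction> C' = H" by blast
      then show "C' = C" using H(2) induce_subgraph_verts by metis
    qed
  next
    assume R: ?R
    let ?H = "with_proj G \<restriction> C"
    have "pre_digraph.max_subgraph (with_proj G) (k_vertex_connected 2) ?H"
      unfolding pre_digraph.max_subgraph_def
    proof (intro conjI allI impI notI)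
      show "subgraph ?H (with_proj G)" "k_vertex_connected 2 ?H" using R sg ind by auto
      fix H' assume H': "H' \<noteq> ?H \<and> subgraph ?H H'" "subgraph H' (with_proj G) \<and> k_vertex_connected 2 H'"
      have "C \<subseteq> verts H'" "verts H' \<subseteq> pverts G" using H' by (auto simp: subgraph_def)
      with R sub[of H'] H'(2) have C: "verts H' = C" by blast
      \<comment> \<open>\<open>H'\<close> lies between the induced subgraph and \<open>G\<close> on
        the same vertices, so there is no room for further arcs.\<close>
      have "arcs H' = arcs ?H"
      proof
        have "wf_digraph H'" "tail H' = fst" "head H' = snd" "arcs H' \<subseteq> parcs G"
          using H'(2) by (auto simp: subgraph_def compatible_def)
        with C show "arcs H' \<subseteq> arcs ?H"
          using wf_digraph.tail_in_verts[of H'] wf_digraph.head_in_verts[of H'] by auto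
        show "arcs ?H \<subseteq> arcs H'" using H'(1) by (auto simp: subgraph_def)
      qed
      moreover have "tail H' = tail ?H" "head H' = head ?H"
        using H'(2) by (auto simp: subgraph_def compatible_def)
      ultimately have "H' = ?H" using C by (intro pre_digraph.equality) auto
      with H'(1) show False by blast
    qed
    then have "verts ?H \<in> kvccs 2 (with_proj G)" unfolding kvccs_def by (intro imageI CollectI)
    then show "C \<in> kvccs 2 (with_proj G)" by simp
  qed
qed

section \<open>Vertex labellings\<close>

text \<open>A labelling \<open>L\<close> with \<open>L v = v\<close> divides the vertices other than \<open>v\<close> into classes; the vertices
  with label \<open>v\<close> have been discarded.\<close>

definition class_of :: "nat \<Rightarrow> (nat \<Rightarrow> nat) \<Rightarrow> nat \<Rightarrow> nat set" where
  "class_of n L l = {w. w < n \<and> L w = l}"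

text \<open>The correctness invariant of the refinement: no biconnected set through
  \<open>v\<close>, maximal or not, is ever torn apart or touched by a discard.\<close>

definition admissible :: "nat rel \<Rightarrow> nat \<Rightarrow> nat \<Rightarrow> (nat \<Rightarrow> nat) \<Rightarrow> bool" where
  "admissible E n v L \<longleftrightarrow> L v = v \<and>
     (\<forall>S. S \<subseteq> {..<n} \<longrightarrow> biconn E S \<and> v \<in> S \<longrightarrow> (\<exists>l. l \<noteq> v \<and> (\<forall>w \<in> S - {v}. L w = l)))"

lemma admissible_class:
  assumes "admissible E n v L" "S \<subseteq> {..<n}" "biconn E S" "v \<in> S"
  obtains l where "l \<noteq> v" "\<And>w. w \<in> S - {v} \<Longrightarrow> L w = l"
  using assms unfolding admissible_def by meson

lemma admissible_converse [simp]: "admissible (E\<inverse>) n v L = admissible E n v L"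
  by (simp add: admissible_def)

text \<open>\<open>S - {v}\<close> is strongly connected and lies in one class. If it met both
  \<open>R\<close> and its complement, some path would leave \<open>R\<close> along an edge of that
  class. So moving the part of class \<open>y\<close> outside \<open>R\<close> to the label
  \<open>x\<close> tears no such set apart.\<close>

lemma admissible_split:
  assumes "admissible E n v L" "x \<noteq> v" "L' v = v"
    and closed: "\<And>a b. (a, b) \<in> E \<Longrightarrow> a \<in> R \<Longrightarrow> a \<noteq> v \<Longrightarrow> b \<noteq> v \<Longrightarrow> L a = L b \<Longrightarrow> b \<in> R"
    and L': "\<And>w. w < n \<Longrightarrow> L' w = (if w \<notin> R \<and> L w = y then x else L w)"
  shows "admissible E n v L'"
  unfolding admissible_def
proof (intro conjI allI impI)
  fix S assume S: "S \<subseteq> {..<n}" "biconn E S \<and> v \<in> S"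
  from admissible_class[OF assms(1)] S obtain l
    where l: "l \<noteq> v" "\<And>w. w \<in> S - {v} \<Longrightarrow> L w = l" by blast
  have "b \<in> R" if "a \<in> S - {v}" "a \<in> R" "b \<in> S - {v}" for a b
  proof -
    have "(a, b) \<in> rtrancl_on (S - {v}) E" using that S(2) by (intro sconnD[OF biconn_minus]) auto
    then show ?thesis using that(2)
    proof (induction rule: rtrancl_on_induct)
      case (step x y)
      then have "L x = L y" using l(2)[of x] l(2)[of y] by simp
      with step closed[of x y] show ?case by simp
    qed
  qed
  then have "S - {v} \<subseteq> R \<or> S - {v} \<subseteq> - R" by blast
  then show "\<exists>l'. l' \<noteq> v \<and> (\<forall>w\<in>S - {v}. L' w = l')"
  proof
    assume "S - {v} \<subseteq> R"
    then have "L' w = l" if "w \<in> S - {v}" for w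
      using L'[of w] l(2)[OF that] that S(1) by (auto simp: subset_iff)
    with l(1) show ?thesis by blast
  next
    assume "S - {v} \<subseteq> - R"
    then have "L' w = (if l = y then x else l)" if "w \<in> S - {v}" for w
      using L'[of w] l(2)[OF that] that S(1) by (auto simp: subset_iff)
    with l(1) assms(2) show ?thesis by (intro exI[of _ "if l = y then x else l"]) simp
  qed
qed fact

text \<open>With \<open>F\<close> the reversed edge relation: only \<open>a\<close> has an edge from the class of \<open>D\<close> or
  from \<open>v\<close> into \<open>D\<close>, so that \<open>a\<close> dominates \<open>D\<close> from \<open>v\<close>. The vertex \<open>h\<close> is the first one
  of \<open>D\<close> in the search order \<open>ord\<close> and \<open>a\<close> precedes it.\<close>

definition closed_set ::
    "nat rel \<Rightarrow> nat \<Rightarrow> nat \<Rightarrow> (nat \<Rightarrow> nat) \<Rightarrow> (nat \<Rightarrow> nat) \<Rightarrow> nat \<Rightarrow> nat set \<Rightarrow> nat \<Rightarrow> bool" where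
  "closed_set F n v L ord h D a \<longleftrightarrow> h \<in> D \<and> D \<subseteq> class_of n L (L h) \<and> (\<forall>x \<in> D. ord h \<le> ord x) \<and>
     (\<forall>x \<in> D. \<forall>y. (x, y) \<in> F \<longrightarrow> y \<noteq> v \<and> (L y = L h \<longrightarrow> y \<in> D \<or> y = a \<and> ord y < ord h))"

text \<open>If a biconnected \<open>S\<close> through \<open>v\<close> met \<open>D\<close>, some
  path from \<open>v\<close> into \<open>D\<close> would survive the deletion of \<open>a\<close>;
  but \<open>a\<close> is the only entrance to \<open>D\<close> from the rest of the class and
  \<open>v\<close>.\<close>

lemma admissible_cut:
  assumes "admissible E n v L" "closed_set (E\<inverse>) n v L ord h D a" "L h \<noteq> v"
  shows "admissible E n v (\<lambda>w. if w \<in> D then v else L w)"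
  unfolding admissible_def
proof (intro conjI allI impI)
  show "(if v \<in> D then v else L v) = v" using assms(1) by (simp add: admissible_def)
  fix S assume S: "S \<subseteq> {..<n}" "biconn E S \<and> v \<in> S"
  from admissible_class[OF assms(1)] S obtain l
    where l: "l \<noteq> v" "\<And>w. w \<in> S - {v} \<Longrightarrow> L w = l" by blast
  have v: "v \<notin> D" using assms by (auto simp: closed_set_def class_of_def admissible_def)
  \<comment> \<open>\<open>a\<close> lies outside \<open>D\<close> because it precedes
    \<open>h\<close>, the first vertex of \<open>D\<close>.\<close>
  have D: "x \<noteq> v \<and> (L x = L h \<longrightarrow> x \<in> D \<or> x = a \<and> x \<notin> D)" if "(x, y) \<in> E" "y \<in> D" for x y
    using assms(2) that unfolding closed_set_def by auto
  have "w \<notin> D" if w: "w \<in> S" for w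
  proof
    assume wD: "w \<in> D"
    with assms(2) have "L w = L h" by (auto simp: closed_set_def class_of_def)
    with l(2)[of w] w wD v have lh: "l = L h" by auto
    \<comment> \<open>\<open>a\<close> is deleted only if that spares \<open>v\<close> and
      \<open>w\<close>. In the other cases no edge inside \<open>S\<close> enters \<open>D\<close>
      anyway.\<close>
    define T where "T = (if a \<in> S - {v} - D then S - {a} else S)"
    have "sconn E T" "v \<in> T" "w \<in> T" "T \<subseteq> S"
      using S(2) w wD biconn_minus[of E S a] by (auto simp: T_def biconn_def)
    from sconnD[OF this(1-3)] have "w \<notin> D"
    proof (induction rule: rtrancl_on_induct)
      case base
      show ?case by (rule v)
    next
      case (step x y)
      show ?case
      proof
        assume "y \<in> D"
        with D[OF step(2)] step(5) have "x \<noteq> v" "L x = L h \<longrightarrow> x = a" by auto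
        with l(2)[of x] step(3) \<open>T \<subseteq> S\<close> lh have "x = a" "a \<in> S - {v} - D" using step(5) by auto
        with step(3) show False by (simp add: T_def)
      qed
    qed
    with wD show False by simp
  qed
  with l show "\<exists>l. l \<noteq> v \<and> (\<forall>w\<in>S - {v}. (if w \<in> D then v else L w) = l)"
    by (intro exI[of _ l]) auto
qed

text \<open>The label is the root of its class. As \<open>rtrancl_on\<close> confines both endpoints
  to the set, \<open>L w\<close> must belong to its own class. Together with the same condition for
  \<open>E\<inverse>\<close> this gives strong connectivity.\<close>

definition split_stable :: "nat rel \<Rightarrow> nat \<Rightarrow> nat \<Rightarrow> (nat \<Rightarrow> nat) \<Rightarrow> bool" where
  "split_stable E n v L \<longleftrightarrow> (\<forall>w<n. L w \<noteq> v \<longrightarrow> (L w, w) \<in> rtrancl_on (class_of n L (L w)) E)"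

text \<open>In the subgraph on \<open>v\<close> and the class of \<open>w\<close>, no vertex
  \<open>a\<close> other than \<open>v\<close> and \<open>w\<close> dominates \<open>w\<close> from
  \<open>v\<close>.\<close>

definition cut_stable :: "nat rel \<Rightarrow> nat \<Rightarrow> nat \<Rightarrow> (nat \<Rightarrow> nat) \<Rightarrow> bool" where
  "cut_stable E n v L \<longleftrightarrow> (\<forall>w<n. \<forall>a. L w \<noteq> v \<longrightarrow> a \<noteq> v \<longrightarrow> a \<noteq> w \<longrightarrow>
     (v, w) \<in> rtrancl_on (insert v (class_of n L (L w)) - {a}) E)"

text \<open>Deleting \<open>a\<close> other than \<open>v\<close> leaves paths to and from
  \<open>v\<close> for all remaining vertices, by \<open>cut_stable\<close> in both directions;
  deleting \<open>v\<close> is covered by \<open>split_stable\<close>; the undeleted set follows by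
  monotonicity.\<close>

lemma biconn_class:
  assumes "L v = v" "l \<noteq> v" "2 \<le> card (class_of n L l)"
    and split: "split_stable E n v L" "split_stable (E\<inverse>) n v L"
    and cut: "cut_stable E n v L" "cut_stable (E\<inverse>) n v L"
  shows "biconn E (insert v (class_of n L l))"
proof -
  let ?A = "class_of n L l"
  let ?C = "insert v ?A"
  have v: "v \<notin> ?A" using assms(1,2) by (auto simp: class_of_def)
  have fin: "finite ?A" by (simp add: class_of_def)
  have to: "(v, w) \<in> rtrancl_on (?C - {a}) E" "(w, v) \<in> rtrancl_on (?C - {a}) E"
    if "w \<in> ?A" "a \<noteq> v" "a \<noteq> w" for w a
    using that assms(2) cut(1)
    by (auto simp: cut_stable_def class_of_def)
      (rule rtrancl_on_converseD, use that assms(2) cut(2) in \<open>auto simp: cut_stable_def class_of_def\<close>)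
  have A: "(x, y) \<in> rtrancl_on ?A E" if "x \<in> ?A" "y \<in> ?A" for x y
  proof -
    have "(x, l) \<in> rtrancl_on ?A E" "(l, y) \<in> rtrancl_on ?A E"
      using that assms(2) split(1)
      by (auto simp: split_stable_def class_of_def)
        (rule rtrancl_on_converseD, use that assms(2) split(2) in \<open>auto simp: split_stable_def class_of_def\<close>)
    then show ?thesis by (rule rtrancl_on_trans)
  qed
  have ne: "\<exists>w\<in>?A. w \<noteq> a" for a
    using assms(3) fin by (metis card_2_iff' card_le_Suc0_iff_eq not_less_eq_eq numeral_2_eq_2)
  have "sconn E (?C - {a})" if "a \<noteq> v" for a
  proof -
    have v: "v \<in> ?C - {a}" using that by simp
    have "(x, v) \<in> rtrancl_on (?C - {a}) E \<and> (v, x) \<in> rtrancl_on (?C - {a}) E" if x: "x \<in> ?C - {a}" for x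
      using to[of x a] x \<open>a \<noteq> v\<close> v by (cases "x = v") auto
    then show ?thesis using v unfolding sconn_def by (metis empty_iff rtrancl_on_trans)
  qed
  moreover have "sconn E (?C - {v})"
    using A ne v by (auto simp: sconn_def)
  moreover have "sconn E ?C"
  proof -
    have "(x, v) \<in> rtrancl_on ?C E \<and> (v, x) \<in> rtrancl_on ?C E" if x: "x \<in> ?C" for x
    proof (cases "x = v")
      case False
      with x have xA: "x \<in> ?A" by simp
      \<comment> \<open>With two vertices in the class there is one other than \<open>x\<close> to
        delete, so that \<open>to\<close> applies; the paths then survive in the larger set.\<close>
      obtain a where "a \<in> ?A" "a \<noteq> x" using ne by blast
      with v xA to[of x a] show ?thesis
        by (metis Diff_subset rtrancl_on_subset)
    qed simp
    then show ?thesis unfolding sconn_def by (metis empty_not_insert rtrancl_on_trans)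
  qed
  moreover have "3 \<le> card ?C" using assms(3) v fin by simp
  ultimately show ?thesis unfolding biconn_def by metis
qed

text \<open>Admissibility confines each biconnected set through \<open>v\<close> to one class, and
  by stability each class of size at least two is biconnected with \<open>v\<close>. Such sets are
  thus exactly the maximal ones. Size two corresponds to the three vertices of
  \<open>biconn\<close>.\<close>

lemma kvccs_2_containing:
  fixes G :: "nat pair_pre_digraph"
  assumes "pair_wf_digraph G" "pverts G = {..<n}" "v < n"
    and resp: "admissible (parcs G) n v L"
    and split: "split_stable (parcs G) n v L" "split_stable ((parcs G)\<inverse>) n v L"
    and cut: "cut_stable (parcs G) n v L" "cut_stable ((parcs G)\<inverse>) n v L"
  shows "{C \<in> kvccs 2 (with_proj G). v \<in> C} =
    (\<lambda>l. insert v (class_of n L l)) ` {l. l < n \<and> L l = l \<and> l \<noteq> v \<and> 2 \<le> card (class_of n L l)}"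
    (is "?L = ?R")
proof -
  interpret pair_wf_digraph G by fact
  let ?E = "parcs G"
  have Lv: "L v = v" using resp by (simp add: admissible_def)
  have sub: "\<exists>l. l < n \<and> L l = l \<and> l \<noteq> v \<and> 2 \<le> card (class_of n L l) \<and> S \<subseteq> insert v (class_of n L l)"
    if S: "S \<subseteq> {..<n}" "biconn ?E S" "v \<in> S" for S
  proof -
    from admissible_class[OF resp S] obtain l
      where l: "l \<noteq> v" "\<And>w. w \<in> S - {v} \<Longrightarrow> L w = l" by blast
    have sub: "S - {v} \<subseteq> class_of n L l" using S l by (auto simp: class_of_def)
    have "3 \<le> card S" using S(2) by (simp add: biconn_def)
    then have "2 \<le> card (S - {v})" using S(3) by simp
    also have "\<dots> \<le> card (class_of n L l)" using sub by (intro card_mono) (auto simp: class_of_def)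
    finally have c: "2 \<le> card (class_of n L l)" .
    then have "class_of n L l \<noteq> {}" by auto
    then obtain w where w: "w < n" "L w = l" by (auto simp: class_of_def)
    with split(1) l(1) have "(l, w) \<in> rtrancl_on (class_of n L l) ?E" by (auto simp: split_stable_def)
    then have "l \<in> class_of n L l" by (rule in_rtrancl_on_in_F)
    with l(1) c sub show ?thesis by (auto simp: class_of_def)
  qed
  have bic: "biconn ?E (insert v (class_of n L l))" if "l \<noteq> v" "2 \<le> card (class_of n L l)" for l
    using biconn_class[OF Lv that split cut] .
  have le: "insert v (class_of n L l) \<subseteq> {..<n}" for l using assms(3) by (auto simp: class_of_def)
  show ?thesis
  proof (intro equalityI subsetI)
    fix C assume "C \<in> ?L"
    then have C: "C \<subseteq> {..<n}" "biconn ?E C" "v \<in> C"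
      and mx: "\<And>C'. C \<subseteq> C' \<Longrightarrow> C' \<subseteq> {..<n} \<Longrightarrow> biconn ?E C' \<Longrightarrow> C' = C"
      using assms(2) by (auto simp: kvccs_2_iff)
    from sub[OF C] obtain l where "l < n" "L l = l" "l \<noteq> v" "2 \<le> card (class_of n L l)"
      "C \<subseteq> insert v (class_of n L l)" by blast
    with mx[OF _ le bic] show "C \<in> ?R" by blast
  next
    fix C assume "C \<in> ?R"
    then obtain l where l: "l < n" "L l = l" "l \<noteq> v" "2 \<le> card (class_of n L l)"
      and C: "C = insert v (class_of n L l)" by blast
    have "C' = C" if C': "C \<subseteq> C'" "C' \<subseteq> {..<n}" "biconn ?E C'" for C'
    proof -
      from C C' have "v \<in> C'" by auto
      with sub[of C'] C' obtain l' where l': "C' \<subseteq> insert v (class_of n L l')" by blast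
      have "l \<in> C'" using l C C' by (auto simp: class_of_def)
      with l' l have "l' = l" by (auto simp: class_of_def)
      with l' C C' show ?thesis by auto
    qed
    with le bic l C assms(2) show "C \<in> ?L" by (auto simp: kvccs_2_iff)
  qed
qed

text \<open>Completeness of the search for closed sets: a violation of \<open>cut_stable\<close>
  yields one, namely everything in the class that is unreached by the search, or else everything
  that \<open>a\<close> cuts off. Here \<open>ord x < n\<close> means that the search has reached
  \<open>x\<close>.\<close>

lemma cut_stable_if_no_closed_set:
  fixes ord :: "nat \<Rightarrow> nat"
  assumes Lv: "L v = v" and vn: "v < n" and En: "E \<subseteq> {..<n} \<times> {..<n}"
    and v0: "ord v < n"
    and closure: "\<And>x y. (x, y) \<in> E \<Longrightarrow> ord x < n \<Longrightarrow> x = v \<or> L x = L y \<Longrightarrow> ord y < n"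
    and parent: "\<And>w. w < n \<Longrightarrow> ord w < n \<Longrightarrow> w \<noteq> v \<Longrightarrow>
      \<exists>p. (p, w) \<in> E \<and> ord p < ord w \<and> (p = v \<or> L p = L w)"
    and none: "\<And>h D a. h < n \<Longrightarrow> L h \<noteq> v \<Longrightarrow> \<not> closed_set (E\<inverse>) n v L ord h D a"
  shows "cut_stable E n v L"
proof -
  have "ord w < n" if w: "w < n" "L w \<noteq> v" for w
  proof (rule ccontr)
    assume "\<not> ord w < n"
    \<comment> \<open>Nothing reached has an edge into the unreached part of the class, so this set
      is closed whatever \<open>a\<close> is.\<close>
    define D where "D = {x \<in> class_of n L (L w). n \<le> ord x}"
    define h where "h = arg_min ord (\<lambda>x. x \<in> D)"
    have "w \<in> D" using w \<open>\<not> ord w < n\<close> by (auto simp: D_def class_of_def)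
    then have hD: "h \<in> D" and hmin: "\<And>x. x \<in> D \<Longrightarrow> ord h \<le> ord x"
      unfolding h_def by (auto intro: arg_min_natI arg_min_nat_le)
    then have h: "h < n" "L h = L w" by (auto simp: D_def class_of_def)
    have "closed_set (E\<inverse>) n v L ord h D a" for a
      unfolding closed_set_def
    proof (intro conjI ballI allI impI)
      show "h \<in> D" "\<And>x. x \<in> D \<Longrightarrow> ord h \<le> ord x" by fact+
      show "D \<subseteq> class_of n L (L h)" using h by (auto simp: D_def class_of_def)
      fix x y assume x: "x \<in> D" "(x, y) \<in> E\<inverse>"
      show "y \<noteq> v" using x closure[of y x] v0 by (auto simp: D_def)
      assume "L y = L h"
      then have "y \<in> D" using x closure[of y x] h En by (force simp: D_def class_of_def)
      then show "y \<in> D \<or> y = a \<and> ord y < ord h" ..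
    qed
    with none[of h] h w show False by auto
  qed note reached = this
  show ?thesis
    unfolding cut_stable_def
  proof (intro allI impI)
    fix w a assume w: "w < n" "L w \<noteq> v" and a: "a \<noteq> v" "a \<noteq> w"
    let ?S = "insert v (class_of n L (L w)) - {a}"
    show "(v, w) \<in> rtrancl_on ?S E"
    proof (rule ccontr)
      assume nw: "(v, w) \<notin> rtrancl_on ?S E"
      \<comment> \<open>All that \<open>a\<close> cuts off in the class, not only \<open>w\<close>:
        this makes \<open>D\<close> closed with \<open>a\<close> as the only exception.\<close>
      define D where "D = {x \<in> class_of n L (L w). x \<noteq> a \<and> (v, x) \<notin> rtrancl_on ?S E}"
      define h where "h = arg_min ord (\<lambda>x. x \<in> D)"
      have "w \<in> D" using w a nw by (auto simp: D_def class_of_def)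
      then have hD: "h \<in> D" and hmin: "\<And>x. x \<in> D \<Longrightarrow> ord h \<le> ord x"
        unfolding h_def by (auto intro: arg_min_natI arg_min_nat_le)
      then have h: "h < n" "L h = L w" by (auto simp: D_def class_of_def)
      have vS: "(v, v) \<in> rtrancl_on ?S E" using a by auto
      \<comment> \<open>Otherwise the parents of any vertex up to \<open>h\<close>, having smaller
        order numbers, avoid \<open>a\<close>, and following them to \<open>v\<close> shows that
        \<open>h\<close> is not cut off.\<close>
      have "ord a < ord h"
      proof (rule ccontr)
        assume na: "\<not> ord a < ord h"
        have "(v, x) \<in> rtrancl_on ?S E" if "x \<in> class_of n L (L w)" "x \<noteq> a" "ord x \<le> ord h" for x
          using that
        proof (induction "ord x" arbitrary: x rule: less_induct)
          case less
          then have x: "x < n" "L x = L w" by (auto simp: class_of_def)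
          with reached[of x] w Lv have "ord x < n" "x \<noteq> v" by auto
          from parent[OF x(1) this] obtain p where p: "(p, x) \<in> E" "ord p < ord x" "p = v \<or> L p = L x" by blast
          have "(v, p) \<in> rtrancl_on ?S E"
          proof (cases "p = v")
            case False
            then have "p \<in> class_of n L (L w)" using p x En by (auto simp: class_of_def)
            moreover have "p \<noteq> a" using p(2) na less.prems(3) by auto
            ultimately show ?thesis using less.hyps p(2) less.prems(3) by simp
          qed (simp add: vS)
          then show ?case using p(1) by (rule rtrancl_on_into_rtrancl_on) (use less.prems in auto)
        qed
        with hD show False by (auto simp: D_def)
      qed note ah = this
      have "closed_set (E\<inverse>) n v L ord h D a"
        unfolding closed_set_def
      proof (intro conjI ballI allI impI)
        show "h \<in> D" "\<And>x. x \<in> D \<Longrightarrow> ord h \<le> ord x" by fact+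
        show "D \<subseteq> class_of n L (L h)" using h by (auto simp: D_def)
        fix x y assume x: "x \<in> D" "(x, y) \<in> E\<inverse>"
        have *: "(v, y) \<notin> rtrancl_on ?S E"
        proof
          assume "(v, y) \<in> rtrancl_on ?S E"
          then have "(v, x) \<in> rtrancl_on ?S E"
            by (rule rtrancl_on_into_rtrancl_on) (use x in \<open>auto simp: D_def\<close>)
          with x show False by (simp add: D_def)
        qed
        show "y \<noteq> v" using * vS by metis
        assume "L y = L h"
        with * h x En ah show "y \<in> D \<or> y = a \<and> ord y < ord h" by (auto simp: D_def class_of_def)
      qed
      with none[of h] h w show False by auto
    qed
  qed
qed

section \<open>Scanning adjacency lists\<close>

text \<open>Indices are decreasing since the linked lists arise by prepending the edges in
  increasing order.\<close>

definition outs :: "(nat \<times> nat) list \<Rightarrow> nat \<Rightarrow> nat list" where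
  "outs xs u = filter (\<lambda>j. fst (xs ! j) = u) (rev [0..<length xs])"

abbreviation "deg xs u \<equiv> length (outs xs u)"

lemma set_outs: "set (outs xs u) = {j. j < length xs \<and> fst (xs ! j) = u}"
  by (auto simp: outs_def)

lemma distinct_outs: "distinct (outs xs u)"
  by (simp add: outs_def)

lemma deg_eq_card: "deg xs u = card {j. j < length xs \<and> fst (xs ! j) = u}"
  using distinct_card[OF distinct_outs] by (metis set_outs)

lemma sum_deg_le: "finite S \<Longrightarrow> (\<Sum>u\<in>S. deg xs u) \<le> length xs"
proof -
  assume "finite S"
  then have "(\<Sum>u\<in>S. deg xs u) = card (\<Union>u\<in>S. {j. j < length xs \<and> fst (xs ! j) = u})"
    unfolding deg_eq_card by (subst card_UN_disjoint) auto
  also have "\<dots> \<le> card {..<length xs}" by (intro card_mono) auto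
  finally show ?thesis by simp
qed

primrec chain :: "(nat \<Rightarrow> nat) \<Rightarrow> nat \<Rightarrow> nat list \<Rightarrow> bool" where
  "chain nx e [] \<longleftrightarrow> e = 0"
| "chain nx e (j # js) \<longleftrightarrow> e = Suc j \<and> chain nx (nx j) js"

text \<open>Pointers are shifted by one, \<open>0\<close> being the null pointer.\<close>

definition adj_repr :: "nat \<Rightarrow> (nat \<times> nat) list \<Rightarrow> string \<Rightarrow> string \<Rightarrow> string \<Rightarrow> state \<Rightarrow> bool" where
  "adj_repr n xs H X T s \<longleftrightarrow> (\<forall>u<n. chain (arrs s X) (arrs s H u) (outs xs u)) \<and>
     (\<forall>j<length xs. arrs s T j = snd (xs ! j))"

text \<open>The adjacency lists of \<open>f p\<^sub>0, f (p\<^sub>0 + 1), \<dots>, f (p - 1)\<close> are being scanned, and the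
  pointer \<open>e\<close> leads to the unread rest of the last one; \<open>J\<close> is the set and \<open>c\<close> the number of
  the edges read so far.\<close>

definition scanning ::
    "(nat \<times> nat) list \<Rightarrow> (nat \<Rightarrow> nat) \<Rightarrow> (nat \<Rightarrow> nat) \<Rightarrow> nat \<Rightarrow> nat \<Rightarrow> nat \<Rightarrow> nat set \<Rightarrow> nat \<Rightarrow> bool" where
  "scanning xs nx f p0 p e J c \<longleftrightarrow> (\<exists>r. chain nx e r \<and>
     (r \<noteq> [] \<longrightarrow> p0 < p \<and> (\<exists>r'. outs xs (f (p - 1)) = r' @ r)) \<and>
     J = {j. \<exists>i. p0 \<le> i \<and> i < p \<and> j \<in> set (outs xs (f i)) \<and> \<not> (i = p - 1 \<and> j \<in> set r)} \<and>
     c + length r = (\<Sum>i=p0..<p. deg xs (f i)))"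

lemma scanning_init: "scanning xs nx f p0 p0 0 {} 0"
  by (auto simp: scanning_def intro!: exI[of _ "[]"])

lemma scanning_cong:
  assumes "scanning xs nx f p0 p e J c" "\<And>i. i < p \<Longrightarrow> g i = f i"
  shows "scanning xs nx g p0 p e J c"
proof -
  from assms(1) obtain r where r: "chain nx e r"
    "r \<noteq> [] \<longrightarrow> p0 < p \<and> (\<exists>r'. outs xs (f (p - 1)) = r' @ r)"
    "J = {j. \<exists>i. p0 \<le> i \<and> i < p \<and> j \<in> set (outs xs (f i)) \<and> \<not> (i = p - 1 \<and> j \<in> set r)}"
    "c + length r = (\<Sum>i=p0..<p. deg xs (f i))"
    unfolding scanning_def by blast
  have "(\<Sum>i=p0..<p. deg xs (g i)) = (\<Sum>i=p0..<p. deg xs (f i))"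
    using assms(2) by (intro sum.cong) auto
  moreover have "p0 < p \<Longrightarrow> g (p - 1) = f (p - 1)" using assms(2) by simp
  moreover have "J = {j. \<exists>i. p0 \<le> i \<and> i < p \<and> j \<in> set (outs xs (g i)) \<and> \<not> (i = p - 1 \<and> j \<in> set r)}"
    unfolding r(3) using assms(2) by (intro Collect_cong ex_cong) auto
  ultimately show ?thesis using r(1,2,4) unfolding scanning_def by (intro exI[of _ r]) auto
qed

lemma scanning_pop:
  assumes "scanning xs nx f p0 p 0 J c" "chain nx e (outs xs (f p))" "p0 \<le> p"
  shows "scanning xs nx f p0 (Suc p) e J c"
proof -
  from assms(1) obtain r where r: "chain nx 0 r"
    "J = {j. \<exists>i. p0 \<le> i \<and> i < p \<and> j \<in> set (outs xs (f i)) \<and> \<not> (i = p - 1 \<and> j \<in> set r)}"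
    "c + length r = (\<Sum>i=p0..<p. deg xs (f i))"
    unfolding scanning_def by blast
  have "r = []" using r(1) by (cases r) auto
  with r assms(2,3) show ?thesis
    unfolding scanning_def
    by (intro exI[of _ "outs xs (f p)"]) (auto simp: less_Suc_eq)
qed

lemma scanning_step:
  assumes "scanning xs nx f p0 p (Suc j) J c"
  shows "j < length xs" "fst (xs ! j) = f (p - 1)" "p0 < p"
    "scanning xs nx f p0 p (nx j) (insert j J) (Suc c)"
proof -
  from assms obtain r where r: "chain nx (Suc j) r" "r \<noteq> [] \<longrightarrow> p0 < p \<and> (\<exists>r'. outs xs (f (p - 1)) = r' @ r)"
    "J = {j. \<exists>i. p0 \<le> i \<and> i < p \<and> j \<in> set (outs xs (f i)) \<and> \<not> (i = p - 1 \<and> j \<in> set r)}"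
    "c + length r = (\<Sum>i=p0..<p. deg xs (f i))"
    unfolding scanning_def by blast
  obtain js where js: "r = j # js" "chain nx (nx j) js" using r(1) by (cases r) auto
  from r(2) js obtain r' where r': "outs xs (f (p - 1)) = r' @ j # js" and p: "p0 < p" by auto
  then have "j \<in> set (outs xs (f (p - 1)))" by simp
  then show "j < length xs" "fst (xs ! j) = f (p - 1)" by (auto simp: set_outs)
  show "p0 < p" by (rule p)
  have "j \<notin> set js" using distinct_outs[of xs "f (p - 1)"] unfolding r' by simp
  then have "insert j J = {j. \<exists>i. p0 \<le> i \<and> i < p \<and> j \<in> set (outs xs (f i)) \<and> \<not> (i = p - 1 \<and> j \<in> set js)}"
    (is "_ = ?J'")
  proof (intro set_eqI iffI)
    fix k assume "k \<in> insert j J"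
    then consider "k = j" | "k \<in> J" by auto
    then show "k \<in> ?J'"
    proof cases
      case 1
      with p r' \<open>j \<notin> set js\<close> show ?thesis by (intro CollectI exI[of _ "p - 1"]) simp
    next
      case 2
      then show ?thesis unfolding r(3) js(1) by auto
    qed
  next
    fix k assume "k \<in> ?J'"
    then show "k \<in> insert j J" unfolding r(3) js(1) by auto
  qed
  moreover have "\<exists>r'. outs xs (f (p - 1)) = r' @ js" using r' by (intro exI[of _ "r' @ [j]"]) simp
  ultimately show "scanning xs nx f p0 p (nx j) (insert j J) (Suc c)"
    unfolding scanning_def using js r(4) p by (intro exI[of _ js]) auto
qed

lemma scanning_end:
  assumes "scanning xs nx f p0 p 0 J c"
  shows "J = {j. j < length xs \<and> (\<exists>i. p0 \<le> i \<and> i < p \<and> fst (xs ! j) = f i)}"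
    "c = (\<Sum>i=p0..<p. deg xs (f i))"
proof -
  from assms obtain r where r: "chain nx 0 r"
    "J = {j. \<exists>i. p0 \<le> i \<and> i < p \<and> j \<in> set (outs xs (f i)) \<and> \<not> (i = p - 1 \<and> j \<in> set r)}"
    "c + length r = (\<Sum>i=p0..<p. deg xs (f i))"
    unfolding scanning_def by blast
  have "r = []" using r(1) by (cases r) auto
  with r show "J = {j. j < length xs \<and> (\<exists>i. p0 \<le> i \<and> i < p \<and> fst (xs ! j) = f i)}"
    "c = (\<Sum>i=p0..<p. deg xs (f i))"
    by (auto simp: set_outs)
qed

lemma scanning_le: "scanning xs nx f p0 p e J c \<Longrightarrow> c \<le> (\<Sum>i=p0..<p. deg xs (f i))"
  by (auto simp: scanning_def)

section \<open>Breadth-first search\<close>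

text \<open>The order number doubles as visited mark: it is the queue position if below
  \<open>n\<close>, and any larger value means unvisited.\<close>

definition queue_ok :: "nat \<Rightarrow> (nat \<Rightarrow> nat) \<Rightarrow> (nat \<Rightarrow> nat) \<Rightarrow> nat \<Rightarrow> bool" where
  "queue_ok n ord Q q \<longleftrightarrow> (\<forall>i<q. Q i < n \<and> ord (Q i) = i) \<and> (\<forall>w<n. ord w < n \<longrightarrow> ord w < q \<and> Q (ord w) = w)"

lemma queue_inj: "queue_ok n ord Q q \<Longrightarrow> inj_on Q {..<q}"
  by (rule inj_on_inverseI[of _ ord]) (auto simp: queue_ok_def)

lemma queue_le: assumes "queue_ok n ord Q q" shows "q \<le> n"
proof -
  have "Q ` {..<q} \<subseteq> {..<n}" using assms by (auto simp: queue_ok_def)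
  from card_inj_on_le[OF queue_inj[OF assms] this] show ?thesis by simp
qed

text \<open>By pigeonhole: as long as some vertex is unvisited, the queue has fewer than
  \<open>n\<close> entries, so the new position is again a valid mark.\<close>

lemma queue_push:
  assumes "queue_ok n ord Q q" "y < n" "n \<le> ord y"
  shows "q < n" "queue_ok n (ord(y := q)) (Q(q := y)) (Suc q)"
proof -
  have "y \<notin> Q ` {..<q}" using assms queue_le[OF assms(1)] by (auto simp: queue_ok_def)
  then have "Q ` {..<q} \<subseteq> {..<n} - {y}" using assms by (auto simp: queue_ok_def)
  from card_inj_on_le[OF queue_inj[OF assms(1)] this] have "q \<le> card ({..<n} - {y})" by simp
  then show "q < n" using assms(2) by simp
  then show "queue_ok n (ord(y := q)) (Q(q := y)) (Suc q)"
    using assms unfolding queue_ok_def by (auto simp: less_Suc_eq)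
qed

text \<open>One search from \<open>v\<close> serves all classes at once: edges at \<open>v\<close>
  may enter any class, all other edges must stay inside theirs.\<close>

abbreviation follows :: "nat \<Rightarrow> (nat \<Rightarrow> nat) \<Rightarrow> nat \<Rightarrow> nat \<Rightarrow> bool" where
  "follows v L x y \<equiv> x = v \<or> L x = L y"

text \<open>The nested loop over vertices and their edges is flattened: an iteration either takes a
  vertex from the queue or reads one edge, so that iterations count vertices plus edges.\<close>

definition "search_body H X T =
  If (Eq (V ''e'') (N 0))
    (Seq (Assign ''x'' (A ''Q'' (V ''p'')))
    (Seq (inc ''p'')
      (Assign ''e'' (A H (V ''x'')))))
    (Seq (Assign ''y'' (A T (Minus (V ''e'') (N 1))))
    (Seq (If (And (Not (Less (A ''O'' (V ''y'')) (V ''n'')))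
            (Not (And (Not (Eq (V ''x'') (V ''v''))) (Not (Eq (A ''L'' (V ''x'')) (A ''L'' (V ''y'')))))))
          (Seq (Store ''O'' (V ''y'') (V ''q''))
          (Seq (Store ''Q'' (V ''q'') (V ''y''))
            (inc ''q'')))
          Skip)
      (Assign ''e'' (A X (Minus (V ''e'') (N 1))))))"

definition "search H X T = Seq (Assign ''e'' (N 0))
  (While (Not (And (Eq (V ''e'') (N 0)) (Not (Less (V ''p'') (V ''q''))))) (search_body H X T))"

lemma mod_search_body [simp]:
  "mod_regs (search_body H X T) = {''e'', ''x'', ''y'', ''p'', ''q''}"
  "mod_arrs (search_body H X T) = {''O'', ''Q''}"
  by (auto simp: search_body_def)

lemma mod_search [simp]:
  "mod_regs (search H X T) = {''e'', ''x'', ''y'', ''p'', ''q''}"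
  "mod_arrs (search H X T) = {''O'', ''Q''}"
  by (auto simp: search_def)

text \<open>\<open>p0\<close> and \<open>q0\<close> are the initial head and end of the queue.
  Entries before \<open>q0\<close> are seeds and need no parent; entries before \<open>p0\<close>
  count as visited but are never expanded.\<close>

definition search_inv where
  "search_inv xs n v L nx Q0 p0 q0 s J c \<longleftrightarrow>
     scanning xs nx (arrs s ''Q'') p0 (regs s ''p'') (regs s ''e'') J c \<and>
     queue_ok n (arrs s ''O'') (arrs s ''Q'') (regs s ''q'') \<and>
     p0 \<le> regs s ''p'' \<and> regs s ''p'' \<le> regs s ''q'' \<and> q0 \<le> regs s ''q'' \<and>
     (regs s ''e'' \<noteq> 0 \<longrightarrow> regs s ''x'' = arrs s ''Q'' (regs s ''p'' - 1)) \<and>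
     (\<forall>j\<in>J. follows v L (fst (xs ! j)) (snd (xs ! j)) \<longrightarrow> arrs s ''O'' (snd (xs ! j)) < n) \<and>
     (\<forall>i. q0 \<le> i \<and> i < regs s ''q'' \<longrightarrow> (\<exists>k. p0 \<le> k \<and> k < i \<and>
        (arrs s ''Q'' k, arrs s ''Q'' i) \<in> set xs \<and> follows v L (arrs s ''Q'' k) (arrs s ''Q'' i))) \<and>
     (\<forall>i<q0. arrs s ''Q'' i = Q0 i)"

text \<open>Taking a vertex and reading an edge both raise \<open>p + c\<close> by exactly one,
  which makes the whole search linear. The longest branch, with \<open>7\<close> steps, pushes a
  vertex.\<close>

lemma search_step:
  assumes inv: "search_inv xs n v L nx Q0 p0 q0 s J c"
    and b: "regs s ''e'' \<noteq> 0 \<or> regs s ''p'' < regs s ''q''"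
    and g: "adj_repr n xs H X T s" "arrs s X = nx" "arrs s ''L'' = L" "regs s ''n'' = n" "regs s ''v'' = v"
    and X: "X \<noteq> ''O''" "X \<noteq> ''Q''"
    and xs: "set xs \<subseteq> {..<n} \<times> {..<n}" and W: "n + length xs + 2 < W"
    and nx: "\<And>j. j < length xs \<Longrightarrow> nx j \<le> length xs" and hd: "\<And>u. u < n \<Longrightarrow> arrs s H u \<le> length xs"
  shows "runs W (search_body H X T) s (\<lambda>t s'. t \<le> 7 \<and>
    (\<exists>J' c'. search_inv xs n v L nx Q0 p0 q0 s' J' c' \<and> regs s' ''p'' + c' = Suc (regs s ''p'' + c)))"
proof (cases "regs s ''e'' = 0")
  case True
  define p where "p = regs s ''p''"
  let ?u = "arrs s ''Q'' p"
  have pq: "p < regs s ''q''" using b True by (simp add: p_def)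
  have u: "?u < n" using inv pq by (auto simp: search_inv_def queue_ok_def)
  have pn: "p < n" using inv pq queue_le unfolding search_inv_def by fastforce
  have "scanning xs nx (arrs s ''Q'') p0 (Suc p) (arrs s H ?u) J c"
    using inv True g u by (intro scanning_pop) (auto simp: search_inv_def adj_repr_def p_def)
  with inv pq have "search_inv xs n v L nx Q0 p0 q0 (s\<lparr>regs := (regs s)(''x'' := ?u, ''p'' := Suc p, ''e'' := arrs s H ?u)\<rparr>) J c"
    by (auto simp: search_inv_def p_def)
  with True W u pn hd[OF u] show ?thesis
    by (auto simp: search_body_def simp flip: p_def)
next
  case False
  then obtain j where j: "regs s ''e'' = Suc j" using not0_implies_Suc by blast
  note sc = scanning_step[OF inv[unfolded search_inv_def, THEN conjunct1, unfolded j]]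
  define x where "x = regs s ''x''"
  define y where "y = snd (xs ! j)"
  have Ty: "arrs s T j = y" using g(1) sc(1) by (simp add: adj_repr_def y_def)
  have x: "fst (xs ! j) = x" using sc(2) inv False by (simp add: search_inv_def x_def)
  then have xy: "(x, y) \<in> set xs" using sc(1) by (metis nth_mem prod.collapse y_def)
  then have y: "y < n" using xs by auto
  show ?thesis
  proof (cases "n \<le> arrs s ''O'' y \<and> follows v L x y")
    case True
    define q where "q = regs s ''q''"
    have Q: "queue_ok n (arrs s ''O'') (arrs s ''Q'') q" using inv by (simp add: search_inv_def q_def)
    note push = queue_push[OF Q y conjunct1[OF True]]
    let ?s = "s\<lparr>regs := (regs s)(''y'' := y, ''q'' := Suc q, ''e'' := nx j),
      arrs := (arrs s)(''O'' := (arrs s ''O'')(y := q), ''Q'' := (arrs s ''Q'')(q := y))\<rparr>"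
    have p: "regs s ''p'' \<le> q" "p0 < regs s ''p''" using inv sc(3) by (simp_all add: search_inv_def q_def)
    have "search_inv xs n v L nx Q0 p0 q0 ?s (insert j J) (Suc c)"
      unfolding search_inv_def
    proof (intro conjI ballI allI impI)
      show "scanning xs nx (arrs ?s ''Q'') p0 (regs ?s ''p'') (regs ?s ''e'') (insert j J) (Suc c)"
        using p by (auto intro!: scanning_cong[OF sc(4)])
      show "queue_ok n (arrs ?s ''O'') (arrs ?s ''Q'') (regs ?s ''q'')"
        using push(2) by simp
      show "regs ?s ''x'' = arrs ?s ''Q'' (regs ?s ''p'' - 1)" 
        using inv False p by (auto simp: search_inv_def)
      show "arrs ?s ''O'' (snd (xs ! i)) < n"
        if "i \<in> insert j J" "follows v L (fst (xs ! i)) (snd (xs ! i))" for i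
        using that inv push(1) by (auto simp: search_inv_def y_def)
      fix i assume i: "q0 \<le> i \<and> i < regs ?s ''q''"
      show "\<exists>k. p0 \<le> k \<and> k < i \<and> (arrs ?s ''Q'' k, arrs ?s ''Q'' i) \<in> set xs \<and>
          follows v L (arrs ?s ''Q'' k) (arrs ?s ''Q'' i)"
      proof (cases "i = q")
        case True
        have "arrs s ''Q'' (regs s ''p'' - 1) = x" using sc(2) x by simp
        with \<open>n \<le> _ \<and> follows v L x y\<close> xy p True show ?thesis
          by (intro exI[of _ "regs s ''p'' - 1"]) auto
      next
        case False
        with i have "q0 \<le> i \<and> i < regs s ''q''" by (auto simp: q_def)
        then obtain k where "p0 \<le> k" "k < i" "(arrs s ''Q'' k, arrs s ''Q'' i) \<in> set xs"
          "follows v L (arrs s ''Q'' k) (arrs s ''Q'' i)"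
          using inv unfolding search_inv_def by metis
        with i False show ?thesis by (intro exI[of _ k]) auto
      qed
    qed (use inv in \<open>auto simp: search_inv_def q_def\<close>)
    then show ?thesis
      using True W y push(1) nx[OF sc(1)] sc(1) g False j Ty X
      by (auto simp: search_body_def simp flip: x_def q_def)
  next
    case ny: False
    let ?s = "s\<lparr>regs := (regs s)(''y'' := y, ''e'' := nx j)\<rparr>"
    have "search_inv xs n v L nx Q0 p0 q0 ?s (insert j J) (Suc c)"
      using inv ny sc(2,4) False x by (auto simp: search_inv_def y_def not_le)
    note I = this
    from ny consider "arrs s ''O'' y < n" | "n \<le> arrs s ''O'' y" "x \<noteq> v" "L x \<noteq> L y" by fastforce
    then show ?thesis
      by cases (insert I W y nx[OF sc(1)] sc(1) g False j Ty,
        simp_all add: search_body_def flip: x_def; blast)+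
  qed
qed

lemma chain_append: "chain nx e (r @ j # js) \<Longrightarrow> chain nx (nx j) js"
  by (induction r arbitrary: e) auto

lemma chain_le: "chain nx e r \<Longrightarrow> set r \<subseteq> {..<m} \<Longrightarrow> e \<le> m"
  by (cases r) auto

lemma adj_repr_le:
  assumes "adj_repr n xs H X T s"
  shows "u < n \<Longrightarrow> arrs s H u \<le> length xs"
    and "j < length xs \<Longrightarrow> set xs \<subseteq> {..<n} \<times> {..<n} \<Longrightarrow> arrs s X j \<le> length xs"
proof -
  have o: "set (outs xs u) \<subseteq> {..<length xs}" for u by (auto simp: set_outs)
  show "u < n \<Longrightarrow> arrs s H u \<le> length xs"
    using assms o by (auto simp: adj_repr_def intro: chain_le)
  assume j: "j < length xs" "set xs \<subseteq> {..<n} \<times> {..<n}"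
  define u where "u = fst (xs ! j)"
  have "u < n" using subsetD[OF j(2) nth_mem[OF j(1)]] by (simp add: u_def mem_Times_iff)
  have "j \<in> set (outs xs u)" using j by (simp add: set_outs u_def)
  then obtain r js where r: "outs xs u = r @ j # js" by (meson split_list)
  with assms \<open>u < n\<close> have "chain (arrs s X) (arrs s X j) js"
    unfolding adj_repr_def by (metis chain_append)
  then show "arrs s X j \<le> length xs" by (rule chain_le) (use o[of u] r in auto)
qed

lemma adj_repr_unchanged:
  "unchanged c s s' \<Longrightarrow> {H, X, T} \<inter> mod_arrs c = {} \<Longrightarrow> adj_repr n xs H X T s' = adj_repr n xs H X T s"
  by (simp add: adj_repr_def unchanged_def)

text \<open>
  Arrays of the program: \<open>H\<close>, \<open>X\<close> (first and next pointers) hold the adjacency lists by source and \<open>G\<close>,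
  \<open>Y\<close> those by target; \<open>L\<close> is the labelling; \<open>Q\<close> and \<open>O\<close> are the queue and the order of the current
  search, and \<open>P\<close> keeps the forward order; \<open>B\<close> lists the vertices of a local search, marked in \<open>M\<close>.
\<close>

definition ctx :: "nat \<Rightarrow> nat \<Rightarrow> nat \<Rightarrow> (nat \<times> nat) list \<Rightarrow> string \<Rightarrow> string \<Rightarrow> string \<Rightarrow> (nat \<Rightarrow> nat) \<Rightarrow> state \<Rightarrow> bool" where
  "ctx W n v xs H X T L s \<longleftrightarrow> regs s ''n'' = n \<and> regs s ''v'' = v \<and> adj_repr n xs H X T s \<and>
     arrs s ''L'' = L \<and> v < n \<and> L v = v \<and> (\<forall>w<n. L w \<le> n) \<and> set xs \<subseteq> {..<n} \<times> {..<n} \<and>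
     4 * (n + length xs + 2) \<le> W \<and> {H, X, T} \<inter> {''O'', ''Q'', ''L'', ''B'', ''M'', ''P''} = {}"

lemma ctx_unchanged:
  assumes "unchanged c s s'" "ctx W n v xs H X T L s"
    "mod_arrs c \<subseteq> {''O'', ''Q'', ''B'', ''M'', ''P''}" "''n'' \<notin> mod_regs c" "''v'' \<notin> mod_regs c"
  shows "ctx W n v xs H X T L s'"
proof -
  have "{H, X, T} \<inter> mod_arrs c \<subseteq> {H, X, T} \<inter> {''O'', ''Q'', ''L'', ''B'', ''M'', ''P''}"
    by (intro Int_mono order_refl order_trans[OF assms(3)]) simp
  also have "\<dots> = {}" using assms(2) unfolding ctx_def by (elim conjE)
  finally have "{H, X, T} \<inter> mod_arrs c = {}" by simp
  note adj = adj_repr_unchanged[OF assms(1) this, of n xs]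
  have "''L'' \<notin> mod_arrs c" by (rule contra_subsetD[OF assms(3)]) simp
  note eqs = adj unchanged_arrs[OF assms(1) this] unchanged_regs[OF assms(1,4)] unchanged_regs[OF assms(1,5)]
  show ?thesis using assms(2) unfolding ctx_def eqs .
qed

lemma scanning_count_le:
  assumes "scanning xs nx f p0 p e J c" "inj_on f {..<q}" "p \<le> q"
  shows "c \<le> length xs"
proof -
  have "inj_on f {p0..<p}" by (rule inj_on_subset[OF assms(2)]) (use assms(3) in auto)
  from sum.reindex[OF this, of "\<lambda>u. deg xs u"]
  have "(\<Sum>i=p0..<p. deg xs (f i)) = (\<Sum>u\<in>f ` {p0..<p}. deg xs u)" by simp
  also have "\<dots> \<le> length xs" by (intro sum_deg_le) simp
  finally show ?thesis using scanning_le[OF assms(1)] by simp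
qed

text \<open>Used with \<open>p0 = 0\<close> for the order from \<open>v\<close> and with
  \<open>p0 = 1\<close> for splitting. Accordingly closure is claimed only for vertices from
  position \<open>p0\<close> on, and parents only for vertices that were not seeds.\<close>

lemma runs_search:
  assumes ctx: "ctx W n v xs H X T L s"
    and Q: "queue_ok n (arrs s ''O'') (arrs s ''Q'') q0" "regs s ''q'' = q0" "regs s ''p'' = p0" "p0 \<le> q0"
    and post: "\<And>t s'. unchanged (search H X T) s s' \<Longrightarrow> ctx W n v xs H X T L s' \<Longrightarrow>
      queue_ok n (arrs s' ''O'') (arrs s' ''Q'') (regs s' ''q'') \<Longrightarrow>
      (\<And>i. i < q0 \<Longrightarrow> arrs s' ''Q'' i = arrs s ''Q'' i) \<Longrightarrow> q0 \<le> regs s' ''q'' \<Longrightarrow>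
      (\<And>a b. (a, b) \<in> set xs \<Longrightarrow> follows v L a b \<Longrightarrow> arrs s' ''O'' a < n \<Longrightarrow> p0 \<le> arrs s' ''O'' a \<Longrightarrow>
        arrs s' ''O'' b < n) \<Longrightarrow>
      (\<And>w. w < n \<Longrightarrow> arrs s' ''O'' w < n \<Longrightarrow> q0 \<le> arrs s' ''O'' w \<Longrightarrow>
        \<exists>a. (a, w) \<in> set xs \<and> follows v L a w \<and> arrs s' ''O'' a < arrs s' ''O'' w \<and> p0 \<le> arrs s' ''O'' a) \<Longrightarrow>
      t \<le> 8 * (n + length xs) + 2 \<Longrightarrow> P t s'"
  shows "runs W (search H X T) s P"
proof -
  let ?nx = "arrs s X" and ?c = "search_body H X T" and ?s = "s\<lparr>regs := (regs s)(''e'' := 0)\<rparr>"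
  \<comment> \<open>\<open>8\<close> is the \<open>7\<close> steps of the body plus the loop test;
    \<open>p0\<close> is subtracted because the head starts there.\<close>
  let ?I = "\<lambda>t r. \<exists>J c. search_inv xs n v L ?nx (arrs s ''Q'') p0 q0 r J c \<and> t + 8 * p0 \<le> 8 * (regs r ''p'' + c)"
  have xs: "set xs \<subseteq> {..<n} \<times> {..<n}" and W: "n + length xs + 2 < W"
    and names: "{H, X, T} \<inter> {''O'', ''Q'', ''L''} = {}"
    using ctx by (auto simp: ctx_def)
  have un: "unchanged (search H X T) s r" if "unchanged ?c ?s r" for r
    using that by (auto simp: unchanged_def)
  have ctx': "ctx W n v xs H X T L r" if "unchanged ?c ?s r" for r
    by (rule ctx_unchanged[OF un[OF that] ctx]) auto
  have "runs W (While (Not (And (Eq (V ''e'') (N 0)) (Not (Less (V ''p'') (V ''q''))))) ?c) ?s (\<lambda>t. P (1 + t))"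
  proof (rule runs_While[where I = ?I and U = "8 * (n + length xs)"])
    have "search_inv xs n v L ?nx (arrs s ''Q'') p0 q0 ?s {} 0"
      using Q by (auto simp: search_inv_def scanning_init)
    then show "?I 0 ?s" using Q by (intro exI[of _ "{}"] exI[of _ 0]) simp
  next
    fix t r assume "?I t r"
    then obtain J c where inv: "search_inv xs n v L ?nx (arrs s ''Q'') p0 q0 r J c"
      and t: "t + 8 * p0 \<le> 8 * (regs r ''p'' + c)" by blast
    let ?Q = "arrs r ''Q''" and ?p = "regs r ''p''" and ?q = "regs r ''q''"
    have ok: "queue_ok n (arrs r ''O'') ?Q ?q" and pq: "?p \<le> ?q" using inv by (auto simp: search_inv_def)
    have "c \<le> length xs"
      using inv by (intro scanning_count_le[OF _ queue_inj[OF ok] pq]) (auto simp: search_inv_def)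
    then show "t \<le> 8 * (n + length xs)" using t queue_le[OF ok] pq by simp
  next
    fix t r
    assume I: "?I t r" and u: "unchanged ?c ?s r" and b: "bval (Not (And (Eq (V ''e'') (N 0)) (Not (Less (V ''p'') (V ''q''))))) r"
    from I obtain J c where inv: "search_inv xs n v L ?nx (arrs s ''Q'') p0 q0 r J c"
      and t: "t + 8 * p0 \<le> 8 * (regs r ''p'' + c)" by blast
    have X: "arrs r X = ?nx" using unchanged_arrs[OF u, of X] names by auto
    from ctx'[OF u] have r: "adj_repr n xs H X T r" "arrs r ''L'' = L" "regs r ''n'' = n" "regs r ''v'' = v"
      by (auto simp: ctx_def)
    show "runs W ?c r (\<lambda>u. ?I (t + u + 1))"
    proof (rule runs_conseq[OF search_step[OF inv _ r(1) X r(2-4) _ _ xs W]])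
      show "regs r ''e'' \<noteq> 0 \<or> regs r ''p'' < regs r ''q''" using b by auto
      show "X \<noteq> ''O''" "X \<noteq> ''Q''" using names by auto
      show "\<And>j. j < length xs \<Longrightarrow> ?nx j \<le> length xs" using adj_repr_le(2)[OF r(1) _ xs] X by simp
      show "\<And>u. u < n \<Longrightarrow> arrs r H u \<le> length xs" by (rule adj_repr_le(1)[OF r(1)])
    next
      fix u :: nat and r'
      assume "u \<le> 7 \<and> (\<exists>J' c'. search_inv xs n v L ?nx (arrs s ''Q'') p0 q0 r' J' c' \<and>
        regs r' ''p'' + c' = Suc (regs r ''p'' + c))"
      then show "?I (t + u + 1) r'" using t by fastforce
    qed
  next
    fix t r
    assume I: "?I t r" and u: "unchanged ?c ?s r" and b: "\<not> bval (Not (And (Eq (V ''e'') (N 0)) (Not (Less (V ''p'') (V ''q''))))) r"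
    from I obtain J c where inv: "search_inv xs n v L ?nx (arrs s ''Q'') p0 q0 r J c"
      and t: "t + 8 * p0 \<le> 8 * (regs r ''p'' + c)" by blast
    let ?Q = "arrs r ''Q''" and ?p = "regs r ''p''" and ?q = "regs r ''q''" and ?O = "arrs r ''O''"
    have pq: "?p = ?q" "regs r ''e'' = 0" using b inv by (auto simp: search_inv_def)
    have ok: "queue_ok n ?O ?Q ?q" using inv by (simp add: search_inv_def)
    have sc: "scanning xs ?nx ?Q p0 ?q 0 J c" using inv pq by (simp add: search_inv_def)
    show "P (1 + (t + 1)) r"
    proof (rule post[OF un[OF u] ctx'[OF u] ok])
      show "?Q i = arrs s ''Q'' i" if "i < q0" for i using inv that by (simp add: search_inv_def)
      show "q0 \<le> ?q" using inv by (simp add: search_inv_def)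
      show "?O b < n" if "(a, b) \<in> set xs" "follows v L a b" "?O a < n" "p0 \<le> ?O a" for a b
      proof -
        from that(1) obtain j where j: "j < length xs" "xs ! j = (a, b)" by (auto simp: in_set_conv_nth)
        have "?O a < ?q \<and> ?Q (?O a) = a" using ok that xs by (auto simp: queue_ok_def)
        then have "j \<in> J" unfolding scanning_end(1)[OF sc] using j that(4) by auto
        with inv j that(2) show ?thesis unfolding search_inv_def by fastforce
      qed
      show "\<exists>a. (a, w) \<in> set xs \<and> follows v L a w \<and> ?O a < ?O w \<and> p0 \<le> ?O a"
        if "w < n" "?O w < n" "q0 \<le> ?O w" for w
      proof -
        have w: "?O w < ?q" "?Q (?O w) = w" using ok that by (auto simp: queue_ok_def)
        from inv that(3) w(1) obtain k where "p0 \<le> k" "k < ?O w" "(?Q k, ?Q (?O w)) \<in> set xs"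
          "follows v L (?Q k) (?Q (?O w))" unfolding search_inv_def by blast
        moreover have "?O (?Q k) = k" using ok \<open>k < ?O w\<close> w(1) unfolding queue_ok_def by simp
        ultimately show ?thesis using w(2) by (intro exI[of _ "?Q k"]) auto
      qed
      have "c \<le> length xs" by (rule scanning_count_le[OF sc queue_inj[OF ok] order_refl])
      then show "1 + (t + 1) \<le> 8 * (n + length xs) + 2" using t queue_le[OF ok] pq by simp
    qed
  qed
  then show ?thesis using W by (simp add: search_def)
qed

section \<open>Splitting classes\<close>

definition "init_ord = For ''i'' (V ''n'') (Store ''O'' (V ''i'') (Plus (V ''n'') (V ''i'')))"

lemma mod_init_ord [simp]: "mod_regs init_ord = {''i''}" "mod_arrs init_ord = {''O''}"
  by (auto simp: init_ord_def)

lemma runs_init_ord: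
  assumes ctx: "ctx W n v xs H X T L s"
    and post: "\<And>t s'. unchanged init_ord s s' \<Longrightarrow> ctx W n v xs H X T L s' \<Longrightarrow>
      (\<And>w. w < n \<Longrightarrow> arrs s' ''O'' w = n + w) \<Longrightarrow> t \<le> 3 * n + 2 \<Longrightarrow> P t s'"
  shows "runs W init_ord s P"
  unfolding init_ord_def
proof (rule runs_For[where n = n and B = "\<lambda>_. 1" and I = "\<lambda>k r. \<forall>w<k. arrs r ''O'' w = n + w"])
  have W: "2 * n < W" using ctx by (simp add: ctx_def)
  then show "n < W" "0 < W" by auto
  fix r
  assume u: "unchanged (For ''i'' (V ''n'') (Store ''O'' (V ''i'') (Plus (V ''n'') (V ''i'')))) s r"
  have r: "ctx W n v xs H X T L r" by (rule ctx_unchanged[OF u ctx]) auto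
  then show n: "aval (V ''n'') r = n" by (simp add: ctx_def)
  show "runs W (Store ''O'' (V ''i'') (Plus (V ''n'') (V ''i''))) r (\<lambda>u r'. u \<le> 1 \<and> regs r' ''i'' = k \<and>
     (\<forall>w<Suc k. arrs (r'\<lparr>regs := (regs r')(''i'' := Suc k)\<rparr>) ''O'' w = n + w))"
    if "k < n" "\<forall>w<k. arrs r ''O'' w = n + w" "regs r ''i'' = k" for k
    using that n W by (auto simp: less_Suc_eq)
  show "P t r" if "\<forall>w<n. arrs r ''O'' w = n + w" "t \<le> (\<Sum>k<n. 1) + 2 * n + 2" for t
    using that by (intro post[OF _ r]) (use u in \<open>auto simp: init_ord_def\<close>)
qed simp

text \<open>One seed per class, so all classes are tested by a single search. The initial class has
  a label outside the vertex set and hence no seed; it is found entirely unreached and obtains a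
  representative that way.\<close>

definition "push_reps = For ''i'' (V ''n'')
  (If (And (Eq (A ''L'' (V ''i'')) (V ''i'')) (Not (Eq (V ''i'') (V ''v''))))
    (Seq (Store ''O'' (V ''i'') (V ''q''))
    (Seq (Store ''Q'' (V ''q'') (V ''i''))
      (inc ''q'')))
    Skip)"

lemma mod_push_reps [simp]: "mod_regs push_reps = {''i'', ''q''}" "mod_arrs push_reps = {''O'', ''Q''}"
  by (auto simp: push_reps_def)

lemma runs_push_reps:
  assumes ctx: "ctx W n v xs H X T L s"
    and s: "regs s ''q'' = 1" "arrs s ''Q'' 0 = v" "arrs s ''O'' v = 0"
      "\<And>w. w < n \<Longrightarrow> w \<noteq> v \<Longrightarrow> arrs s ''O'' w = n + w"
    and post: "\<And>t s'. unchanged push_reps s s' \<Longrightarrow> ctx W n v xs H X T L s' \<Longrightarrow>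
      queue_ok n (arrs s' ''O'') (arrs s' ''Q'') (regs s' ''q'') \<Longrightarrow> 1 \<le> regs s' ''q'' \<Longrightarrow>
      arrs s' ''Q'' 0 = v \<Longrightarrow>
      (\<And>w. w < n \<Longrightarrow> L w = w \<Longrightarrow> arrs s' ''O'' w < n) \<Longrightarrow>
      (\<And>i. 0 < i \<Longrightarrow> i < regs s' ''q'' \<Longrightarrow> L (arrs s' ''Q'' i) = arrs s' ''Q'' i) \<Longrightarrow>
      t \<le> 6 * n + 2 \<Longrightarrow> P t s'"
  shows "runs W push_reps s P"
proof -
  define I where "I k r \<longleftrightarrow> queue_ok n (arrs r ''O'') (arrs r ''Q'') (regs r ''q'') \<and> 1 \<le> regs r ''q'' \<and>
      arrs r ''Q'' 0 = v \<and>
      (\<forall>w<n. L w = w \<and> (w = v \<or> w < k) \<longrightarrow> arrs r ''O'' w < n) \<and>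
      (\<forall>w<n. k \<le> w \<and> w \<noteq> v \<longrightarrow> n \<le> arrs r ''O'' w) \<and>
      (\<forall>i. 0 < i \<and> i < regs r ''q'' \<longrightarrow> L (arrs r ''Q'' i) = arrs r ''Q'' i)"
    for k and r :: state
  have W: "2 * n + 2 < W" and v: "v < n" using ctx by (auto simp: ctx_def)
  show ?thesis
    unfolding push_reps_def
  proof (rule runs_For[where n = n and B = "\<lambda>_. 4" and I = I])
    show "n < W" "0 < W" using W by auto
    have "queue_ok n (arrs s ''O'') (arrs s ''Q'') 1"
      using s v by (auto simp: queue_ok_def) (metis add_lessD1 less_irrefl)+
    then show "I 0 (s\<lparr>regs := (regs s)(''i'' := 0)\<rparr>)" using s v by (auto simp: I_def)
  next
    fix r assume "unchanged (For ''i'' (V ''n'')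
      (If (And (Eq (A ''L'' (V ''i'')) (V ''i'')) (Not (Eq (V ''i'') (V ''v''))))
        (Seq (Store ''O'' (V ''i'') (V ''q'')) (Seq (Store ''Q'' (V ''q'') (V ''i'')) (inc ''q''))) Skip)) s r"
    then have u: "unchanged push_reps s r" by (simp add: push_reps_def)
    have r: "ctx W n v xs H X T L r" by (rule ctx_unchanged[OF u ctx]) auto
    then show n: "aval (V ''n'') r = n" by (simp add: ctx_def)
    have rL: "arrs r ''L'' = L" "regs r ''v'' = v" using r by (auto simp: ctx_def)
    show "runs W (If (And (Eq (A ''L'' (V ''i'')) (V ''i'')) (Not (Eq (V ''i'') (V ''v''))))
        (Seq (Store ''O'' (V ''i'') (V ''q'')) (Seq (Store ''Q'' (V ''q'') (V ''i'')) (inc ''q''))) Skip) r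
        (\<lambda>u r'. u \<le> 4 \<and> regs r' ''i'' = k \<and> I (Suc k) (r'\<lparr>regs := (regs r')(''i'' := Suc k)\<rparr>))"
      if k: "k < n" and I: "I k r" and i: "regs r ''i'' = k" for k
    proof (cases "L k = k \<and> k \<noteq> v")
      case True
      define q where "q = regs r ''q''"
      have ok: "queue_ok n (arrs r ''O'') (arrs r ''Q'') q" using I by (simp add: I_def q_def)
      have "n \<le> arrs r ''O'' k" using I True k by (simp add: I_def)
      note push = queue_push[OF ok k this]
      have "I (Suc k) (r\<lparr>regs := (regs r)(''q'' := Suc q, ''i'' := Suc k),
        arrs := (arrs r)(''O'' := (arrs r ''O'')(k := q), ''Q'' := (arrs r ''Q'')(q := k))\<rparr>)"
        using I push True unfolding I_def by (auto simp: less_Suc_eq q_def[symmetric])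
      then show ?thesis using True i rL W push k by (simp add: fun_upd_twist flip: q_def)
    next
      case False
      have "I (Suc k) (r\<lparr>regs := (regs r)(''i'' := Suc k)\<rparr>)"
        using I False v k unfolding I_def by (auto simp: less_Suc_eq)
      then show ?thesis using False i rL by auto
    qed
    show "P t r" if "I n r" "t \<le> (\<Sum>k<n. 4) + 2 * n + 2" for t
      by (rule post[OF u r]) (use that in \<open>auto simp: I_def\<close>)
  qed
qed

definition "find_unreached = For ''i'' (V ''n'')
  (If (And (Not (Less (A ''O'' (V ''i'')) (V ''n''))) (Not (Eq (A ''L'' (V ''i'')) (V ''v''))))
    (Assign ''x'' (V ''i'')) Skip)"

lemma mod_find_unreached [simp]: "mod_regs find_unreached = {''i'', ''x''}" "mod_arrs find_unreached = {}"
  by (auto simp: find_unreached_def)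

lemma runs_find_unreached:
  assumes ctx: "ctx W n v xs H X T L s" and x: "regs s ''x'' = n"
    and post: "\<And>t s'. unchanged find_unreached s s' \<Longrightarrow> ctx W n v xs H X T L s' \<Longrightarrow>
      (regs s' ''x'' = n \<Longrightarrow> \<forall>w<n. L w \<noteq> v \<longrightarrow> arrs s ''O'' w < n) \<Longrightarrow>
      (regs s' ''x'' \<noteq> n \<Longrightarrow> regs s' ''x'' < n \<and> L (regs s' ''x'') \<noteq> v \<and> n \<le> arrs s ''O'' (regs s' ''x'')) \<Longrightarrow>
      t \<le> 4 * n + 2 \<Longrightarrow> P t s'"
  shows "runs W find_unreached s P"
proof -
  define I where "I k r \<longleftrightarrow>
    (if regs r ''x'' = n then \<forall>w<k. L w \<noteq> v \<longrightarrow> arrs s ''O'' w < n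
     else regs r ''x'' < n \<and> L (regs r ''x'') \<noteq> v \<and> n \<le> arrs s ''O'' (regs r ''x''))" for k and r :: state
  have W: "2 * n + 2 < W" using ctx by (auto simp: ctx_def)
  show ?thesis
    unfolding find_unreached_def
  proof (rule runs_For[where n = n and B = "\<lambda>_. 2" and I = I])
    show "n < W" "0 < W" using W by auto
    show "I 0 (s\<lparr>regs := (regs s)(''i'' := 0)\<rparr>)" using x by (simp add: I_def)
  next
    fix r assume "unchanged (For ''i'' (V ''n'')
      (If (And (Not (Less (A ''O'' (V ''i'')) (V ''n''))) (Not (Eq (A ''L'' (V ''i'')) (V ''v''))))
        (Assign ''x'' (V ''i'')) Skip)) s r"
    then have u: "unchanged find_unreached s r" by (simp add: find_unreached_def)
    have r: "ctx W n v xs H X T L r" by (rule ctx_unchanged[OF u ctx]) auto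
    then show n: "aval (V ''n'') r = n" by (simp add: ctx_def)
    have rL: "arrs r ''L'' = L" "regs r ''v'' = v" "regs r ''n'' = n" using r by (auto simp: ctx_def)
    have O: "arrs r ''O'' = arrs s ''O''" using unchanged_arrs[OF u] by simp
    show "runs W (If (And (Not (Less (A ''O'' (V ''i'')) (V ''n''))) (Not (Eq (A ''L'' (V ''i'')) (V ''v''))))
        (Assign ''x'' (V ''i'')) Skip) r
        (\<lambda>u r'. u \<le> 2 \<and> regs r' ''i'' = k \<and> I (Suc k) (r'\<lparr>regs := (regs r')(''i'' := Suc k)\<rparr>))"
      if "k < n" "I k r" "regs r ''i'' = k" for k
      using that W rL O by (auto simp: I_def less_Suc_eq)
    show "P t r" if "I n r" "t \<le> (\<Sum>k<n. 2) + 2 * n + 2" for t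
      by (rule post[OF u r]) (use that in \<open>auto simp: I_def split: if_splits\<close>)
  qed
qed

definition "relabel = For ''i'' (V ''n'')
  (If (And (Not (Less (A ''O'' (V ''i'')) (V ''n''))) (Eq (A ''L'' (V ''i'')) (V ''y'')))
    (Store ''L'' (V ''i'') (V ''x'')) Skip)"

lemma mod_relabel [simp]: "mod_regs relabel = {''i''}" "mod_arrs relabel = {''L''}"
  by (auto simp: relabel_def)

lemma runs_relabel:
  assumes W: "2 * n + 2 < W" and x: "regs s ''x'' < n" and n: "regs s ''n'' = n"
    and post: "\<And>t s'. unchanged relabel s s' \<Longrightarrow>
      arrs s' ''L'' = (\<lambda>w. if w < n \<and> n \<le> arrs s ''O'' w \<and> arrs s ''L'' w = regs s ''y''
        then regs s ''x'' else arrs s ''L'' w) \<Longrightarrow> t \<le> 4 * n + 2 \<Longrightarrow> P t s'"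
  shows "runs W relabel s P"
proof -
  define I where "I k r \<longleftrightarrow> arrs r ''L'' = (\<lambda>w. if w < k \<and> n \<le> arrs s ''O'' w \<and> arrs s ''L'' w = regs s ''y''
        then regs s ''x'' else arrs s ''L'' w)" for k and r :: state
  show ?thesis
    unfolding relabel_def
  proof (rule runs_For[where n = n and B = "\<lambda>_. 2" and I = I])
    show "n < W" "0 < W" using W by auto
    show "I 0 (s\<lparr>regs := (regs s)(''i'' := 0)\<rparr>)" by (simp add: I_def)
  next
    fix r assume "unchanged (For ''i'' (V ''n'')
      (If (And (Not (Less (A ''O'' (V ''i'')) (V ''n''))) (Eq (A ''L'' (V ''i'')) (V ''y'')))
        (Store ''L'' (V ''i'') (V ''x'')) Skip)) s r"
    then have u: "unchanged relabel s r" by (simp add: relabel_def)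
    have r: "regs r ''n'' = n" "regs r ''x'' = regs s ''x''" "regs r ''y'' = regs s ''y''" "arrs r ''O'' = arrs s ''O''"
      using n by (simp_all add: unchanged_regs[OF u] unchanged_arrs[OF u])
    then show "aval (V ''n'') r = n" by simp
    show "runs W (If (And (Not (Less (A ''O'' (V ''i'')) (V ''n''))) (Eq (A ''L'' (V ''i'')) (V ''y'')))
        (Store ''L'' (V ''i'') (V ''x'')) Skip) r
        (\<lambda>u r'. u \<le> 2 \<and> regs r' ''i'' = k \<and> I (Suc k) (r'\<lparr>regs := (regs r')(''i'' := Suc k)\<rparr>))"
      if "k < n" "I k r" "regs r ''i'' = k" for k
      using that W r x by (auto simp: I_def less_Suc_eq fun_eq_iff)
    show "P t r" if "I n r" "t \<le> (\<Sum>k<n. 2) + 2 * n + 2" for t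
      by (rule post[OF u]) (use that in \<open>auto simp: I_def\<close>)
  qed
qed

text \<open>The search from \<open>v\<close> leaves unreached vertices \<open>w\<close> with order number \<open>n + w\<close>.\<close>

definition "start_search =
  Seq init_ord
  (Seq (Store ''O'' (V ''v'') (N 0))
  (Seq (Store ''Q'' (N 0) (V ''v''))
    (Assign ''q'' (N 1))))"

lemma mod_start_search [simp]: "mod_regs start_search = {''i'', ''q''}" "mod_arrs start_search = {''O'', ''Q''}"
  by (auto simp: start_search_def)

lemma runs_start_search:
  assumes ctx: "ctx W n v xs H X T L s"
  shows "runs W start_search s (\<lambda>t r. t \<le> 3 * n + 5 \<and> unchanged start_search s r \<and> ctx W n v xs H X T L r \<and>
    regs r ''q'' = 1 \<and> arrs r ''Q'' 0 = v \<and> arrs r ''O'' v = 0 \<and> (\<forall>w<n. w \<noteq> v \<longrightarrow> arrs r ''O'' w = n + w))"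
proof -
  have W: "2 * n + 2 < W" and v: "v < n" using ctx by (auto simp: ctx_def)
  have *: "runs W start_search s (\<lambda>t r. t \<le> 3 * n + 5 \<and>
    regs r ''q'' = 1 \<and> arrs r ''Q'' 0 = v \<and> arrs r ''O'' v = 0 \<and> (\<forall>w<n. w \<noteq> v \<longrightarrow> arrs r ''O'' w = n + w))"
    unfolding start_search_def
    by (subst runs_Seq, rule runs_init_ord[OF ctx]) (use W v in \<open>simp add: ctx_def\<close>)
  show ?thesis
    by (rule runs_conseq[OF *]) (use ctx_unchanged[OF _ ctx, of start_search] in auto)
qed

text \<open>The unreached part of the class of \<open>x\<close> becomes a class of its own,
  represented by \<open>x\<close>.\<close>

definition "split_off =
  If (Less (V ''x'') (V ''n''))
    (Seq (Assign ''f'' (N 1))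
    (Seq (Assign ''y'' (A ''L'' (V ''x'')))
      relabel))
    Skip"

text \<open>\<open>v\<close> occupies queue position 0 and the head starts at 1: \<open>v\<close> is
  marked but not expanded, so the search takes place in the graph without \<open>v\<close>.\<close>

definition "split_classes H X T =
  Seq start_search
  (Seq (Seq push_reps (Assign ''p'' (N 1)))
  (Seq (search H X T)
  (Seq (Seq (Assign ''x'' (V ''n'')) find_unreached)
    split_off)))"

lemma mod_split_classes [simp]:
  "mod_regs (split_classes H X T) = {''e'', ''x'', ''y'', ''p'', ''q'', ''i'', ''f''}"
  "mod_arrs (split_classes H X T) = {''O'', ''Q'', ''L''}"
  by (auto simp: split_classes_def split_off_def)

definition alive :: "nat \<Rightarrow> nat \<Rightarrow> (nat \<Rightarrow> nat) \<Rightarrow> nat set" where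
  "alive n v L = {w. w < n \<and> L w \<noteq> v}"

text \<open>A discard lowers the first summand; a split keeps it and lowers the second, since a new
  representative arises.\<close>

definition potential :: "nat \<Rightarrow> nat \<Rightarrow> (nat \<Rightarrow> nat) \<Rightarrow> nat" where
  "potential n v L = card (alive n v L) + card {w \<in> alive n v L. L w \<noteq> w}"

lemma finite_alive [simp]: "finite (alive n v L)"
  by (simp add: alive_def)

text \<open>Representatives lie in \<open>R\<close> and keep their label, while \<open>x\<close>
  turns from a non-representative into one.\<close>

lemma potential_relabel:
  assumes "x \<in> alive n v L" "L x \<noteq> x"
    and rep: "\<And>w. w < n \<Longrightarrow> L w = w \<Longrightarrow> w \<in> R" and "x \<notin> R" "L v = v"
    and L': "L' = (\<lambda>w. if w < n \<and> w \<notin> R \<and> L w = L x then x else L w)"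
  shows "alive n v L' = alive n v L" "potential n v L' < potential n v L"
proof -
  have xv: "x \<noteq> v" using assms by (auto simp: alive_def)
  show a: "alive n v L' = alive n v L" using xv assms(1) by (auto simp: alive_def L')
  have "{w \<in> alive n v L. L' w \<noteq> w} \<subset> {w \<in> alive n v L. L w \<noteq> w}"
  proof
    show "{w \<in> alive n v L. L' w \<noteq> w} \<subseteq> {w \<in> alive n v L. L w \<noteq> w}"
      using rep by (auto simp: L' alive_def)
    have "x \<in> {w \<in> alive n v L. L w \<noteq> w}" "x \<notin> {w \<in> alive n v L. L' w \<noteq> w}"
      using assms by (auto simp: L' alive_def)
    then show "{w \<in> alive n v L. L' w \<noteq> w} \<noteq> {w \<in> alive n v L. L w \<noteq> w}" by blast
  qed
  then show "potential n v L' < potential n v L"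
    unfolding potential_def a by (intro add_strict_left_mono psubset_card_mono) auto
qed

abbreviation "split_outcome W n v xs H X T L r \<equiv> (\<exists>L'. ctx W n v xs H X T L' r \<and>
  (regs r ''f'' = 0 \<and> L' = L \<and> split_stable (set xs) n v L \<or>
   regs r ''f'' = 1 \<and> admissible (set xs) n v L' \<and> alive n v L' = alive n v L \<and>
     potential n v L' < potential n v L))"

lemma runs_split_classes:
  assumes ctx: "ctx W n v xs H X T L s" and adm: "admissible (set xs) n v L" and f: "regs s ''f'' = 0"
  shows "runs W (split_classes H X T) s (\<lambda>t r. t \<le> 30 * (n + length xs + 1) \<and> split_outcome W n v xs H X T L r)"
proof -
  have W: "2 * n + 2 < W" and v: "v < n" "L v = v"
    and xs: "set xs \<subseteq> {..<n} \<times> {..<n}"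
    using ctx by (auto simp: ctx_def)
  have nam: "{H, X, T} \<inter> {''O'', ''Q'', ''L'', ''B'', ''M'', ''P''} = {}" using ctx by (simp add: ctx_def)
  define A0 where "A0 r \<longleftrightarrow> ctx W n v xs H X T L r \<and> regs r ''f'' = 0" for r
  define A1 where "A1 r \<longleftrightarrow> A0 r \<and>
    regs r ''q'' = 1 \<and> arrs r ''Q'' 0 = v \<and> arrs r ''O'' v = 0 \<and> (\<forall>w<n. w \<noteq> v \<longrightarrow> arrs r ''O'' w = n + w)" for r
  define A2 where "A2 r \<longleftrightarrow> A0 r \<and> queue_ok n (arrs r ''O'') (arrs r ''Q'') (regs r ''q'') \<and>
    regs r ''p'' = 1 \<and> 1 \<le> regs r ''q'' \<and> arrs r ''Q'' 0 = v \<and> (\<forall>w<n. L w = w \<longrightarrow> arrs r ''O'' w < n) \<and>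
    (\<forall>i. 0 < i \<and> i < regs r ''q'' \<longrightarrow> L (arrs r ''Q'' i) = arrs r ''Q'' i)" for r
  define C where "C ord \<longleftrightarrow> ord v = 0 \<and> (\<forall>w<n. L w = w \<longrightarrow> ord w < n) \<and>
    (\<forall>a b. (a, b) \<in> set xs \<longrightarrow> L a = L b \<longrightarrow> ord a < n \<longrightarrow> a \<noteq> v \<longrightarrow> ord b < n) \<and>
    (\<forall>w<n. ord w < n \<longrightarrow> w \<noteq> v \<longrightarrow> L w \<noteq> w \<longrightarrow> (\<exists>a. (a, w) \<in> set xs \<and> L a = L w \<and> ord a < ord w \<and> a \<noteq> v))"
    for ord :: "nat \<Rightarrow> nat"
  define A3 where "A3 r \<longleftrightarrow> A0 r \<and> C (arrs r ''O'')" for r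
  define A4 where "A4 r \<longleftrightarrow> A3 r \<and> (if regs r ''x'' = n then \<forall>w<n. L w \<noteq> v \<longrightarrow> arrs r ''O'' w < n
    else regs r ''x'' < n \<and> L (regs r ''x'') \<noteq> v \<and> n \<le> arrs r ''O'' (regs r ''x''))" for r
  define B where "B r \<longleftrightarrow> split_outcome W n v xs H X T L r" for r
  have A0_un: "A0 r'" if "unchanged c r r'" "A0 r"
    "mod_arrs c \<subseteq> {''O'', ''Q'', ''B'', ''M'', ''P''}" "''n'' \<notin> mod_regs c" "''v'' \<notin> mod_regs c" "''f'' \<notin> mod_regs c" for c r r'
    using that ctx_unchanged[OF that(1) _ that(3-5)] unchanged_regs[OF that(1,6)] by (simp add: A0_def)
  have A0: "ctx W n v xs H X T L r" if "A0 r" for r using that by (simp add: A0_def)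
  have s: "A0 s" using ctx f by (simp add: A0_def)
  have 1: "runs W start_search s (\<lambda>t r. t \<le> 3 * n + 5 \<and> A1 r)"
    by (rule runs_conseq[OF runs_start_search[OF ctx]]) (use A0_un[OF _ s, of start_search] in \<open>simp add: A1_def\<close>)
  have 2: "runs W (Seq push_reps (Assign ''p'' (N 1))) r (\<lambda>t r. t \<le> 6 * n + 3 \<and> A2 r)" if r: "A1 r" for r
  proof (rule runs_conseq[where Q = "\<lambda>t r'. t \<le> 6 * n + 3 \<and> (A0 r' \<longrightarrow> A2 r')"])
    have A1: "ctx W n v xs H X T L r" "regs r ''q'' = 1" "arrs r ''Q'' 0 = v" "arrs r ''O'' v = 0"
      "\<And>w. w < n \<Longrightarrow> w \<noteq> v \<Longrightarrow> arrs r ''O'' w = n + w" using r by (auto simp: A1_def A0_def)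
    show "runs W (Seq push_reps (Assign ''p'' (N 1))) r (\<lambda>t r'. t \<le> 6 * n + 3 \<and> (A0 r' \<longrightarrow> A2 r'))"
      by (subst runs_Seq, rule runs_push_reps[OF A1]) (use W in \<open>auto simp: A2_def\<close>)
    show "t \<le> 6 * n + 3 \<and> A2 r'"
      if "t \<le> 6 * n + 3 \<and> (A0 r' \<longrightarrow> A2 r')" "unchanged (Seq push_reps (Assign ''p'' (N 1))) r r'" for t r'
      using that A0_un[OF that(2)] r by (simp add: A1_def)
  qed
  have 3: "runs W (search H X T) r (\<lambda>t r. t \<le> 8 * (n + length xs) + 2 \<and> A3 r)" if r: "A2 r" for r
  proof -
    have A2: "A0 r" "queue_ok n (arrs r ''O'') (arrs r ''Q'') (regs r ''q'')" "regs r ''p'' = 1" "1 \<le> regs r ''q''"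
      "arrs r ''Q'' 0 = v" "\<And>w. w < n \<Longrightarrow> L w = w \<Longrightarrow> arrs r ''O'' w < n"
      "\<And>i. 0 < i \<Longrightarrow> i < regs r ''q'' \<Longrightarrow> L (arrs r ''Q'' i) = arrs r ''Q'' i"
      using r by (auto simp: A2_def)
    show ?thesis
    proof (rule runs_search[OF A0[OF A2(1)] A2(2) refl A2(3,4)])
      fix t :: nat and r' :: state
      let ?O = "arrs r' ''O''" and ?Q = "arrs r' ''Q''" and ?q = "regs r' ''q''"
      assume u: "unchanged (search H X T) r r'" and c: "ctx W n v xs H X T L r'"
        and ok: "queue_ok n ?O ?Q ?q" and old: "\<And>i. i < regs r ''q'' \<Longrightarrow> ?Q i = arrs r ''Q'' i"
        and q: "regs r ''q'' \<le> ?q"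
        and cl: "\<And>a b. (a, b) \<in> set xs \<Longrightarrow> follows v L a b \<Longrightarrow> ?O a < n \<Longrightarrow> 1 \<le> ?O a \<Longrightarrow> ?O b < n"
        and par: "\<And>w. w < n \<Longrightarrow> ?O w < n \<Longrightarrow> regs r ''q'' \<le> ?O w \<Longrightarrow>
          \<exists>a. (a, w) \<in> set xs \<and> follows v L a w \<and> ?O a < ?O w \<and> 1 \<le> ?O a"
        and t: "t \<le> 8 * (n + length xs) + 2"
      have v0: "?O v = 0"
        using ok old[of 0] A2(4,5) q by (auto simp: queue_ok_def)
      \<comment> \<open>Position 0 belongs to \<open>v\<close>, so every other visited vertex was
        expanded and the closure property from \<open>p0 = 1\<close> on covers it.\<close>
      have pos: "1 \<le> ?O w" if "w < n" "?O w < n" "w \<noteq> v" for w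
      proof (rule ccontr)
        assume "\<not> 1 \<le> ?O w"
        then have "?O w = 0" by simp
        then show False using ok that v0 v(1) unfolding queue_ok_def by (metis old A2(4,5) less_le_trans less_numeral_extra(1))
      qed
      have "C ?O"
        unfolding C_def
      proof (intro conjI allI impI)
        show "?O v = 0" by (rule v0)
        show "?O w < n" if "w < n" "L w = w" for w
        proof -
          have "arrs r ''O'' w < n" using A2(6) that by simp
          then have w: "arrs r ''O'' w < regs r ''q''" "arrs r ''Q'' (arrs r ''O'' w) = w"
            using A2(2) that(1) unfolding queue_ok_def by auto
          with old have "?Q (arrs r ''O'' w) = w" by simp
          with w(1) q ok have "?O w = arrs r ''O'' w" unfolding queue_ok_def by (metis less_le_trans)
          with \<open>arrs r ''O'' w < n\<close> show ?thesis by simp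
        qed
        show "?O b < n" if "(a, b) \<in> set xs" "L a = L b" "?O a < n" "a \<noteq> v" for a b
          using cl[OF that(1) _ that(3)] pos[of a] that xs by auto
        show "\<exists>a. (a, w) \<in> set xs \<and> L a = L w \<and> ?O a < ?O w \<and> a \<noteq> v"
          if w: "w < n" "?O w < n" "w \<noteq> v" "L w \<noteq> w" for w
        proof -
          \<comment> \<open>The seeds other than \<open>v\<close> are representatives, so
            \<open>w\<close> was pushed by the search and has a parent.\<close>
          have "regs r ''q'' \<le> ?O w"
          proof (rule ccontr)
            assume n: "\<not> regs r ''q'' \<le> ?O w"
            then have "?Q (?O w) = arrs r ''Q'' (?O w)" using old by simp
            moreover have "?Q (?O w) = w" using ok w unfolding queue_ok_def by simp
            moreover have "L (arrs r ''Q'' (?O w)) = arrs r ''Q'' (?O w)"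
              using A2(7)[of "?O w"] pos[OF w(1-3)] n by simp
            ultimately show False using w(4) by simp
          qed
          from par[OF w(1,2) this] obtain a where "(a, w) \<in> set xs" "follows v L a w" "?O a < ?O w" "1 \<le> ?O a" by blast
          with v0 show ?thesis by (intro exI[of _ a]) auto
        qed
      qed
      then show "t \<le> 8 * (n + length xs) + 2 \<and> A3 r'"
        using t A0_un[OF u A2(1)] by (simp add: A3_def)
    qed
  qed
  have 4: "runs W (Seq (Assign ''x'' (V ''n'')) find_unreached) r (\<lambda>t r. t \<le> 4 * n + 3 \<and> A4 r)" if r: "A3 r" for r
  proof -
    let ?r = "r\<lparr>regs := (regs r)(''x'' := n)\<rparr>"
    have A0r: "A0 r" using r by (simp add: A3_def)
    have "A0 ?r" by (rule A0_un[where c = "Assign ''x'' (V ''n'')", OF _ A0r]) (auto simp: unchanged_def)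
    have n: "regs r ''n'' = n" using A0r by (simp add: A0_def ctx_def)
    have "runs W find_unreached ?r (\<lambda>t r. t + 1 \<le> 4 * n + 3 \<and> A4 r)"
    proof (rule runs_find_unreached[OF A0[OF \<open>A0 ?r\<close>]])
      fix t :: nat and r' :: state
      assume u: "unchanged find_unreached ?r r'"
        and x: "regs r' ''x'' = n \<Longrightarrow> \<forall>w<n. L w \<noteq> v \<longrightarrow> arrs ?r ''O'' w < n"
         "regs r' ''x'' \<noteq> n \<Longrightarrow> regs r' ''x'' < n \<and> L (regs r' ''x'') \<noteq> v \<and> n \<le> arrs ?r ''O'' (regs r' ''x'')"
        and t: "t \<le> 4 * n + 2"
      have "arrs r' ''O'' = arrs r ''O''" using unchanged_arrs[OF u] by simp
      then show "t + 1 \<le> 4 * n + 3 \<and> A4 r'"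
        using x t r A0_un[OF u \<open>A0 ?r\<close>] by (simp add: A4_def A3_def)
    qed simp
    then show ?thesis using n W by simp
  qed
  have 5: "runs W split_off r (\<lambda>t r. t \<le> 4 * n + 5 \<and> B r)" if r: "A4 r" for r
  proof (cases "regs r ''x'' = n")
    case True
    have A0r: "A0 r" and C: "C (arrs r ''O'')" and all: "\<And>w. w < n \<Longrightarrow> L w \<noteq> v \<Longrightarrow> arrs r ''O'' w < n"
      using r True by (auto simp: A4_def A3_def)
    \<comment> \<open>Parents lead back within the class, with falling order numbers, to a vertex
      that is its own label.\<close>
    have "(L w, w) \<in> rtrancl_on (class_of n L (L w)) (set xs)" if "w < n" "L w \<noteq> v" for w
      using that
    proof (induction "arrs r ''O'' w" arbitrary: w rule: less_induct)
      case less
      show ?case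
      proof (cases "L w = w")
        case True
        then show ?thesis using less.prems by (auto simp: class_of_def)
      next
        case False
        have "w \<noteq> v" using less.prems v by auto
        with C False all less.prems obtain a where a: "(a, w) \<in> set xs" "L a = L w" "arrs r ''O'' a < arrs r ''O'' w"
          unfolding C_def by blast
        then have "(L a, a) \<in> rtrancl_on (class_of n L (L a)) (set xs)"
          using less.hyps[of a] less.prems xs by auto
        with a show ?thesis using less.prems by (auto simp: class_of_def intro: rtrancl_on_into_rtrancl_on)
      qed
    qed
    then have "B r" using A0r by (auto simp: B_def split_stable_def A0_def)
    moreover have "regs r ''n'' = n" using A0r by (simp add: A0_def ctx_def)
    ultimately show ?thesis using True by (simp add: split_off_def)
  next
    case False
    define x where "x = regs r ''x''"
    have A0r: "A0 r" and C: "C (arrs r ''O'')" and x: "x < n" "L x \<noteq> v" "n \<le> arrs r ''O'' x"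
      using r False by (auto simp: A4_def A3_def x_def)
    have cr: "ctx W n v xs H X T L r" using A0r by (simp add: A0_def)
    have rL: "arrs r ''L'' = L" "regs r ''n'' = n" "L x \<le> n" using cr x by (auto simp: ctx_def)
    let ?r = "r\<lparr>regs := (regs r)(''f'' := 1, ''y'' := L x)\<rparr>"
    have "runs W relabel ?r (\<lambda>t r. t + 3 \<le> 4 * n + 5 \<and> B r)"
    proof (rule runs_relabel[OF W])
      fix t :: nat and r' :: state
      assume u: "unchanged relabel ?r r'" and t: "t \<le> 4 * n + 2" and
        L': "arrs r' ''L'' = (\<lambda>w. if w < n \<and> n \<le> arrs ?r ''O'' w \<and> arrs ?r ''L'' w = regs ?r ''y''
        then regs ?r ''x'' else arrs ?r ''L'' w)"
      define L' where "L' = arrs r' ''L''"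
      \<comment> \<open>The visited vertices are closed under edges that avoid \<open>v\<close> and
        stay in a class, as \<open>admissible_split\<close> demands.\<close>
      define R where "R = {w. arrs r ''O'' w < n}"
      have L'_eq: "L' = (\<lambda>w. if w < n \<and> w \<notin> R \<and> L w = L x then x else L w)"
        using L' rL by (auto simp: L'_def R_def x_def)
      have xR: "x \<notin> R" "L x \<noteq> x" using x C by (auto simp: C_def R_def)
      have rep: "w \<in> R" if "w < n" "L w = w" for w using C that by (simp add: C_def R_def)
      note pot = potential_relabel[OF _ xR(2) rep xR(1) v(2) L'_eq]
      have xv: "x \<noteq> v" using x v by auto
      have "admissible (set xs) n v L'"
      proof (rule admissible_split[OF adm xv])
        show "L' v = v" using rep v by (simp add: L'_eq)
        show "b \<in> R" if "(a, b) \<in> set xs" "a \<in> R" "a \<noteq> v" "b \<noteq> v" "L a = L b" for a b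
          using C that unfolding C_def R_def by blast
        show "L' w = (if w \<notin> R \<and> L w = L x then x else L w)" if "w < n" for w
          using that by (simp add: L'_eq)
      qed
      moreover have "ctx W n v xs H X T L' r'"
      proof -
        have "adj_repr n xs H X T r'"
          using cr nam unchanged_arrs[OF u] by (auto simp: ctx_def adj_repr_def)
        moreover have "regs r' ''n'' = n" "regs r' ''v'' = v"
          using cr unchanged_regs[OF u] by (simp_all add: ctx_def)
        moreover have "L' v = v" "\<forall>w<n. L' w \<le> n" using cr rep v x by (auto simp: L'_eq ctx_def)
        ultimately show ?thesis using cr nam by (simp add: ctx_def L'_def)
      qed
      moreover have "regs r' ''f'' = 1" using unchanged_regs[OF u] by simp
      moreover have "x \<in> alive n v L" using x by (simp add: alive_def)
      ultimately have "B r'" unfolding B_def using pot by blast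
      then show "t + 3 \<le> 4 * n + 5 \<and> B r'" using t by simp
    qed (use x rL in \<open>simp_all add: x_def\<close>)
    then show ?thesis using x rL W by (simp add: split_off_def x_def)
  qed
  have "runs W (split_classes H X T) s
    (\<lambda>t r. t \<le> (3 * n + 5) + ((6 * n + 3) + ((8 * (n + length xs) + 2) + ((4 * n + 3) + (4 * n + 5)))) \<and> B r)"
    unfolding split_classes_def
    by (rule runs_SeqI[OF 1 runs_SeqI[OF 2 runs_SeqI[OF 3 runs_SeqI[OF 4 5]]]])
  then show ?thesis by (rule runs_conseq) (auto simp: B_def)
qed

section \<open>Local searches for dominated sets\<close>

text \<open>\<open>a\<close> holds the only preceding vertex met so far, shifted by one, with 0 for
  none. \<open>c\<close> counts the edges read against the budget \<open>s\<close>.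
  \<open>k = 0\<close> reports failure: budget exceeded, \<open>v\<close> met, or a second preceding
  vertex met.\<close>

definition "local_body Z H X T =
  If (Eq (V ''e'') (N 0))
    (Seq (Assign ''x'' (A ''B'' (V ''p'')))
    (Seq (inc ''p'')
      (Assign ''e'' (A H (V ''x'')))))
    (Seq (Assign ''y'' (A T (Minus (V ''e'') (N 1))))
    (Seq (Assign ''e'' (A X (Minus (V ''e'') (N 1))))
    (Seq (inc ''c'')
      (If (Less (V ''s'') (V ''c'')) (Assign ''k'' (N 0))
      (If (Eq (V ''y'') (V ''v'')) (Assign ''k'' (N 0))
      (If (Eq (A ''L'' (V ''y'')) (A ''L'' (V ''h'')))
        (If (Less (A Z (V ''y'')) (A Z (V ''h'')))
          (If (Eq (V ''a'') (N 0)) (Assign ''a'' (Plus (V ''y'') (N 1)))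
            (If (Eq (V ''a'') (Plus (V ''y'') (N 1))) Skip (Assign ''k'' (N 0))))
          (If (Eq (A ''M'' (V ''y'')) (N 0))
            (Seq (Store ''M'' (V ''y'') (N 1))
            (Seq (Store ''B'' (V ''b'') (V ''y''))
              (inc ''b'')))
            Skip))
        Skip))))))"

lemma mod_local_body [simp]:
  "mod_regs (local_body Z H X T) = {''e'', ''x'', ''y'', ''p'', ''c'', ''k'', ''a'', ''b''}"
  "mod_arrs (local_body Z H X T) = {''B'', ''M''}"
  by (auto simp: local_body_def)

text \<open>The conjunct for \<open>k = 1\<close> makes the final list a closed set. The last
  conjunct makes failure meaningful: every closed set with first vertex \<open>h\<close> contains
  all vertices listed so far and has the same exception \<open>a\<close>, so if one exists only the
  budget can stop the search. The bounds on \<open>b\<close> and \<open>c\<close> keep the cost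
  linear in the budget.\<close>

definition local_inv ::
    "(nat \<times> nat) list \<Rightarrow> nat \<Rightarrow> nat \<Rightarrow> (nat \<Rightarrow> nat) \<Rightarrow> (nat \<Rightarrow> nat) \<Rightarrow> nat \<Rightarrow> nat \<Rightarrow> (nat \<Rightarrow> nat) \<Rightarrow>
      (nat \<Rightarrow> nat) \<Rightarrow> (nat \<Rightarrow> nat) \<Rightarrow> nat \<Rightarrow> nat \<Rightarrow> nat \<Rightarrow> nat \<Rightarrow> nat \<Rightarrow> nat set \<Rightarrow> nat \<Rightarrow> bool" where
  "local_inv ys n v L ord h bud nx B M b p e a k J c \<longleftrightarrow>
     scanning ys nx B 0 p e J c \<and> p \<le> b \<and> 0 < b \<and> B 0 = h \<and> inj_on B {..<b} \<and>
     (\<forall>i<b. B i < n \<and> L (B i) = L h \<and> ord h \<le> ord (B i)) \<and>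
     (\<forall>w. M w = (if w \<in> B ` {..<b} then 1 else 0)) \<and>
     b \<le> Suc c \<and> k \<le> 1 \<and> (k = 1 \<longrightarrow> c \<le> bud) \<and> c \<le> Suc bud \<and>
     (k = 1 \<longrightarrow> (\<forall>j\<in>J. snd (ys ! j) \<noteq> v \<and> (L (snd (ys ! j)) = L h \<longrightarrow>
        (if ord (snd (ys ! j)) < ord h then a = Suc (snd (ys ! j)) else snd (ys ! j) \<in> B ` {..<b})))) \<and>
     (\<forall>D d. closed_set (set ys) n v L ord h D d \<longrightarrow>
        B ` {..<b} \<subseteq> D \<and> (a = 0 \<or> a = Suc d) \<and> (k = 0 \<longrightarrow> bud < c))"

lemma local_inv_le:
  assumes "local_inv ys n v L ord h bud nx B M b p e a k J c"
  shows "b \<le> n"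
proof -
  have "B ` {..<b} \<subseteq> {..<n}" "inj_on B {..<b}" using assms by (auto simp: local_inv_def)
  from card_inj_on_le[OF this(2,1)] show ?thesis by simp
qed

lemma local_inv_pop:
  assumes "local_inv ys n v L ord h bud nx B M b p 0 a k J c" "p < b" "chain nx e (outs ys (B p))"
  shows "local_inv ys n v L ord h bud nx B M b (Suc p) e a k J c"
  using assms scanning_pop[of ys nx B 0 p J c e] by (auto simp: local_inv_def)

text \<open>An edge from a listed vertex to \<open>y\<close> starts in every closed set
  \<open>D\<close> with first vertex \<open>h\<close>. So \<open>y\<close> is not \<open>v\<close>,
  and if it lies in the class it either belongs to \<open>D\<close> and does not precede
  \<open>h\<close>, or it is the exception of \<open>D\<close> and precedes \<open>h\<close>. The
  order therefore tells which, without knowledge of \<open>D\<close>.\<close>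

lemma local_inv_step:
  assumes inv: "local_inv ys n v L ord h bud nx B M b p (Suc j) a 1 J c" and y: "y = snd (ys ! j)"
    and ys: "set ys \<subseteq> {..<n} \<times> {..<n}"
  shows "bud < Suc c \<or> y = v \<or> L y = L h \<and> ord y < ord h \<and> a \<noteq> 0 \<and> a \<noteq> Suc y \<Longrightarrow>
      local_inv ys n v L ord h bud nx B M b p (nx j) a 0 (insert j J) (Suc c)"
    and "Suc c \<le> bud \<Longrightarrow> y \<noteq> v \<Longrightarrow> L y \<noteq> L h \<or> ord y < ord h \<and> a = Suc y \<or> ord h \<le> ord y \<and> M y \<noteq> 0 \<Longrightarrow>
      local_inv ys n v L ord h bud nx B M b p (nx j) a 1 (insert j J) (Suc c)"
    and "Suc c \<le> bud \<Longrightarrow> y \<noteq> v \<Longrightarrow> L y = L h \<Longrightarrow> ord y < ord h \<Longrightarrow> a = 0 \<Longrightarrow>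
      local_inv ys n v L ord h bud nx B M b p (nx j) (Suc y) 1 (insert j J) (Suc c)"
    and "Suc c \<le> bud \<Longrightarrow> y \<noteq> v \<Longrightarrow> L y = L h \<Longrightarrow> ord h \<le> ord y \<Longrightarrow> M y = 0 \<Longrightarrow>
      local_inv ys n v L ord h bud nx (B(b := y)) (M(y := 1)) (Suc b) p (nx j) a 1 (insert j J) (Suc c)"
proof -
  have inv': "scanning ys nx B 0 p (Suc j) J c" "p \<le> b" "0 < b" "B 0 = h" "inj_on B {..<b}"
    "\<forall>i<b. B i < n \<and> L (B i) = L h \<and> ord h \<le> ord (B i)"
    "\<forall>w. M w = (if w \<in> B ` {..<b} then 1 else 0)" "b \<le> Suc c" "c \<le> bud"
    "\<forall>j\<in>J. snd (ys ! j) \<noteq> v \<and> (L (snd (ys ! j)) = L h \<longrightarrow>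
        (if ord (snd (ys ! j)) < ord h then a = Suc (snd (ys ! j)) else snd (ys ! j) \<in> B ` {..<b}))"
    using inv unfolding local_inv_def by simp_all
  have cl: "B ` {..<b} \<subseteq> D \<and> (a = 0 \<or> a = Suc d)" if "closed_set (set ys) n v L ord h D d" for D d
    using inv that unfolding local_inv_def by blast
  note sc = scanning_step[OF inv'(1)]
  define x where "x = B (p - 1)"
  have "p - 1 < b" using sc(3) inv'(2) by simp
  then have xB: "x \<in> B ` {..<b}" by (auto simp: x_def)
  have "ys ! j = (x, y)" using sc(2) y by (metis prod.collapse x_def)
  then have xy: "(x, y) \<in> set ys" using sc(1) by (metis nth_mem)
  then have yn: "y < n" using ys by auto
  have D: "y \<noteq> v \<and> (L y = L h \<longrightarrow> y \<in> D \<and> ord h \<le> ord y \<or> y = d \<and> ord y < ord h)"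
    if "closed_set (set ys) n v L ord h D d" for D d
    using that cl[OF that] xB xy unfolding closed_set_def by blast
  show "local_inv ys n v L ord h bud nx B M b p (nx j) a 0 (insert j J) (Suc c)"
    if *: "bud < Suc c \<or> y = v \<or> L y = L h \<and> ord y < ord h \<and> a \<noteq> 0 \<and> a \<noteq> Suc y"
    unfolding local_inv_def
  proof (intro conjI allI impI)
    fix D d assume c: "closed_set (set ys) n v L ord h D d"
    show "B ` {..<b} \<subseteq> D" "a = 0 \<or> a = Suc d" using cl[OF c] by auto
    show "bud < Suc c" using * D[OF c] cl[OF c] by auto
  qed (use inv'(8,9) in \<open>simp_all add: inv'(2-7) sc(4)\<close>)
  show "local_inv ys n v L ord h bud nx B M b p (nx j) a 1 (insert j J) (Suc c)"
    if *: "Suc c \<le> bud" "y \<noteq> v" "L y \<noteq> L h \<or> ord y < ord h \<and> a = Suc y \<or> ord h \<le> ord y \<and> M y \<noteq> 0"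
    unfolding local_inv_def
  proof (intro conjI allI impI)
    fix D d assume c: "closed_set (set ys) n v L ord h D d"
    show "B ` {..<b} \<subseteq> D" "a = 0 \<or> a = Suc d" using cl[OF c] by auto
  next
    show "\<forall>i\<in>insert j J. snd (ys ! i) \<noteq> v \<and> (L (snd (ys ! i)) = L h \<longrightarrow>
        (if ord (snd (ys ! i)) < ord h then a = Suc (snd (ys ! i)) else snd (ys ! i) \<in> B ` {..<b}))"
      using inv'(10) inv'(7)[rule_format, of y] * unfolding y by (auto split: if_splits)
  qed (use inv'(8,9) * in \<open>simp_all add: inv'(2-7) sc(4)\<close>)
  show "local_inv ys n v L ord h bud nx B M b p (nx j) (Suc y) 1 (insert j J) (Suc c)"
    if *: "Suc c \<le> bud" "y \<noteq> v" "L y = L h" "ord y < ord h" "a = 0"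
    unfolding local_inv_def
  proof (intro conjI allI impI)
    fix D d assume c: "closed_set (set ys) n v L ord h D d"
    show "B ` {..<b} \<subseteq> D" using cl[OF c] by auto
    show "Suc y = 0 \<or> Suc y = Suc d" using D[OF c] * by auto
  next
    show "\<forall>i\<in>insert j J. snd (ys ! i) \<noteq> v \<and> (L (snd (ys ! i)) = L h \<longrightarrow>
        (if ord (snd (ys ! i)) < ord h then Suc y = Suc (snd (ys ! i)) else snd (ys ! i) \<in> B ` {..<b}))"
      using inv'(10) * unfolding y by (auto split: if_splits)
  qed (use inv'(8,9) * in \<open>simp_all add: inv'(2-7) sc(4)\<close>)
  show "local_inv ys n v L ord h bud nx (B(b := y)) (M(y := 1)) (Suc b) p (nx j) a 1 (insert j J) (Suc c)"
    if *: "Suc c \<le> bud" "y \<noteq> v" "L y = L h" "ord h \<le> ord y" "M y = 0"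
  proof -
    have yB: "y \<notin> B ` {..<b}" using inv'(7) *(5) by (auto split: if_splits)
    have im: "(B(b := y)) ` {..<Suc b} = insert y (B ` {..<b})"
      by (auto simp: less_Suc_eq image_iff)
    show ?thesis
      unfolding local_inv_def im
    proof (intro conjI allI impI)
      show "scanning ys nx (B(b := y)) 0 p (nx j) (insert j J) (Suc c)"
        by (rule scanning_cong[OF sc(4)]) (use inv'(2) in auto)
      show "inj_on (B(b := y)) {..<Suc b}"
        unfolding lessThan_Suc using inv'(5) yB by (auto simp: inj_on_def)
      show "(M(y := 1)) w = (if w \<in> insert y (B ` {..<b}) then 1 else 0)" for w
        using inv'(7) by simp
      fix D d assume c: "closed_set (set ys) n v L ord h D d"
      show "insert y (B ` {..<b}) \<subseteq> D" "a = 0 \<or> a = Suc d" using cl[OF c] D[OF c] * by auto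
    next
      show "\<forall>i\<in>insert j J. snd (ys ! i) \<noteq> v \<and> (L (snd (ys ! i)) = L h \<longrightarrow>
          (if ord (snd (ys ! i)) < ord h then a = Suc (snd (ys ! i)) else snd (ys ! i) \<in> insert y (B ` {..<b})))"
        using inv'(10) * unfolding y by (auto split: if_splits)
    qed (use inv'(2-4,6,8,9) * yn in \<open>auto simp: less_Suc_eq\<close>)
  qed
qed

abbreviation "state_local_inv ys n v L ord h bud nx r J \<equiv>
  local_inv ys n v L ord h bud nx (arrs r ''B'') (arrs r ''M'') (regs r ''b'') (regs r ''p'') (regs r ''e'')
    (regs r ''a'') (regs r ''k'') J (regs r ''c'')"

text \<open>As in \<open>search_step\<close>, \<open>p + c\<close> grows by one per iteration. The
  \<open>12\<close> steps are those of the branch that lists a new vertex.\<close>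

lemma runs_local_body:
  assumes inv: "state_local_inv ys n v L ord h bud nx s J"
    and b: "regs s ''k'' = 1" "regs s ''e'' \<noteq> 0 \<or> regs s ''p'' < regs s ''b''"
    and ctx: "ctx W n v ys H X T L s" and g: "arrs s X = nx" "arrs s Z = ord" "regs s ''h'' = h" "regs s ''s'' = bud"
    and W: "bud + 2 < W"
  shows "runs W (local_body Z H X T) s (\<lambda>t s'. t \<le> 12 \<and>
    (\<exists>J'. state_local_inv ys n v L ord h bud nx s' J' \<and> regs s' ''p'' + regs s' ''c'' = Suc (regs s ''p'' + regs s ''c'')))"
proof (cases "regs s ''e'' = 0")
  case True
  define p where "p = regs s ''p''"
  let ?u = "arrs s ''B'' p"
  have pq: "p < regs s ''b''" using b True by (simp add: p_def)
  have u: "?u < n" using inv pq by (auto simp: local_inv_def)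
  have "n + length ys + 2 < W" and adj: "adj_repr n ys H X T s" using ctx by (auto simp: ctx_def)
  have "Suc p < W" "arrs s H ?u < W"
    using local_inv_le[OF inv] pq \<open>n + length ys + 2 < W\<close> adj_repr_le(1)[OF adj u] by simp_all
  moreover have "local_inv ys n v L ord h bud nx (arrs s ''B'') (arrs s ''M'') (regs s ''b'') (Suc p) (arrs s H ?u)
    (regs s ''a'') (regs s ''k'') J (regs s ''c'')"
    by (rule local_inv_pop) (use inv True adj u g pq in \<open>auto simp: adj_repr_def p_def\<close>)
  ultimately show ?thesis
    using True u \<open>n + length ys + 2 < W\<close> by (simp add: local_body_def flip: p_def) blast
next
  case False
  then obtain j where j: "regs s ''e'' = Suc j" using not0_implies_Suc by blast
  have W': "n + length ys + 2 < W" and adj: "adj_repr n ys H X T s" and ys: "set ys \<subseteq> {..<n} \<times> {..<n}"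
    and r: "arrs s ''L'' = L" "regs s ''v'' = v"
    and nam: "X \<notin> {''B'', ''M''}" "T \<notin> {''B'', ''M''}" using ctx by (auto simp: ctx_def)
  define c where "c = regs s ''c''"
  define a where "a = regs s ''a''"
  define bb where "bb = regs s ''b''"
  note inv1 = inv[unfolded b(1) j]
  have sc: "scanning ys nx (arrs s ''B'') 0 (regs s ''p'') (Suc j) J c" using inv1 by (simp add: local_inv_def c_def)
  have jl: "j < length ys" using scanning_step(1)[OF sc] .
  define y where "y = snd (ys ! j)"
  have Ty: "arrs s T j = y" using adj jl by (simp add: adj_repr_def y_def)
  have "y < n" using ys nth_mem[OF jl] unfolding y_def by (cases "ys ! j") auto
  moreover have "nx j < W" using adj_repr_le(2)[OF adj jl ys] W' g by simp
  moreover have cb: "c \<le> bud" using inv1 by (simp add: local_inv_def c_def)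
  moreover have "bb \<le> n" using local_inv_le[OF inv] by (simp add: bb_def)
  ultimately have bnd: "y < W" "Suc y < W" "nx j < W" "Suc c < W" "bb < W" "Suc bb < W" "0 < W" "1 < W"
    using W W' by auto
  note steps = local_inv_step[OF inv1 y_def ys, folded c_def a_def bb_def]
  note facts = False j Ty g r bnd nam
  consider "bud < Suc c \<or> y = v \<or> L y = L h \<and> ord y < ord h \<and> a \<noteq> 0 \<and> a \<noteq> Suc y"
    | "Suc c \<le> bud" "y \<noteq> v" "L y \<noteq> L h \<or> ord y < ord h \<and> a = Suc y \<or> ord h \<le> ord y \<and> arrs s ''M'' y \<noteq> 0"
    | "Suc c \<le> bud" "y \<noteq> v" "L y = L h" "ord y < ord h" "a = 0"
    | "Suc c \<le> bud" "y \<noteq> v" "L y = L h" "ord h \<le> ord y" "arrs s ''M'' y = 0"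
    by linarith
  then show ?thesis
  proof cases
    case 1
    from 1 steps(1)[OF 1] facts b(1) show ?thesis
      by (simp add: local_body_def flip: c_def a_def bb_def) blast
  next
    case 2
    note I = steps(2)[OF 2]
    from 2(3) consider "L y \<noteq> L h" | "L y = L h" "ord y < ord h" "a = Suc y"
      | "L y = L h" "\<not> ord y < ord h" "arrs s ''M'' y \<noteq> 0" by (metis not_le)
    then show ?thesis
      by cases (insert 2(1,2) I facts b(1), simp_all add: local_body_def flip: c_def a_def bb_def; blast)+
  next
    case 3
    from 3 steps(3)[OF 3] facts b(1) show ?thesis
      by (simp add: local_body_def flip: c_def a_def bb_def) blast
  next
    case 4
    from 4 steps(4)[OF 4] facts b(1) show ?thesis
      by (simp add: local_body_def flip: c_def a_def bb_def) blast
  qed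
qed

definition volume :: "(nat \<times> nat) list \<Rightarrow> nat set \<Rightarrow> nat" where
  "volume ys D = (\<Sum>x\<in>D. deg ys x)"

definition discard :: "nat \<Rightarrow> nat set \<Rightarrow> (nat \<Rightarrow> nat) \<Rightarrow> nat \<Rightarrow> nat" where
  "discard v D L = (\<lambda>w. if w \<in> D then v else L w)"

definition "local_loop Z H X T =
  While (And (Eq (V ''k'') (N 1)) (Not (And (Eq (V ''e'') (N 0)) (Not (Less (V ''p'') (V ''b'')))))) (local_body Z H X T)"

text \<open>The marks are erased along the list \<open>B\<close> instead of over all vertices, so
  that a local search costs no more than its budget allows.\<close>

definition "local_end =
  Seq (For ''i'' (V ''b'')
    (Seq (Store ''M'' (A ''B'' (V ''i'')) (N 0))
      (If (Eq (V ''k'') (N 1)) (Store ''L'' (A ''B'' (V ''i'')) (V ''v'')) Skip)))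
  (Assign ''f'' (V ''k''))"

definition "local_start =
  Seq (Store ''B'' (N 0) (V ''h''))
  (Seq (Store ''M'' (V ''h'') (N 1))
  (Seq (Assign ''b'' (N 1))
  (Seq (Assign ''p'' (N 0))
  (Seq (Assign ''e'' (N 0))
  (Seq (Assign ''a'' (N 0))
  (Seq (Assign ''c'' (N 0))
    (Assign ''k'' (N 1))))))))"

definition "local_search Z H X T = Seq local_start (Seq (local_loop Z H X T) local_end)"

lemma mod_local [simp]:
  "mod_regs local_start = {''b'', ''p'', ''e'', ''a'', ''c'', ''k''}" "mod_arrs local_start = {''B'', ''M''}"
  "mod_regs (local_loop Z H X T) = {''e'', ''x'', ''y'', ''p'', ''c'', ''k'', ''a'', ''b''}"
  "mod_arrs (local_loop Z H X T) = {''B'', ''M''}"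
  "mod_regs local_end = {''i'', ''f''}" "mod_arrs local_end = {''L'', ''M''}"
  "mod_regs (local_search Z H X T) = {''e'', ''x'', ''y'', ''p'', ''c'', ''k'', ''a'', ''b'', ''i'', ''f''}"
  "mod_arrs (local_search Z H X T) = {''B'', ''L'', ''M''}"
  by (auto simp: local_start_def local_loop_def local_end_def local_search_def)

lemma runs_local_loop:
  assumes ctx: "ctx W n v ys H X T L s"
    and s: "arrs s Z = ord" "regs s ''h'' = h" "regs s ''s'' = bud" "bud + 2 < W" "Z \<notin> {''B'', ''M''}"
    and init: "state_local_inv ys n v L ord h bud (arrs s X) s {}" "regs s ''c'' = 0" "regs s ''p'' = 0"
  shows "runs W (local_loop Z H X T) s (\<lambda>t r. t \<le> 26 * bud + 40 \<and> ctx W n v ys H X T L r \<and> regs r ''b'' \<le> bud + 2 \<and>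
    (\<exists>J. state_local_inv ys n v L ord h bud (arrs s X) r J \<and>
      \<not> (regs r ''k'' = 1 \<and> \<not> (regs r ''e'' = 0 \<and> \<not> regs r ''p'' < regs r ''b''))))"
proof -
  let ?c = "local_body Z H X T"
  let ?I = "\<lambda>t r. t \<le> 13 * (regs r ''p'' + regs r ''c'') \<and> (\<exists>J. state_local_inv ys n v L ord h bud (arrs s X) r J)"
  have ctx': "ctx W n v ys H X T L r" if "unchanged ?c s r" for r
    by (rule ctx_unchanged[OF that ctx]) auto
  have X: "X \<noteq> ''B''" "X \<noteq> ''M''" using ctx by (auto simp: ctx_def)
  have le: "regs r ''p'' \<le> bud + 2" "regs r ''c'' \<le> bud + 1" "regs r ''b'' \<le> bud + 2"
    if "state_local_inv ys n v L ord h bud (arrs s X) r J" for r J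
  proof -
    have "regs r ''p'' \<le> regs r ''b''" "regs r ''b'' \<le> Suc (regs r ''c'')" "regs r ''c'' \<le> Suc bud"
      using that by (simp_all add: local_inv_def)
    then show "regs r ''p'' \<le> bud + 2" "regs r ''c'' \<le> bud + 1" "regs r ''b'' \<le> bud + 2" by linarith+
  qed
  show ?thesis
    unfolding local_loop_def
  \<comment> \<open>Each unit of \<open>p + c\<close> costs \<open>13\<close>, the body and the loop
    test. With \<open>p\<close> at most \<open>bud + 2\<close> and \<open>c\<close> at most
    \<open>bud + 1\<close> this gives \<open>26 * bud + 39\<close>.\<close>
  proof (rule runs_While[where I = ?I and U = "26 * bud + 39"])
    show "?I 0 s" using init by auto
    show "t \<le> 26 * bud + 39" if "?I t r" for t and r :: state
    proof -
      from that obtain J where "t \<le> 13 * (regs r ''p'' + regs r ''c'')"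
        "state_local_inv ys n v L ord h bud (arrs s X) r J" by blast
      with le(1,2)[OF this(2)] show ?thesis by simp
    qed
  next
    fix t and r :: state
    assume I: "?I t r" and u: "unchanged ?c s r"
      and b: "bval (And (Eq (V ''k'') (N 1)) (Not (And (Eq (V ''e'') (N 0)) (Not (Less (V ''p'') (V ''b'')))))) r"
    from I obtain J where t: "t \<le> 13 * (regs r ''p'' + regs r ''c'')"
      and J: "state_local_inv ys n v L ord h bud (arrs s X) r J" by blast
    show "runs W ?c r (\<lambda>u. ?I (t + u + 1))"
    proof (rule runs_conseq[OF runs_local_body[OF J _ _ ctx'[OF u]]])
      fix u :: nat and r' :: state
      assume "u \<le> 12 \<and> (\<exists>J'. state_local_inv ys n v L ord h bud (arrs s X) r' J' \<and>
        regs r' ''p'' + regs r' ''c'' = Suc (regs r ''p'' + regs r ''c''))"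
      then show "?I (t + u + 1) r'" using t by auto
    qed (use b s unchanged_regs[OF u] unchanged_arrs[OF u] X in auto)
  next
    fix t and r :: state
    assume I: "?I t r" and u: "unchanged ?c s r"
      and b: "\<not> bval (And (Eq (V ''k'') (N 1)) (Not (And (Eq (V ''e'') (N 0)) (Not (Less (V ''p'') (V ''b'')))))) r"
    from I obtain J where t: "t \<le> 13 * (regs r ''p'' + regs r ''c'')"
      and J: "state_local_inv ys n v L ord h bud (arrs s X) r J" by blast
    have "t + 1 \<le> 26 * bud + 40" "regs r ''b'' \<le> bud + 2" using t le[OF J] by simp_all
    moreover have "\<not> (regs r ''k'' = 1 \<and> \<not> (regs r ''e'' = 0 \<and> \<not> regs r ''p'' < regs r ''b''))"
      using b by simp
    ultimately show "t + 1 \<le> 26 * bud + 40 \<and> ctx W n v ys H X T L r \<and> regs r ''b'' \<le> bud + 2 \<and>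
      (\<exists>J. state_local_inv ys n v L ord h bud (arrs s X) r J \<and>
        \<not> (regs r ''k'' = 1 \<and> \<not> (regs r ''e'' = 0 \<and> \<not> regs r ''p'' < regs r ''b'')))"
      using ctx'[OF u] J by blast
  qed
qed

lemma runs_local_end:
  assumes B: "\<And>i. i < regs s ''b'' \<Longrightarrow> arrs s ''B'' i < n" "regs s ''b'' \<le> n" "n + 2 < W" "regs s ''v'' < n" "regs s ''k'' \<le> 1"
    and M: "\<And>w. arrs s ''M'' w \<noteq> 0 \<Longrightarrow> w \<in> arrs s ''B'' ` {..<regs s ''b''}"
  shows "runs W local_end s (\<lambda>t r. t \<le> 5 * regs s ''b'' + 3 \<and> (\<forall>w. arrs r ''M'' w = 0) \<and> regs r ''f'' = regs s ''k'' \<and>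
    arrs r ''L'' = (if regs s ''k'' = 1 then discard (regs s ''v'') (arrs s ''B'' ` {..<regs s ''b''}) (arrs s ''L'') else arrs s ''L''))"
proof -
  let ?B = "arrs s ''B''" and ?b = "regs s ''b''"
  let ?c = "Seq (Store ''M'' (A ''B'' (V ''i'')) (N 0))
      (If (Eq (V ''k'') (N 1)) (Store ''L'' (A ''B'' (V ''i'')) (V ''v'')) Skip)"
  define I where "I k r \<longleftrightarrow> (\<forall>w. arrs r ''M'' w \<noteq> 0 \<longrightarrow> w \<in> ?B ` {k..<?b}) \<and>
    arrs r ''L'' = (if regs s ''k'' = 1 then discard (regs s ''v'') (?B ` {..<k}) (arrs s ''L'') else arrs s ''L'')" for k and r :: state
  have "runs W (For ''i'' (V ''b'') ?c) s (\<lambda>t r. t + 1 \<le> 5 * regs s ''b'' + 3 \<and> (\<forall>w. arrs r ''M'' w = 0) \<and> regs r ''k'' = regs s ''k'' \<and>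
    arrs r ''L'' = (if regs s ''k'' = 1 then discard (regs s ''v'') (?B ` {..<?b}) (arrs s ''L'') else arrs s ''L''))"
  proof (rule runs_For[where n = ?b and B = "\<lambda>_. 3" and I = I])
    show "?b < W" "0 < W" using B by auto
    show "I 0 (s\<lparr>regs := (regs s)(''i'' := 0)\<rparr>)" using M by (auto simp: I_def discard_def atLeast0LessThan)
  next
    fix r :: state
    assume u: "unchanged (For ''i'' (V ''b'') ?c) s r"
    have r: "regs r ''b'' = ?b" "regs r ''k'' = regs s ''k''" "regs r ''v'' = regs s ''v''" "arrs r ''B'' = ?B"
      by (simp_all add: unchanged_regs[OF u] unchanged_arrs[OF u])
    then show "aval (V ''b'') r = ?b" by simp
    show "runs W ?c r (\<lambda>u r'. u \<le> 3 \<and> regs r' ''i'' = k \<and> I (Suc k) (r'\<lparr>regs := (regs r')(''i'' := Suc k)\<rparr>))"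
      if k: "k < ?b" and I: "I k r" and i: "regs r ''i'' = k" for k
    proof -
      have "{k..<?b} = insert k {Suc k..<?b}" using k by auto
      then have M: "arrs r ''M'' w \<noteq> 0 \<Longrightarrow> w \<noteq> ?B k \<Longrightarrow> w \<in> ?B ` {Suc k..<?b}" for w
        using I unfolding I_def by auto
      have "discard (regs s ''v'') (?B ` {..<Suc k}) (arrs s ''L'') =
          (discard (regs s ''v'') (?B ` {..<k}) (arrs s ''L''))(?B k := regs s ''v'')"
        by (auto simp: discard_def fun_eq_iff less_Suc_eq image_iff)
      with M I k i r B(1)[OF k] B(2-) show ?thesis by (auto simp: I_def)
    qed
    show "t + 1 \<le> 5 * ?b + 3 \<and> (\<forall>w. arrs r ''M'' w = 0) \<and> regs r ''k'' = regs s ''k'' \<and>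
      arrs r ''L'' = (if regs s ''k'' = 1 then discard (regs s ''v'') (?B ` {..<?b}) (arrs s ''L'') else arrs s ''L'')"
      if "I ?b r" "t \<le> (\<Sum>k<?b. 3) + 2 * ?b + 2" for t
      using that r by (auto simp: I_def)
  qed
  then show ?thesis
    unfolding local_end_def runs_Seq
    by (rule runs_conseq) (use B in \<open>auto split: if_splits\<close>)
qed

abbreviation "local_outcome W n v ys H X T L ord h bud r \<equiv> (\<forall>w. arrs r ''M'' w = 0) \<and>
  (regs r ''f'' = 0 \<and> ctx W n v ys H X T L r \<and>
     (\<forall>D d. closed_set (set ys) n v L ord h D d \<longrightarrow> bud < volume ys D) \<or>
   regs r ''f'' = 1 \<and> (\<exists>D d. closed_set (set ys) n v L ord h D d \<and> ctx W n v ys H X T (discard v D L) r))"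

text \<open>Failure certifies that every closed set with first vertex \<open>h\<close> has more than
  \<open>bud\<close> edges; success produces one. The coefficient \<open>31\<close> is
  \<open>26\<close> for the loop plus \<open>5\<close> for the cleanup of each listed
  vertex.\<close>

lemma runs_local_search:
  assumes ctx: "ctx W n v ys H X T L s"
    and s: "arrs s Z = ord" "regs s ''h'' = h" "regs s ''s'' = bud" "bud + 2 < W" "Z \<notin> {''B'', ''M''}"
    and h: "h < n" "L h \<noteq> v" and M: "\<And>w. arrs s ''M'' w = 0"
  shows "runs W (local_search Z H X T) s (\<lambda>t r. t \<le> 31 * bud + 61 \<and> local_outcome W n v ys H X T L ord h bud r)"
proof -
  have W: "n + length ys + 2 < W" and nam: "{H, X, T} \<inter> {''O'', ''Q'', ''L'', ''B'', ''M'', ''P''} = {}" and v: "v < n"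
    and ys: "set ys \<subseteq> {..<n} \<times> {..<n}"
    using ctx by (auto simp: ctx_def)
  define G where "G r \<longleftrightarrow> ctx W n v ys H X T L r \<and> arrs r Z = ord \<and> regs r ''h'' = h \<and> regs r ''s'' = bud" for r
  have G_un: "G r'" if "unchanged c r r'" "G r" "mod_arrs c \<subseteq> {''B'', ''M''}"
    "{''n'', ''v'', ''h'', ''s''} \<inter> mod_regs c = {}" for c r r'
  proof -
    have "mod_arrs c \<subseteq> {''O'', ''Q'', ''B'', ''M'', ''P''}" "Z \<notin> mod_arrs c"
      by (rule order_trans[OF that(3)], simp) (rule contra_subsetD[OF that(3) s(5)])
    then show ?thesis using that(2,4) ctx_unchanged[OF that(1)] unchanged_regs[OF that(1)] unchanged_arrs[OF that(1)]
      by (simp add: G_def)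
  qed
  have Gs: "G s" using ctx s by (simp add: G_def)
  define P1 where "P1 r \<longleftrightarrow> G r \<and> state_local_inv ys n v L ord h bud (arrs r X) r {} \<and> regs r ''c'' = 0 \<and> regs r ''p'' = 0" for r
  define P2 where "P2 r \<longleftrightarrow> ctx W n v ys H X T L r \<and> regs r ''b'' \<le> bud + 2 \<and>
    (\<exists>nx J. state_local_inv ys n v L ord h bud nx r J \<and>
      \<not> (regs r ''k'' = 1 \<and> \<not> (regs r ''e'' = 0 \<and> \<not> regs r ''p'' < regs r ''b'')))" for r
  have 1: "runs W local_start s (\<lambda>t r. t \<le> 8 \<and> P1 r)"
  proof -
    have "local_inv ys n v L ord h bud nx ((arrs s ''B'')(0 := h)) ((arrs s ''M'')(h := 1)) 1 0 0 0 1 {} 0" for nx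
      unfolding local_inv_def using h M
      by (auto simp: scanning_init closed_set_def class_of_def lessThan_Suc)
    then have "runs W local_start s (\<lambda>t r. t \<le> 8 \<and> state_local_inv ys n v L ord h bud (arrs r X) r {} \<and> regs r ''c'' = 0 \<and> regs r ''p'' = 0)"
      using s h W by (simp add: local_start_def)
    then show ?thesis by (rule runs_conseq) (use G_un[OF _ Gs, of local_start] in \<open>auto simp: P1_def\<close>)
  qed
  have 2: "runs W (local_loop Z H X T) r (\<lambda>t r. t \<le> 26 * bud + 40 \<and> P2 r)" if "P1 r" for r
    by (rule runs_conseq[OF runs_local_loop[of W n v ys H X T L r Z ord h bud]])
      (use that s in \<open>auto simp: P1_def G_def P2_def\<close>)
  have 3: "runs W local_end r (\<lambda>t r. t \<le> 5 * bud + 13 \<and> local_outcome W n v ys H X T L ord h bud r)"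
    if r: "P2 r" for r
  proof -
    let ?B = "arrs r ''B''" and ?b = "regs r ''b''" and ?k = "regs r ''k''"
    let ?D = "?B ` {..<?b}"
    from r obtain nx J where inv: "state_local_inv ys n v L ord h bud nx r J" and b: "?b \<le> bud + 2"
      and ex: "\<not> (?k = 1 \<and> \<not> (regs r ''e'' = 0 \<and> \<not> regs r ''p'' < ?b))"
      and cr: "ctx W n v ys H X T L r" unfolding P2_def by blast
    have L: "arrs r ''L'' = L" "regs r ''v'' = v" using cr by (auto simp: ctx_def)
    have i: "scanning ys nx ?B 0 (regs r ''p'') (regs r ''e'') J (regs r ''c'')" "regs r ''p'' \<le> ?b" "0 < ?b" "?B 0 = h"
      "inj_on ?B {..<?b}" "\<And>i. i < ?b \<Longrightarrow> ?B i < n \<and> L (?B i) = L h \<and> ord h \<le> ord (?B i)"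
      "\<And>w. arrs r ''M'' w = (if w \<in> ?D then 1 else 0)" "?k \<le> 1"
      "?k = 1 \<Longrightarrow> \<forall>j\<in>J. snd (ys ! j) \<noteq> v \<and> (L (snd (ys ! j)) = L h \<longrightarrow>
        (if ord (snd (ys ! j)) < ord h then regs r ''a'' = Suc (snd (ys ! j)) else snd (ys ! j) \<in> ?D))"
      "\<And>D d. closed_set (set ys) n v L ord h D d \<Longrightarrow> ?D \<subseteq> D \<and> (?k = 0 \<longrightarrow> bud < regs r ''c'')"
      using inv unfolding local_inv_def by blast+
    \<comment> \<open>The edges read belong to distinct listed vertices, all of which lie in
      \<open>D\<close>, so exceeding the budget bounds the volume of \<open>D\<close> from
      below.\<close>
    have zero: "bud < volume ys D" if k: "?k = 0" and D: "closed_set (set ys) n v L ord h D d" for D d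
    proof -
      have fin: "finite D" using D by (auto simp: closed_set_def class_of_def intro: finite_subset)
      have "bud < regs r ''c''" using i(10)[OF D] k by simp
      also have "\<dots> \<le> (\<Sum>i=0..<regs r ''p''. deg ys (?B i))" by (rule scanning_le[OF i(1)])
      also have "\<dots> \<le> (\<Sum>i<?b. deg ys (?B i))" using i(2) by (intro sum_mono2) auto
      also have "\<dots> = volume ys ?D" unfolding volume_def by (rule sum.reindex_cong[OF i(5) refl refl, symmetric])
      also have "\<dots> \<le> volume ys D" unfolding volume_def using fin i(10)[OF D] by (intro sum_mono2) auto
      finally show ?thesis .
    qed
    \<comment> \<open>If \<open>a\<close> is still 0, the truncated \<open>a - 1\<close> is an
      arbitrary witness; then no edge from the list meets a preceding vertex of the class.\<close>
    have one: "closed_set (set ys) n v L ord h ?D (regs r ''a'' - 1)" if k: "?k = 1"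
      unfolding closed_set_def
    proof (intro conjI ballI allI impI)
      show "h \<in> ?D" using i(3,4) by force
      show "?D \<subseteq> class_of n L (L h)" using i(6) by (auto simp: class_of_def)
      show "ord h \<le> ord x" if "x \<in> ?D" for x using that i(6) by auto
      fix x y assume x: "x \<in> ?D" and xy: "(x, y) \<in> set ys"
      have "regs r ''p'' = ?b" "regs r ''e'' = 0" using ex k i(2) by auto
      then have sc: "scanning ys nx ?B 0 ?b 0 J (regs r ''c'')" using i(1) by simp
      obtain j where j: "j < length ys" "ys ! j = (x, y)" using xy by (auto simp: in_set_conv_nth)
      then have "j \<in> J" using x by (auto simp: scanning_end(1)[OF sc])
      then have *: "snd (ys ! j) \<noteq> v \<and> (L (snd (ys ! j)) = L h \<longrightarrow>
        (if ord (snd (ys ! j)) < ord h then regs r ''a'' = Suc (snd (ys ! j)) else snd (ys ! j) \<in> ?D))"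
        using i(9)[OF k] by blast
      then show "y \<noteq> v" using j by simp
      show "y \<in> ?D \<or> y = regs r ''a'' - 1 \<and> ord y < ord h" if "L y = L h"
        using * that j by (auto split: if_splits)
    qed
    show ?thesis
    proof (rule runs_conseq[OF runs_local_end[where n = n]])
      fix t :: nat and r' :: state
      assume u: "unchanged local_end r r'" and
        "t \<le> 5 * ?b + 3 \<and> (\<forall>w. arrs r' ''M'' w = 0) \<and> regs r' ''f'' = ?k \<and>
          arrs r' ''L'' = (if ?k = 1 then discard (regs r ''v'') ?D (arrs r ''L'') else arrs r ''L'')"
      then have t: "t \<le> 5 * ?b + 3" and M: "\<forall>w. arrs r' ''M'' w = 0" and f: "regs r' ''f'' = ?k"
        and L': "arrs r' ''L'' = (if ?k = 1 then discard v ?D L else L)" using L by auto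
      have "adj_repr n ys H X T r'"
        using cr adj_repr_unchanged[OF u, of H X T n ys] nam by (auto simp: ctx_def)
      moreover have "regs r' ''n'' = n" "regs r' ''v'' = v"
        using cr unchanged_regs[OF u] by (simp_all add: ctx_def)
      moreover have "discard v ?D L v = v" "\<forall>w<n. discard v ?D L w \<le> n" using cr v by (auto simp: ctx_def discard_def)
      ultimately have ctx': "ctx W n v ys H X T (if ?k = 1 then discard v ?D L else L) r'"
        using cr by (simp add: ctx_def L')
      have k: "?k = 0 \<or> ?k = 1" using i(8) by auto
      have "regs r' ''f'' = 0 \<and> ctx W n v ys H X T L r' \<and> (\<forall>D d. closed_set (set ys) n v L ord h D d \<longrightarrow> bud < volume ys D) \<or>
        regs r' ''f'' = 1 \<and> (\<exists>D d. closed_set (set ys) n v L ord h D d \<and> ctx W n v ys H X T (discard v D L) r')"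
      proof (cases "?k = 1")
        case True
        with f one ctx' show ?thesis
          by (intro disjI2 conjI exI[of _ ?D] exI[of _ "regs r ''a'' - 1"]) simp_all
      next
        case False
        with k have "?k = 0" by simp
        with f ctx' zero[OF this] show ?thesis by (intro disjI1 conjI allI impI) simp_all
      qed
      then show "t \<le> 5 * bud + 13 \<and> local_outcome W n v ys H X T L ord h bud r'"
        using t b M by auto
    qed (use i W v L local_inv_le[OF inv] in \<open>auto split: if_splits\<close>)
  qed
  show ?thesis
    unfolding local_search_def
    by (rule runs_conseq[OF runs_SeqI[OF 1 runs_SeqI[OF 2 3]]]) auto
qed

section \<open>Cutting off dominated sets\<close>

definition "candidates Z H X T =
  Seq (Assign ''h'' (N 0))
  (While (And (Eq (V ''f'') (N 0)) (Less (V ''h'') (V ''n'')))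
    (Seq (If (Eq (A ''L'' (V ''h'')) (V ''v'')) Skip (local_search Z H X T))
      (inc ''h'')))"

lemma mod_candidates [simp]:
  "mod_regs (candidates Z H X T) = {''e'', ''x'', ''y'', ''p'', ''c'', ''k'', ''a'', ''b'', ''i'', ''f'', ''h''}"
  "mod_arrs (candidates Z H X T) = {''B'', ''L'', ''M''}"
  by (auto simp: candidates_def)

definition closed_in where
  "closed_in F n v L ord D \<longleftrightarrow> (\<exists>h d. h < n \<and> L h \<noteq> v \<and> closed_set F n v L ord h D d)"

abbreviation "candidates_outcome W n v ys H X T L ord bud r \<equiv> (\<forall>w. arrs r ''M'' w = 0) \<and>
  (regs r ''f'' = 0 \<and> ctx W n v ys H X T L r \<and>
     (\<forall>D. closed_in (set ys) n v L ord D \<longrightarrow> bud < volume ys D) \<or>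
   regs r ''f'' = 1 \<and> (\<exists>D. closed_in (set ys) n v L ord D \<and> ctx W n v ys H X T (discard v D L) r))"

text \<open>Any vertex can be the first one of a closed set, so each is tried. Per vertex, three
  steps come on top of the local search: the test for discarded vertices, the increment and the loop
  test.\<close>

lemma runs_candidates:
  assumes ctx: "ctx W n v ys H X T L s"
    and s: "arrs s Z = ord" "regs s ''s'' = bud" "bud + 2 < W" "Z \<notin> {''B'', ''M'', ''L''}"
    and f: "regs s ''f'' = 0" and M: "\<forall>w. arrs s ''M'' w = 0"
  shows "runs W (candidates Z H X T) s (\<lambda>t r. t \<le> n * (31 * bud + 64) + 2 \<and> candidates_outcome W n v ys H X T L ord bud r)"
proof -
  let ?ls = "If (Eq (A ''L'' (V ''h'')) (V ''v'')) Skip (local_search Z H X T)"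
  let ?c = "Seq ?ls (inc ''h'')" and ?s = "s\<lparr>regs := (regs s)(''h'' := 0)\<rparr>"
  let ?b = "And (Eq (V ''f'') (N 0)) (Less (V ''h'') (V ''n''))"
  define good where "good h r \<longleftrightarrow> (\<forall>w. arrs r ''M'' w = 0) \<and>
    (regs r ''f'' = 0 \<and> ctx W n v ys H X T L r \<and>
       (\<forall>i<h. L i \<noteq> v \<longrightarrow> (\<forall>D d. closed_set (set ys) n v L ord i D d \<longrightarrow> bud < volume ys D)) \<or>
     regs r ''f'' = 1 \<and> (\<exists>D. closed_in (set ys) n v L ord D \<and> ctx W n v ys H X T (discard v D L) r))"
    for h and r :: state
  let ?I = "\<lambda>t r. t \<le> regs r ''h'' * (31 * bud + 64) \<and> regs r ''h'' \<le> n \<and> good (regs r ''h'') r"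
  have W: "n + 2 < W" using ctx by (auto simp: ctx_def)
  have ctx_upd: "ctx W n v ys H X T L' (r\<lparr>regs := (regs r)(''h'' := k)\<rparr>) = ctx W n v ys H X T L' r" for L' r k
    by (simp add: ctx_def adj_repr_def)
  have n: "regs r ''n'' = n" if "good h r" for h r using that by (auto simp: good_def ctx_def)
  have "runs W (While ?b ?c) ?s (\<lambda>t r. 1 + t \<le> n * (31 * bud + 64) + 2 \<and> good n r)"
  proof (rule runs_While[where I = ?I and U = "n * (31 * bud + 64)"])
    show "?I 0 ?s" using f M ctx by (simp add: good_def ctx_upd)
    show "t \<le> n * (31 * bud + 64)" if "?I t r" for t and r :: state
      using that by (meson le_trans mult_le_mono1)
  next
    fix t and r :: state
    assume I: "?I t r" and u: "unchanged ?c ?s r" and b: "bval ?b r"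
    define h where "h = regs r ''h''"
    have good: "good h r" and t: "t \<le> h * (31 * bud + 64)" using I by (auto simp: h_def)
    have h: "h < n" "regs r ''f'' = 0" using b n[OF good] by (auto simp: h_def)
    have r: "ctx W n v ys H X T L r" "\<And>w. arrs r ''M'' w = 0" using good h(2) by (auto simp: good_def)
    have rZ: "arrs r Z = ord" "regs r ''s'' = bud"
      using s unchanged_arrs[OF u, of Z] unchanged_regs[OF u] by auto
    have rL: "arrs r ''L'' = L" "regs r ''v'' = v" using r(1) by (auto simp: ctx_def)
    have "runs W ?ls r (\<lambda>u r'. u \<le> 31 * bud + 62 \<and> good (Suc h) r' \<and> regs r' ''h'' = h)"
    proof (cases "L h = v")
      case True
      have "good (Suc h) r" using good True h(2) by (auto simp: good_def less_Suc_eq)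
      then show ?thesis using True rL by (simp add: h_def)
    next
      case False
      have "runs W (local_search Z H X T) r (\<lambda>u r'. 1 + u \<le> 31 * bud + 62 \<and> good (Suc h) r' \<and> regs r' ''h'' = h)"
      proof (rule runs_conseq[OF runs_local_search[OF r(1) rZ(1) h_def[symmetric] rZ(2) s(3) _ h(1) False r(2)]])
        fix u :: nat and r' :: state
        assume un: "unchanged (local_search Z H X T) r r'" and
          q: "u \<le> 31 * bud + 61 \<and> local_outcome W n v ys H X T L ord h bud r'"
        have "good (Suc h) r'"
        proof (cases "regs r' ''f'' = 0")
          case True
          with q good h(2) show ?thesis by (auto simp: good_def less_Suc_eq)
        next
          case f1: False
          with q obtain D d where "closed_set (set ys) n v L ord h D d" "ctx W n v ys H X T (discard v D L) r'"
            "regs r' ''f'' = 1" by auto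
          then have "closed_in (set ys) n v L ord D" using h(1) False unfolding closed_in_def by blast
          with q \<open>ctx W n v ys H X T (discard v D L) r'\<close> \<open>regs r' ''f'' = 1\<close> show ?thesis
            unfolding good_def by blast
        qed
        then show "1 + u \<le> 31 * bud + 62 \<and> good (Suc h) r' \<and> regs r' ''h'' = h"
          using q unchanged_regs[OF un, of "''h''"] by (simp add: h_def)
      qed (use s in auto)
      then show ?thesis using False rL by (simp add: h_def)
    qed
    then show "runs W ?c r (\<lambda>u. ?I (t + u + 1))"
      unfolding runs_Seq
      by (rule runs_conseq) (use t h W in \<open>auto simp: good_def ctx_upd\<close>)
  next
    fix t and r :: state
    assume I: "?I t r" and u: "unchanged ?c ?s r" and b: "\<not> bval ?b r"
    define h where "h = regs r ''h''"
    have good: "good h r" and t: "t \<le> h * (31 * bud + 64)" "h \<le> n" using I by (auto simp: h_def)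
    have "good n r"
    proof (cases "regs r ''f'' = 0")
      case True
      then have "h = n" using b n[OF good] t(2) by (auto simp: h_def)
      then show ?thesis using good by simp
    next
      case False
      then show ?thesis using good by (auto simp: good_def)
    qed
    moreover have "t \<le> n * (31 * bud + 64)" using t by (meson le_trans mult_le_mono1)
    ultimately show "1 + (t + 1) \<le> n * (31 * bud + 64) + 2 \<and> good n r" by simp
  qed
  then have "runs W (candidates Z H X T) s (\<lambda>t r. t \<le> n * (31 * bud + 64) + 2 \<and> good n r)"
    using W by (simp add: candidates_def)
  then show ?thesis
    by (rule runs_conseq) (auto simp: good_def closed_in_def)
qed

text \<open>The two directions share the budget, which doubles in every round. Hence a successful
  search is paid for by the edges at the vertices it discards.\<close>

definition "levels H X T G Y S =
  Seq (Assign ''s'' (N 1))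
  (While (And (Eq (V ''f'') (N 0)) (Less (V ''s'') (Plus (V ''m'') (V ''m''))))
    (Seq (candidates ''P'' G Y S)
    (Seq (If (Eq (V ''f'') (N 0)) (candidates ''O'' H X T) Skip)
      (Assign ''s'' (Plus (V ''s'') (V ''s''))))))"

lemma mod_levels [simp]:
  "mod_regs (levels H X T G Y S) =
    {''e'', ''x'', ''y'', ''p'', ''c'', ''k'', ''a'', ''b'', ''i'', ''f'', ''h'', ''s''}"
  "mod_arrs (levels H X T G Y S) = {''B'', ''L'', ''M''}"
  by (auto simp: levels_def)

definition ctx2 where
  "ctx2 W n v xs H X T ys G Y S L s \<longleftrightarrow> ctx W n v xs H X T L s \<and> ctx W n v ys G Y S L s \<and>
     set ys = (set xs)\<inverse> \<and> length ys = length xs \<and> regs s ''m'' = length xs"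

lemma ctx2_transfer:
  assumes "ctx2 W n v xs H X T ys G Y S L s" "unchanged c s s'"
    "mod_arrs c \<subseteq> {''O'', ''Q'', ''L'', ''B'', ''M'', ''P''}" "''m'' \<notin> mod_regs c"
    "ctx W n v xs H X T L' s' \<or> ctx W n v ys G Y S L' s'"
  shows "ctx2 W n v xs H X T ys G Y S L' s'"
proof -
  have "{H, X, T} \<inter> {''O'', ''Q'', ''L'', ''B'', ''M'', ''P''} = {}" "{G, Y, S} \<inter> {''O'', ''Q'', ''L'', ''B'', ''M'', ''P''} = {}"
    using assms(1) unfolding ctx2_def ctx_def by auto
  then have "{H, X, T} \<inter> mod_arrs c = {}" "{G, Y, S} \<inter> mod_arrs c = {}"
    using assms(3) by (meson disjoint_iff subset_iff)+
  then have "adj_repr n xs H X T s'" "adj_repr n ys G Y S s'"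
    using assms(1) adj_repr_unchanged[OF assms(2)] unfolding ctx2_def ctx_def by auto
  moreover have "regs s' ''m'' = regs s ''m''" using unchanged_regs[OF assms(2,4)] .
  ultimately show ?thesis
    using assms(1,5) unfolding ctx2_def ctx_def by auto
qed

lemma closed_in_volume_le: "closed_in (set ys) n v L ord D \<Longrightarrow> volume ys D \<le> length ys"
  unfolding volume_def
  by (rule sum_deg_le) (auto simp: closed_in_def closed_set_def class_of_def intro: finite_subset)

text \<open>Sets dominated from \<open>v\<close> are found along reversed edges \<open>ys\<close> in
  the forward order \<open>ord\<close>; sets dominated in the reversed graph along \<open>xs\<close>
  in the backward order \<open>ord'\<close>. The volume is counted on the side that is
  searched.\<close>

abbreviation "cut_candidate xs ys n v L ord ord' D vol \<equiv>
  closed_in (set ys) n v L ord D \<and> vol = volume ys D \<or>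
  closed_in (set xs) n v L ord' D \<and> vol = volume xs D"

abbreviation "levels_outcome W n v xs H X T ys G Y S L C t r \<equiv> (\<forall>w. arrs r ''M'' w = 0) \<and>
  (regs r ''f'' = 0 \<and> t \<le> 800 * n * length xs + 2 \<and> ctx2 W n v xs H X T ys G Y S L r \<and> (\<forall>D vol. \<not> C D vol) \<or>
   regs r ''f'' = 1 \<and> (\<exists>D vol. C D vol \<and> t \<le> 800 * n * (vol + 1) + 2 \<and>
     ctx2 W n v xs H X T ys G Y S (discard v D L) r))"

text \<open>Round costs form a geometric series dominated by the last budget. On success that budget
  is bounded by the volume found, because the preceding round, with half of it, failed in both
  directions. On failure the budgets have outgrown every volume, none of which exceeds
  \<open>length xs\<close>.\<close>

lemma runs_levels:
  assumes ctx: "ctx2 W n v xs H X T ys G Y S L s" and m: "xs \<noteq> []"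
    and s: "arrs s ''P'' = ord" "arrs s ''O'' = ord'"
    and f: "regs s ''f'' = 0" and M: "\<forall>w. arrs s ''M'' w = 0"
  defines "Cl \<equiv> cut_candidate xs ys n v L ord ord'"
  shows "runs W (levels H X T G Y S) s (\<lambda>t r. levels_outcome W n v xs H X T ys G Y S L Cl t r)"
proof -
  let ?b = "And (Eq (V ''f'') (N 0)) (Less (V ''s'') (Plus (V ''m'') (V ''m'')))"
  let ?c1 = "candidates ''P'' G Y S" and ?c2 = "If (Eq (V ''f'') (N 0)) (candidates ''O'' H X T) Skip"
    and ?c3 = "Assign ''s'' (Plus (V ''s'') (V ''s''))"
  let ?c = "Seq ?c1 (Seq ?c2 ?c3)" and ?s = "s\<lparr>regs := (regs s)(''s'' := 1)\<rparr>"
  let ?ctx = "ctx2 W n v xs H X T ys G Y S"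
  have W: "4 * (n + length xs + 2) \<le> W" and vn: "v < n" using ctx by (auto simp: ctx2_def ctx_def)
  have ctx_s: "?ctx L' (r\<lparr>regs := (regs r)(''s'' := k)\<rparr>) = ?ctx L' r" for L' r k
    by (simp add: ctx2_def ctx_def adj_repr_def)
  define B where "B b r \<longleftrightarrow> (\<forall>w. arrs r ''M'' w = 0) \<and> arrs r ''P'' = ord \<and> arrs r ''O'' = ord' \<and> regs r ''s'' = b" for b and r :: state
  \<comment> \<open>Here \<open>b\<close> is the next budget. Failure at \<open>b div 2\<close>
    means \<open>b + 2 \<le> 2 * vol\<close> for every candidate; before the first round, at
    \<open>b = 1\<close>, nothing is known yet. After a success \<open>b\<close> has been doubled
    once more, whence \<open>4 * vol + 2\<close>.\<close>
  define good where "good b r \<longleftrightarrow> 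
    (regs r ''f'' = 0 \<and> ?ctx L r \<and> (b = 1 \<or> (\<forall>D vol. Cl D vol \<longrightarrow> b + 2 \<le> 2 * vol)) \<or>
     regs r ''f'' = 1 \<and> (\<exists>D vol. Cl D vol \<and> b \<le> 4 * vol + 2 \<and> ?ctx (discard v D L) r))" for b r
  \<comment> \<open>A round with budget \<open>bu\<close> costs at most \<open>200 * n * bu\<close>;
    as the budget doubles, \<open>200 * n\<close> times the next budget covers this round and all
    earlier ones. A round starts below \<open>2 * length xs\<close>, which gives the bound
    \<open>4 * length xs\<close>.\<close>
  let ?I = "\<lambda>t r. t \<le> 200 * n * regs r ''s'' \<and> 1 \<le> regs r ''s'' \<and> regs r ''s'' \<le> 4 * length xs \<and> B (regs r ''s'') r \<and> good (regs r ''s'') r"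
  have m': "regs r ''m'' = length xs" if "good b r" for b r using that by (auto simp: good_def ctx2_def)
  have "runs W (While ?b ?c) ?s (\<lambda>t r. \<exists>b. t \<le> 200 * n * b + 1 \<and> 1 \<le> b \<and> b \<le> 4 * length xs \<and> B b r \<and> good b r \<and>
    (regs r ''f'' = 0 \<longrightarrow> 2 * length xs \<le> b))"
  proof (rule runs_While[where I = ?I and U = "200 * n * (4 * length xs)"])
    have "1 \<le> length xs" using m by (cases xs) auto
    then show "?I 0 ?s" using f M s ctx by (simp add: good_def B_def ctx_s)
    show "t \<le> 200 * n * (4 * length xs)" if "?I t r" for t and r :: state
      using that by (meson le_trans mult_le_mono2)
  next
    fix t and r :: state
    assume I: "?I t r" and u: "unchanged ?c ?s r" and b: "bval ?b r"
    define bu where "bu = regs r ''s''"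
    have bu: "B bu r" "good bu r" "t \<le> 200 * n * bu" "1 \<le> bu" using I by (auto simp: bu_def)
    have b': "regs r ''f'' = 0" "bu < 2 * length xs" using b m'[OF bu(2)] by (auto simp: bu_def)
    have r: "?ctx L r" and cl: "bu = 1 \<or> (\<forall>D vol. Cl D vol \<longrightarrow> bu + 2 \<le> 2 * vol)" using bu(2) b'(1) by (auto simp: good_def)
    have buW: "bu + 2 < W" "bu + bu < W" using W b'(2) by auto
    have small: "2 * bu \<le> 4 * vol + 2" if "Cl D vol" for D vol using cl that by fastforce
    define K where "K = n * (31 * bu + 64) + 2"
    define P1 where "P1 r \<longleftrightarrow> B bu r \<and> (regs r ''f'' = 0 \<and> ?ctx L r \<and> (\<forall>D. closed_in (set ys) n v L ord D \<longrightarrow> bu < volume ys D) \<or>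
      regs r ''f'' = 1 \<and> (\<exists>D vol. Cl D vol \<and> ?ctx (discard v D L) r))" for r
    define P2 where "P2 r \<longleftrightarrow> B bu r \<and> (regs r ''f'' = 0 \<and> ?ctx L r \<and> (\<forall>D vol. Cl D vol \<longrightarrow> bu < vol) \<or>
      regs r ''f'' = 1 \<and> (\<exists>D vol. Cl D vol \<and> ?ctx (discard v D L) r))" for r
    have "runs W ?c1 r (\<lambda>t r. t \<le> K \<and> P1 r)"
    proof (rule runs_conseq[OF runs_candidates[where ord = ord and bud = bu and n = n and v = v and ys = ys and L = L]])
      fix t :: nat and r' :: state
      assume u1: "unchanged ?c1 r r'" and q: "t \<le> n * (31 * bu + 64) + 2 \<and> candidates_outcome W n v ys G Y S L ord bu r'"
      have "B bu r'" using q bu(1) unchanged_arrs[OF u1] unchanged_regs[OF u1] by (simp add: B_def)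
      moreover have "?ctx L' r'" if "ctx W n v ys G Y S L' r'" for L'
        by (rule ctx2_transfer[OF r u1]) (use that in auto)
      ultimately show "t \<le> K \<and> P1 r'" using q unfolding P1_def Cl_def K_def by blast
    qed (use r bu(1) buW b' in \<open>auto simp: ctx2_def B_def\<close>)
    moreover have "runs W ?c2 r1 (\<lambda>t r. t \<le> K + 1 \<and> P2 r)" if r1: "P1 r1" for r1
    proof (cases "regs r1 ''f'' = 0")
      case False
      with r1 have "B bu r1" "regs r1 ''f'' = 1" "\<exists>D vol. Cl D vol \<and> ?ctx (discard v D L) r1"
        unfolding P1_def by simp_all
      then have "P2 r1" unfolding P2_def by simp
      then show ?thesis using False by (simp add: K_def)
    next
      case True
      have c1: "?ctx L r1" "B bu r1" and y1: "\<forall>D. closed_in (set ys) n v L ord D \<longrightarrow> bu < volume ys D"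
        using r1 True unfolding P1_def by auto
      have "runs W (candidates ''O'' H X T) r1 (\<lambda>t r. 1 + t \<le> K + 1 \<and> P2 r)"
      proof (rule runs_conseq[OF runs_candidates[where ord = ord' and bud = bu and n = n and v = v and ys = xs and L = L]])
        fix t :: nat and r' :: state
        assume u1: "unchanged (candidates ''O'' H X T) r1 r'" and q: "t \<le> n * (31 * bu + 64) + 2 \<and> candidates_outcome W n v xs H X T L ord' bu r'"
        have "B bu r'" using q c1(2) unchanged_arrs[OF u1] unchanged_regs[OF u1] by (simp add: B_def)
        moreover have "?ctx L' r'" if "ctx W n v xs H X T L' r'" for L'
          by (rule ctx2_transfer[OF c1(1) u1]) (use that in auto)
        ultimately show "1 + t \<le> K + 1 \<and> P2 r'" using q y1 unfolding P2_def Cl_def K_def by auto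
      qed (use c1 buW True in \<open>auto simp: ctx2_def B_def\<close>)
      then show ?thesis using True by simp
    qed
    moreover have "runs W ?c3 r2 (\<lambda>t r. t \<le> 1 \<and> B (2 * bu) r \<and> good (2 * bu) r)" if r2: "P2 r2" for r2
    proof -
      have "regs r2 ''s'' = bu" using r2 by (simp add: P2_def B_def)
      moreover have "good (2 * bu) r2"
      proof (cases "regs r2 ''f'' = 0")
        case True
        then have "?ctx L r2" "\<And>D vol. Cl D vol \<Longrightarrow> bu < vol" using r2 unfolding P2_def by auto
        with True show ?thesis unfolding good_def by force
      next
        case False
        then obtain D vol where "regs r2 ''f'' = 1" "Cl D vol" "?ctx (discard v D L) r2" using r2 unfolding P2_def by auto
        with small[of D vol] show ?thesis unfolding good_def by blast
      qed
      moreover have "B bu r2" using r2 by (simp add: P2_def)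
      ultimately show ?thesis using buW
        by (simp add: good_def B_def ctx_s mult_2)
    qed
    ultimately have "runs W ?c r (\<lambda>t r. t \<le> K + ((K + 1) + 1) \<and> B (2 * bu) r \<and> good (2 * bu) r)"
      by (intro runs_SeqI)
    moreover have "2 * K + 3 \<le> 200 * n * bu"
    proof -
      have "n \<le> n * bu" "1 \<le> n" using bu(4) vn by auto
      moreover have "K = 31 * (n * bu) + 64 * n + 2" by (simp add: K_def algebra_simps)
      ultimately show ?thesis by linarith
    qed
    ultimately show "runs W ?c r (\<lambda>u. ?I (t + u + 1))"
      by (elim runs_conseq) (use bu b' in \<open>auto simp: B_def\<close>)
  next
    fix t and r :: state
    assume I: "?I t r" and u: "unchanged ?c ?s r" and b: "\<not> bval ?b r"
    then have "regs r ''f'' = 0 \<longrightarrow> 2 * length xs \<le> regs r ''s''" using m' by auto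
    with I show "\<exists>b. t + 1 \<le> 200 * n * b + 1 \<and> 1 \<le> b \<and> b \<le> 4 * length xs \<and> B b r \<and> good b r \<and>
      (regs r ''f'' = 0 \<longrightarrow> 2 * length xs \<le> b)" by (intro exI[of _ "regs r ''s''"]) simp
  qed
  then have "runs W (While ?b ?c) ?s (\<lambda>t r. levels_outcome W n v xs H X T ys G Y S L Cl (1 + t) r)"
  proof (rule runs_conseq)
    fix t :: nat and r :: state
    assume "\<exists>b. t \<le> 200 * n * b + 1 \<and> 1 \<le> b \<and> b \<le> 4 * length xs \<and> B b r \<and> good b r \<and>
      (regs r ''f'' = 0 \<longrightarrow> 2 * length xs \<le> b)"
    then obtain b where "t \<le> 200 * n * b + 1 \<and> 1 \<le> b \<and> b \<le> 4 * length xs \<and> B b r \<and> good b r \<and>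
      (regs r ''f'' = 0 \<longrightarrow> 2 * length xs \<le> b)" ..
    then have b: "t \<le> 200 * n * b + 1" "1 \<le> b" "b \<le> 4 * length xs" "B b r" "good b r"
      "regs r ''f'' = 0 \<Longrightarrow> 2 * length xs \<le> b" by simp_all
    have "regs r ''f'' = 0 \<and> 1 + t \<le> 800 * n * length xs + 2 \<and> ?ctx L r \<and> (\<forall>D vol. \<not> Cl D vol) \<or>
     regs r ''f'' = 1 \<and> (\<exists>D vol. Cl D vol \<and> 1 + t \<le> 800 * n * (vol + 1) + 2 \<and> ?ctx (discard v D L) r)"
    proof (cases "regs r ''f'' = 0")
      case True
      have "1 \<le> length xs" using m by (cases xs) auto
      with b(6)[OF True] have b2: "2 * length xs \<le> b" "b \<noteq> 1" by auto
      with b(5) True have c: "?ctx L r" and cl: "\<And>D vol. Cl D vol \<Longrightarrow> b + 2 \<le> 2 * vol" by (auto simp: good_def)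
      \<comment> \<open>The last completed round had at least budget \<open>length xs\<close>, which
        no volume exceeds.\<close>
      have "\<not> Cl D vol" for D vol
      proof
        assume "Cl D vol"
        moreover from this have "vol \<le> length xs"
          using closed_in_volume_le[of ys n v L ord D] closed_in_volume_le[of xs n v L ord' D] ctx
          by (auto simp: Cl_def ctx2_def)
        ultimately show False using cl[of D vol] b2 by simp
      qed
      moreover have "200 * n * b \<le> 200 * n * (4 * length xs)" using b(3) by (rule mult_le_mono2)
      then have "1 + t \<le> 800 * n * length xs + 2" using b(1) by linarith
      ultimately show ?thesis using True c by simp
    next
      case False
      with b(5) obtain D vol where D: "regs r ''f'' = 1" "Cl D vol" "b \<le> 4 * vol + 2" "?ctx (discard v D L) r"
        by (auto simp: good_def)
      \<comment> \<open>The summand 1 covers a success in the first round, where the volume has no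
        lower bound and may be 0.\<close>
      have "200 * n * b \<le> 200 * n * (4 * (vol + 1))" using D(3) by (intro mult_le_mono2) simp
      then have "1 + t \<le> 800 * n * (vol + 1) + 2" using b(1) by (simp add: algebra_simps)
      with D show ?thesis by blast
    qed
    then show "levels_outcome W n v xs H X T ys G Y S L Cl (1 + t) r"
      using b(4) by (simp add: B_def)
  qed
  then show ?thesis using W by (simp add: levels_def)
qed

section \<open>Search orders for the two directions\<close>

definition search_order :: "nat rel \<Rightarrow> nat \<Rightarrow> nat \<Rightarrow> (nat \<Rightarrow> nat) \<Rightarrow> (nat \<Rightarrow> nat) \<Rightarrow> bool" where
  "search_order E n v L ord \<longleftrightarrow> ord v < n \<and>
     (\<forall>x y. (x, y) \<in> E \<longrightarrow> ord x < n \<longrightarrow> follows v L x y \<longrightarrow> ord y < n) \<and>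
     (\<forall>w<n. ord w < n \<longrightarrow> w \<noteq> v \<longrightarrow> (\<exists>p. (p, w) \<in> E \<and> ord p < ord w \<and> follows v L p w))"

text \<open>Truncation changes order numbers only at unreached vertices, where nothing but being at
  least \<open>n\<close> matters.\<close>

lemma search_order_min:
  assumes "E \<subseteq> {..<n} \<times> {..<n}" "v < n" "\<And>w. w < n \<Longrightarrow> ord' w = min n (ord w)" "search_order E n v L ord"
  shows "search_order E n v L ord'"
  unfolding search_order_def
proof (intro conjI allI impI)
  show "ord' v < n" using assms by (simp add: search_order_def)
  show "ord' y < n" if "(x, y) \<in> E" "ord' x < n" "follows v L x y" for x y
  proof -
    have xy: "x < n" "y < n" using that(1) assms(1) by auto
    then have "ord x < n" using assms(3) that(2) by simp
    then have "ord y < n" using assms(4) that(1,3) unfolding search_order_def by blast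
    then show ?thesis using assms(3) xy by simp
  qed
  show "\<exists>p. (p, w) \<in> E \<and> ord' p < ord' w \<and> follows v L p w" if w: "w < n" "ord' w < n" "w \<noteq> v" for w
  proof -
    have "ord w < n" using w assms(3) by simp
    with assms(4) w obtain p where p: "(p, w) \<in> E" "ord p < ord w" "follows v L p w"
      unfolding search_order_def by blast
    moreover have "p < n" using p(1) assms(1) by auto
    ultimately show ?thesis using assms(3) w \<open>ord w < n\<close> by (intro exI[of _ p]) simp
  qed
qed

definition "order_search H X T = Seq start_search (Seq (Assign ''p'' (N 0)) (search H X T))"

lemma mod_order_search [simp]:
  "mod_regs (order_search H X T) = {''e'', ''x'', ''y'', ''p'', ''q'', ''i''}"
  "mod_arrs (order_search H X T) = {''O'', ''Q''}"
  by (auto simp: order_search_def)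

lemma runs_order_search:
  assumes ctx: "ctx W n v xs H X T L s"
  shows "runs W (order_search H X T) s (\<lambda>t r. t \<le> 11 * (n + length xs) + 8 \<and> search_order (set xs) n v L (arrs r ''O''))"
proof -
  have W: "0 < W" and v: "v < n" using ctx by (auto simp: ctx_def)
  have "runs W (Seq (Assign ''p'' (N 0)) (search H X T)) r
    (\<lambda>t r. t \<le> 8 * (n + length xs) + 3 \<and> search_order (set xs) n v L (arrs r ''O''))"
    if r: "ctx W n v xs H X T L r" "regs r ''q'' = 1" "arrs r ''Q'' 0 = v" "arrs r ''O'' v = 0"
      "\<forall>w<n. w \<noteq> v \<longrightarrow> arrs r ''O'' w = n + w" for r
  proof -
    let ?r = "r\<lparr>regs := (regs r)(''p'' := 0)\<rparr>"
    have c: "ctx W n v xs H X T L ?r"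
      by (rule ctx_unchanged[where c = "Assign ''p'' (N 0)", OF _ r(1)]) (auto simp: unchanged_def)
    have ok: "queue_ok n (arrs ?r ''O'') (arrs ?r ''Q'') 1"
      unfolding queue_ok_def
    proof (intro conjI allI impI)
      fix w assume w: "w < n" "arrs ?r ''O'' w < n"
      then have "w = v" using r(5) by force
      then show "arrs ?r ''O'' w < 1" "arrs ?r ''Q'' (arrs ?r ''O'' w) = w" using r(3,4) by simp_all
    qed (use r v in auto)
    have "runs W (search H X T) ?r (\<lambda>t r. 1 + t \<le> 8 * (n + length xs) + 3 \<and> search_order (set xs) n v L (arrs r ''O''))"
    proof (rule runs_search[OF c ok])
      show "regs ?r ''q'' = 1" "regs ?r ''p'' = 0" "(0::nat) \<le> 1" using r(2) by simp_all
      fix t :: nat and r' :: state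
      let ?O = "arrs r' ''O''" and ?Q = "arrs r' ''Q''" and ?q = "regs r' ''q''"
      assume ok': "queue_ok n ?O ?Q ?q" and old: "\<And>i. i < 1 \<Longrightarrow> ?Q i = arrs ?r ''Q'' i" and q: "1 \<le> ?q"
        and cl: "\<And>a b. (a, b) \<in> set xs \<Longrightarrow> follows v L a b \<Longrightarrow> ?O a < n \<Longrightarrow> 0 \<le> ?O a \<Longrightarrow> ?O b < n"
        and par: "\<And>w. w < n \<Longrightarrow> ?O w < n \<Longrightarrow> 1 \<le> ?O w \<Longrightarrow>
          \<exists>a. (a, w) \<in> set xs \<and> follows v L a w \<and> ?O a < ?O w \<and> 0 \<le> ?O a"
        and t: "t \<le> 8 * (n + length xs) + 2"
      have Q0: "?Q 0 = v" using old[of 0] r(3) by simp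
      then have v0: "?O v = 0" using ok' q unfolding queue_ok_def by fastforce
      have "search_order (set xs) n v L ?O"
        unfolding search_order_def
      proof (intro conjI allI impI)
        show "?O v < n" using v0 v by simp
        show "?O y < n" if "(x, y) \<in> set xs" "?O x < n" "follows v L x y" for x y
          using cl[OF that(1,3,2)] by simp
        show "\<exists>p. (p, w) \<in> set xs \<and> ?O p < ?O w \<and> follows v L p w" if w: "w < n" "?O w < n" "w \<noteq> v" for w
        proof -
          have "?Q (?O w) = w" using ok' w by (simp add: queue_ok_def)
          then have "?O w \<noteq> 0" using Q0 w(3) by metis
          then have "1 \<le> ?O w" by simp
          from par[OF w(1,2) this] show ?thesis by blast
        qed
      qed
      then show "1 + t \<le> 8 * (n + length xs) + 3 \<and> search_order (set xs) n v L ?O" using t by simp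
    qed
    then show ?thesis using W by simp
  qed
  note 2 = this
  have "runs W (order_search H X T) s
    (\<lambda>t r. t \<le> (3 * n + 5) + (8 * (n + length xs) + 3) \<and> search_order (set xs) n v L (arrs r ''O''))"
    unfolding order_search_def
    by (rule runs_SeqI[OF runs_start_search[OF ctx]]) (elim conjE, rule 2)
  then show ?thesis by (rule runs_conseq) auto
qed

text \<open>The backward search overwrites \<open>O\<close>, so the forward order is saved in
  \<open>P\<close>. Cutting values off at \<open>n\<close> keeps the stores within the word bound
  whatever \<open>O\<close> holds at unreached vertices.\<close>

definition "copy_order = For ''i'' (V ''n'')
  (If (Less (A ''O'' (V ''i'')) (V ''n''))
    (Store ''P'' (V ''i'') (A ''O'' (V ''i'')))
    (Store ''P'' (V ''i'') (V ''n'')))"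

lemma mod_copy_order [simp]: "mod_regs copy_order = {''i''}" "mod_arrs copy_order = {''P''}"
  by (auto simp: copy_order_def)

lemma runs_copy_order:
  assumes "regs s ''n'' = n" "n < W"
  shows "runs W copy_order s (\<lambda>t r. t \<le> 4 * n + 2 \<and> (\<forall>w<n. arrs r ''P'' w = min n (arrs s ''O'' w)))"
  unfolding copy_order_def
proof (rule runs_For[where n = n and B = "\<lambda>_. 2" and I = "\<lambda>k r. \<forall>w<k. arrs r ''P'' w = min n (arrs s ''O'' w)"])
  let ?c = "If (Less (A ''O'' (V ''i'')) (V ''n'')) (Store ''P'' (V ''i'') (A ''O'' (V ''i'')))
    (Store ''P'' (V ''i'') (V ''n''))"
  show "n < W" "0 < W" using assms by auto
  fix r
  assume u: "unchanged (For ''i'' (V ''n'') ?c) s r"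
  have r: "regs r ''n'' = n" "arrs r ''O'' = arrs s ''O''"
    using assms(1) by (simp_all add: unchanged_regs[OF u] unchanged_arrs[OF u])
  then show "aval (V ''n'') r = n" by simp
  show "runs W ?c r (\<lambda>u r'. u \<le> 2 \<and> regs r' ''i'' = k \<and>
     (\<forall>w<Suc k. arrs (r'\<lparr>regs := (regs r')(''i'' := Suc k)\<rparr>) ''P'' w = min n (arrs s ''O'' w)))"
    if "k < n" "\<forall>w<k. arrs r ''P'' w = min n (arrs s ''O'' w)" "regs r ''i'' = k" for k
    using that r assms by (auto simp: less_Suc_eq)
qed auto

section \<open>The cutting step and its amortised cost\<close>

definition "cut_off H X T G Y S =
  Seq (order_search H X T) (Seq copy_order (Seq (order_search G Y S) (levels H X T G Y S)))"

lemma mod_cut_off [simp]: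
  "mod_regs (cut_off H X T G Y S) =
    {''e'', ''x'', ''y'', ''p'', ''q'', ''c'', ''k'', ''a'', ''b'', ''i'', ''f'', ''h'', ''s''}"
  "mod_arrs (cut_off H X T G Y S) = {''O'', ''Q'', ''P'', ''B'', ''L'', ''M''}"
  by (auto simp: cut_off_def)

text \<open>Both directions are counted, because the volume that pays for a cut is measured in the
  direction in which the set was found.\<close>

definition total_volume :: "(nat \<times> nat) list \<Rightarrow> (nat \<times> nat) list \<Rightarrow> nat \<Rightarrow> nat \<Rightarrow> (nat \<Rightarrow> nat) \<Rightarrow> nat" where
  "total_volume xs ys n v L = volume xs (alive n v L) + volume ys (alive n v L)"

lemma discard_decreases:
  assumes D: "closed_in F n v L ord D"
  shows "potential n v (discard v D L) < potential n v L"
    and "volume xs (alive n v (discard v D L)) + volume xs D = volume xs (alive n v L)"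
proof -
  from D obtain h d where hd: "h < n" "L h \<noteq> v" "closed_set F n v L ord h D d" unfolding closed_in_def by blast
  then have sub: "D \<subseteq> alive n v L" and h: "h \<in> D" by (auto simp: closed_set_def class_of_def alive_def)
  have a: "alive n v (discard v D L) = alive n v L - D" by (auto simp: alive_def discard_def)
  have "card (alive n v L - D) < card (alive n v L)"
    using sub h by (intro psubset_card_mono) auto
  moreover have "card {w \<in> alive n v L - D. discard v D L w \<noteq> w} \<le> card {w \<in> alive n v L. L w \<noteq> w}"
    by (intro card_mono) (auto simp: discard_def)
  ultimately show "potential n v (discard v D L) < potential n v L"
    unfolding potential_def a by simp
  show "volume xs (alive n v (discard v D L)) + volume xs D = volume xs (alive n v L)"
    unfolding a volume_def using sum.subset_diff[OF sub finite_alive] by metis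
qed

lemma closed_in_admissible:
  assumes "admissible E n v L" "closed_in (E\<inverse>) n v L ord D"
  shows "admissible E n v (discard v D L)"
  using assms admissible_cut unfolding closed_in_def discard_def by blast

abbreviation "cut_outcome W n v xs H X T ys G Y S L t r \<equiv> (\<forall>w. arrs r ''M'' w = 0) \<and>
  (\<exists>L'. ctx2 W n v xs H X T ys G Y S L' r \<and>
    (regs r ''f'' = 0 \<and> L' = L \<and> cut_stable (set xs) n v L \<and> cut_stable (set ys) n v L \<and>
       t \<le> 30 * (n + length xs + 1) + 800 * (n * length xs) \<or>
     regs r ''f'' = 1 \<and> admissible (set xs) n v L' \<and> potential n v L' < potential n v L \<and>
       t + 800 * (n * total_volume xs ys n v L') \<le>
         830 * (n + length xs + 1) + 800 * (n * total_volume xs ys n v L)))"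

text \<open>On success the term \<open>800 * n * vol\<close> of the local searches is balanced by
  the drop of \<open>total_volume\<close>. What remains is linear: \<open>30\<close> units for the
  two order searches and the copy, and \<open>800\<close> for the summand 1 in
  \<open>vol + 1\<close>.\<close>

lemma runs_cut_off:
  assumes ctx: "ctx2 W n v xs H X T ys G Y S L s" and adm: "admissible (set xs) n v L" and xs: "xs \<noteq> []"
    and f: "regs s ''f'' = 0" and M: "\<forall>w. arrs s ''M'' w = 0"
  shows "runs W (cut_off H X T G Y S) s (\<lambda>t r. cut_outcome W n v xs H X T ys G Y S L t r)"
proof -
  let ?ctx = "ctx2 W n v xs H X T ys G Y S"
  have sys: "set ys = (set xs)\<inverse>" "length ys = length xs" and v: "v < n" "L v = v"
    and W: "4 * (n + length xs + 2) \<le> W"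
    and E: "set xs \<subseteq> {..<n} \<times> {..<n}" "set ys \<subseteq> {..<n} \<times> {..<n}"
    using ctx by (auto simp: ctx2_def ctx_def)
  define R where "R r \<longleftrightarrow> ?ctx L r \<and> regs r ''f'' = 0 \<and> (\<forall>w. arrs r ''M'' w = 0)" for r
  have R_un: "R r'" if "R r" "unchanged c r r'" "mod_arrs c \<subseteq> {''O'', ''Q'', ''P''}" "{''f'', ''m'', ''n'', ''v''} \<inter> mod_regs c = {}" for c r r'
  proof -
    have c: "ctx W n v xs H X T L r'"
      by (rule ctx_unchanged[OF that(2)]) (use that in \<open>auto simp: R_def ctx2_def\<close>)
    have "?ctx L r'"
      by (rule ctx2_transfer[OF _ that(2)]) (use that c in \<open>auto simp: R_def\<close>)
    moreover have "''M'' \<notin> mod_arrs c" by (rule contra_subsetD[OF that(3)]) simp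
    ultimately show ?thesis using that unchanged_regs[OF that(2)] unchanged_arrs[OF that(2)] by (simp add: R_def)
  qed
  have Rs: "R s" using ctx f M by (simp add: R_def)
  have Rctx: "ctx W n v xs H X T L r" "ctx W n v ys G Y S L r" if "R r" for r
    using that by (auto simp: R_def ctx2_def)
  define P1 where "P1 r \<longleftrightarrow> R r \<and> search_order (set xs) n v L (arrs r ''O'')" for r
  define P2 where "P2 r \<longleftrightarrow> R r \<and> search_order (set xs) n v L (arrs r ''P'')" for r
  define P3 where "P3 r \<longleftrightarrow> P2 r \<and> search_order (set ys) n v L (arrs r ''O'')" for r
  let ?T1 = "11 * (n + length xs) + 8"
  let ?Q = "\<lambda>t r. cut_outcome W n v xs H X T ys G Y S L t r"
  have 1: "runs W (order_search H X T) s (\<lambda>t r. t \<le> ?T1 \<and> P1 r)"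
    by (rule runs_conseq[OF runs_order_search[OF Rctx(1)[OF Rs]]]) (use R_un[OF Rs] in \<open>simp add: P1_def\<close>)
  have 2: "runs W copy_order r (\<lambda>t r. t \<le> 4 * n + 2 \<and> P2 r)" if r: "P1 r" for r
  proof (rule runs_conseq[OF runs_copy_order[of r n]])
    have Rr: "R r" "search_order (set xs) n v L (arrs r ''O'')" using r by (auto simp: P1_def)
    show "regs r ''n'' = n" "n < W" using Rctx(1)[OF Rr(1)] by (auto simp: ctx_def)
    fix t :: nat and r' :: state
    assume q: "t \<le> 4 * n + 2 \<and> (\<forall>w<n. arrs r' ''P'' w = min n (arrs r ''O'' w))" and u: "unchanged copy_order r r'"
    have "search_order (set xs) n v L (arrs r' ''P'')"
      by (rule search_order_min[OF E(1) v(1) _ Rr(2)]) (use q in simp)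
    then show "t \<le> 4 * n + 2 \<and> P2 r'" using q R_un[OF Rr(1) u] by (simp add: P2_def)
  qed
  have 3: "runs W (order_search G Y S) r (\<lambda>t r. t \<le> ?T1 \<and> P3 r)" if r: "P2 r" for r
  proof (rule runs_conseq[OF runs_order_search[of W n v ys G Y S L r]])
    have Rr: "R r" "search_order (set xs) n v L (arrs r ''P'')" using r by (auto simp: P2_def)
    show "ctx W n v ys G Y S L r" using Rctx(2)[OF Rr(1)] .
    fix t :: nat and r' :: state
    assume q: "t \<le> 11 * (n + length ys) + 8 \<and> search_order (set ys) n v L (arrs r' ''O'')"
      and u: "unchanged (order_search G Y S) r r'"
    have "arrs r' ''P'' = arrs r ''P''" using unchanged_arrs[OF u] by simp
    then show "t \<le> ?T1 \<and> P3 r'" using q Rr R_un[OF Rr(1) u] sys by (simp add: P2_def P3_def)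
  qed
  let ?T = "?T1 + ((4 * n + 2) + (?T1 + 0))"
  \<comment> \<open>The claim couples time and outcome, so the time of the preceding components
    enters as the delay \<open>u\<close>.\<close>
  have 4: "runs W (levels H X T G Y S) r (\<lambda>t r. \<forall>u. u \<le> ?T \<longrightarrow> ?Q (u + t) r)" if r: "P3 r" for r
  proof (rule runs_conseq[OF runs_levels[where ord = "arrs r ''P''" and ord' = "arrs r ''O''"]])
    have Rr: "R r" and so: "search_order (set xs) n v L (arrs r ''P'')" "search_order (set ys) n v L (arrs r ''O'')"
      using r by (auto simp: P2_def P3_def)
    show "ctx2 W n v xs H X T ys G Y S L r" "regs r ''f'' = 0" "\<forall>w. arrs r ''M'' w = 0" using Rr by (auto simp: R_def)
    show "xs \<noteq> []" by (rule xs)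
    fix t :: nat and r' :: state
    define Cl where "Cl D vol \<longleftrightarrow> cut_candidate xs ys n v L (arrs r ''P'') (arrs r ''O'') D vol" for D vol
    assume "levels_outcome W n v xs H X T ys G Y S L (cut_candidate xs ys n v L (arrs r ''P'') (arrs r ''O'')) t r'"
    then have M': "\<forall>w. arrs r' ''M'' w = 0" and
      cases: "regs r' ''f'' = 0 \<and> t \<le> 800 * n * length xs + 2 \<and> ?ctx L r' \<and> (\<forall>D vol. \<not> Cl D vol) \<or>
       regs r' ''f'' = 1 \<and> (\<exists>D vol. Cl D vol \<and> t \<le> 800 * n * (vol + 1) + 2 \<and> ?ctx (discard v D L) r')"
      unfolding Cl_def by blast+
    show "\<forall>u. u \<le> ?T \<longrightarrow> ?Q (u + t) r'"
    proof (intro allI impI)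
      fix u assume u: "u \<le> ?T"
      from cases show "?Q (u + t) r'"
      proof (elim disjE conjE exE)
        assume f0: "regs r' ''f'' = 0" and t: "t \<le> 800 * n * length xs + 2" and c: "?ctx L r'"
          and none: "\<forall>D vol. \<not> Cl D vol"
        have "cut_stable (set xs) n v L"
        proof (rule cut_stable_if_no_closed_set[where ord = "arrs r ''P''"])
          show "\<not> closed_set ((set xs)\<inverse>) n v L (arrs r ''P'') h D a" if "h < n" "L h \<noteq> v" for h D a
            using none that unfolding Cl_def closed_in_def sys(1) by blast
        qed (use so(1) v E in \<open>auto simp: search_order_def\<close>)
        moreover have "cut_stable (set ys) n v L"
        proof (rule cut_stable_if_no_closed_set[where ord = "arrs r ''O''"])
          show "\<not> closed_set ((set ys)\<inverse>) n v L (arrs r ''O'') h D a" if "h < n" "L h \<noteq> v" for h D a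
            using none that unfolding Cl_def closed_in_def sys(1) converse_converse by blast
        qed (use so(2) v E in \<open>auto simp: search_order_def\<close>)
        moreover have "u + t \<le> 30 * (n + length xs + 1) + 800 * (n * length xs)"
          using u t by (simp add: algebra_simps)
        ultimately show ?thesis using f0 c M' by blast
      next
        fix D vol
        assume f1: "regs r' ''f'' = 1" and Cl: "Cl D vol" and t: "t \<le> 800 * n * (vol + 1) + 2"
          and c: "?ctx (discard v D L) r'"
        from Cl have "potential n v (discard v D L) < potential n v L"
          unfolding Cl_def by (auto dest: discard_decreases(1))
        moreover have "admissible (set xs) n v (discard v D L)"
          using Cl unfolding Cl_def
        proof (elim disjE conjE)
          assume "closed_in (set ys) n v L (arrs r ''P'') D"
          with closed_in_admissible[OF adm] sys show ?thesis by simp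
        next
          assume "closed_in (set xs) n v L (arrs r ''O'') D"
          with closed_in_admissible[of "(set xs)\<inverse>" n v L] adm show ?thesis by simp
        qed
        moreover have "vol + total_volume xs ys n v (discard v D L) \<le> total_volume xs ys n v L"
        proof -
          have "volume xs (alive n v (discard v D L)) + volume xs D = volume xs (alive n v L)"
            "volume ys (alive n v (discard v D L)) + volume ys D = volume ys (alive n v L)"
            using Cl discard_decreases(2) unfolding Cl_def by metis+
          then show ?thesis using Cl unfolding Cl_def total_volume_def by auto
        qed
        then have "n * (vol + total_volume xs ys n v (discard v D L)) \<le> n * total_volume xs ys n v L"
          by (rule mult_le_mono2)
        then have "u + t + 800 * (n * total_volume xs ys n v (discard v D L)) \<le>
            830 * (n + length xs + 1) + 800 * (n * total_volume xs ys n v L)"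
          using u t by (simp add: algebra_simps)
        ultimately show ?thesis using f1 c M' by blast
      qed
    qed
  qed simp_all
  have "runs W (cut_off H X T G Y S) s (\<lambda>t r. \<forall>u. u \<le> 0 \<longrightarrow> ?Q (u + t) r)"
    unfolding cut_off_def by (rule runs_SeqI_delay[OF 1 runs_SeqI_delay[OF 2 runs_SeqI_delay[OF 3 4]]])
  then show ?thesis by (rule runs_conseq) simp
qed

section \<open>Refining the labelling\<close>

text \<open>Each test runs only if the earlier ones changed nothing; a final \<open>f = 0\<close>
  therefore certifies all four stability conditions for one and the same labelling.\<close>

definition "refine H X T G Y S =
  Seq (Assign ''f'' (N 0))
  (Seq (split_classes H X T)
  (Seq (If (Eq (V ''f'') (N 0)) (split_classes G Y S) Skip)
    (If (Eq (V ''f'') (N 0)) (cut_off H X T G Y S) Skip)))"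

lemma mod_refine [simp]:
  "mod_regs (refine H X T G Y S) =
    {''e'', ''x'', ''y'', ''p'', ''q'', ''c'', ''k'', ''a'', ''b'', ''i'', ''f'', ''h'', ''s''}"
  "mod_arrs (refine H X T G Y S) = {''O'', ''Q'', ''P'', ''B'', ''L'', ''M''}"
  by (auto simp: refine_def)

definition stable :: "nat rel \<Rightarrow> nat \<Rightarrow> nat \<Rightarrow> (nat \<Rightarrow> nat) \<Rightarrow> bool" where
  "stable E n v L \<longleftrightarrow> split_stable E n v L \<and> split_stable (E\<inverse>) n v L \<and> cut_stable E n v L \<and> cut_stable (E\<inverse>) n v L"

lemma ctx2_set_f [simp]:
  "ctx2 W n v xs H X T ys G Y S L (s\<lparr>regs := (regs s)(''f'' := k)\<rparr>) = ctx2 W n v xs H X T ys G Y S L s"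
  by (simp add: ctx2_def ctx_def adj_repr_def)

abbreviation "refine_outcome W n v xs H X T ys G Y S L t r \<equiv> (\<forall>w. arrs r ''M'' w = 0) \<and>
  (\<exists>L'. ctx2 W n v xs H X T ys G Y S L' r \<and>
    (regs r ''f'' = 0 \<and> L' = L \<and> stable (set xs) n v L \<and>
       t \<le> 900 * (n + length xs + 1) + 800 * (n * length xs) \<or>
     regs r ''f'' = 1 \<and> admissible (set xs) n v L' \<and> potential n v L' < potential n v L \<and>
       t + 800 * (n * total_volume xs ys n v L') \<le>
         900 * (n + length xs + 1) + 800 * (n * total_volume xs ys n v L)))"

lemma runs_refine:
  assumes ctx: "ctx2 W n v xs H X T ys G Y S L s" and adm: "admissible (set xs) n v L" and xs: "xs \<noteq> []"
    and M: "\<forall>w. arrs s ''M'' w = 0"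
  shows "runs W (refine H X T G Y S) s (\<lambda>t r. refine_outcome W n v xs H X T ys G Y S L t r)"
proof -
  let ?ctx = "ctx2 W n v xs H X T ys G Y S" and ?N = "n + length xs + 1"
  have sys: "set ys = (set xs)\<inverse>" "length ys = length xs" and W: "4 * (n + length xs + 2) \<le> W"
    using ctx by (auto simp: ctx2_def ctx_def)
  define progress where "progress r \<longleftrightarrow> regs r ''f'' = 1 \<and> (\<exists>L'. ?ctx L' r \<and> admissible (set xs) n v L' \<and>
    alive n v L' = alive n v L \<and> potential n v L' < potential n v L)" for r
  define P0 where "P0 r \<longleftrightarrow> (\<forall>w. arrs r ''M'' w = 0) \<and> regs r ''f'' = 0 \<and> ?ctx L r" for r
  define P1 where "P1 r \<longleftrightarrow> (\<forall>w. arrs r ''M'' w = 0) \<and>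
    (regs r ''f'' = 0 \<and> ?ctx L r \<and> split_stable (set xs) n v L \<or> progress r)" for r
  define P2 where "P2 r \<longleftrightarrow> (\<forall>w. arrs r ''M'' w = 0) \<and>
    (regs r ''f'' = 0 \<and> ?ctx L r \<and> split_stable (set xs) n v L \<and> split_stable (set ys) n v L \<or> progress r)" for r
  let ?Q = "\<lambda>t r. refine_outcome W n v xs H X T ys G Y S L t r"
  have 0: "runs W (Assign ''f'' (N 0)) s (\<lambda>t r. t \<le> 1 \<and> P0 r)"
  proof -
    have "?ctx L (s\<lparr>regs := (regs s)(''f'' := 0)\<rparr>)"
      using ctx by simp
    then show ?thesis using M W by (simp add: P0_def)
  qed
  have 1: "runs W (split_classes H X T) r (\<lambda>t r. t \<le> 30 * ?N \<and> P1 r)" if r: "P0 r" for r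
  proof (rule runs_conseq[OF runs_split_classes[OF _ adm]])
    show "ctx W n v xs H X T L r" "regs r ''f'' = 0" using r by (auto simp: P0_def ctx2_def)
    fix t :: nat and r' :: state
    assume u: "unchanged (split_classes H X T) r r'" and q: "t \<le> 30 * ?N \<and> split_outcome W n v xs H X T L r'"
    have "?ctx L' r'" if "ctx W n v xs H X T L' r'" for L'
      by (rule ctx2_transfer[OF _ u]) (use that r in \<open>auto simp: P0_def\<close>)
    moreover have "arrs r' ''M'' = arrs r ''M''" using unchanged_arrs[OF u] by simp
    ultimately show "t \<le> 30 * ?N \<and> P1 r'" using q r unfolding P1_def progress_def P0_def by metis
  qed
  have 2: "runs W (If (Eq (V ''f'') (N 0)) (split_classes G Y S) Skip) r (\<lambda>t r. t \<le> 30 * ?N + 1 \<and> P2 r)" if r: "P1 r" for r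
  proof (cases "regs r ''f'' = 0")
    case False
    then have "P2 r" using r unfolding P1_def P2_def by simp
    then show ?thesis using False by simp
  next
    case True
    have c: "?ctx L r" "split_stable (set xs) n v L" "\<forall>w. arrs r ''M'' w = 0"
      using r True by (auto simp: P1_def progress_def)
    have "runs W (split_classes G Y S) r (\<lambda>t r. 1 + t \<le> 30 * ?N + 1 \<and> P2 r)"
    proof (rule runs_conseq[OF runs_split_classes])
      show "ctx W n v ys G Y S L r" "admissible (set ys) n v L" "regs r ''f'' = 0"
        using c True adm sys by (auto simp: ctx2_def)
      fix t :: nat and r' :: state
      assume u: "unchanged (split_classes G Y S) r r'" and q: "t \<le> 30 * (n + length ys + 1) \<and> split_outcome W n v ys G Y S L r'"
      have "?ctx L' r'" if "ctx W n v ys G Y S L' r'" for L'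
        by (rule ctx2_transfer[OF c(1) u]) (use that in auto)
      moreover have "arrs r' ''M'' = arrs r ''M''" using unchanged_arrs[OF u] by simp
      moreover have "admissible (set ys) n v L' = admissible (set xs) n v L'" for L' using sys by simp
      ultimately show "1 + t \<le> 30 * ?N + 1 \<and> P2 r'" using q c(2,3) sys(2) unfolding P2_def progress_def by auto
    qed
    then show ?thesis using True by simp
  qed
  let ?T = "30 * ?N + 1 + (30 * ?N + (1 + 0))"
  have 3: "runs W (If (Eq (V ''f'') (N 0)) (cut_off H X T G Y S) Skip) r (\<lambda>t r. \<forall>u. u \<le> ?T \<longrightarrow> ?Q (u + t) r)" if r: "P2 r" for r
  proof (cases "regs r ''f'' = 0")
    case False
    with r obtain L' where L': "?ctx L' r" "admissible (set xs) n v L'" "alive n v L' = alive n v L"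
      "potential n v L' < potential n v L" and f: "regs r ''f'' = 1" and M': "\<forall>w. arrs r ''M'' w = 0"
      unfolding P2_def progress_def by auto
    have "?Q (u + 2) r" if u: "u \<le> ?T" for u
    proof (intro conjI exI[of _ L'] disjI2)
      show "u + 2 + 800 * (n * total_volume xs ys n v L') \<le> 900 * ?N + 800 * (n * total_volume xs ys n v L)"
        using u by (simp add: total_volume_def L'(3))
    qed (use L' f M' in simp_all)
    with False show ?thesis by simp
  next
    case True
    have c: "?ctx L r" "split_stable (set xs) n v L" "split_stable (set ys) n v L" "\<forall>w. arrs r ''M'' w = 0"
      using r True by (auto simp: P2_def progress_def)
    have "runs W (cut_off H X T G Y S) r (\<lambda>t r. \<forall>u. u \<le> ?T \<longrightarrow> ?Q (u + (1 + t)) r)"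
    proof (rule runs_conseq[OF runs_cut_off[OF c(1) adm xs True c(4)]], intro allI impI)
      fix t u :: nat and r' :: state
      assume u: "u \<le> ?T" and "cut_outcome W n v xs H X T ys G Y S L t r'"
      then obtain L' where M': "\<forall>w. arrs r' ''M'' w = 0" and L': "?ctx L' r'" and
        cases: "regs r' ''f'' = 0 \<and> L' = L \<and> cut_stable (set xs) n v L \<and> cut_stable (set ys) n v L \<and>
           t \<le> 30 * ?N + 800 * (n * length xs) \<or>
         regs r' ''f'' = 1 \<and> admissible (set xs) n v L' \<and> potential n v L' < potential n v L \<and>
           t + 800 * (n * total_volume xs ys n v L') \<le> 830 * ?N + 800 * (n * total_volume xs ys n v L)"
        by blast
      \<comment> \<open>Two splitting searches at \<open>30\<close> each and the cutting step at
        \<open>830\<close> leave slack in \<open>900\<close> for the constant overhead, as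
        \<open>?N\<close> is positive.\<close>
      have T: "?T + 1 + 830 * ?N \<le> 900 * ?N" by simp
      from cases show "?Q (u + (1 + t)) r'"
      proof
        assume *: "regs r' ''f'' = 0 \<and> L' = L \<and> cut_stable (set xs) n v L \<and> cut_stable (set ys) n v L \<and>
           t \<le> 30 * ?N + 800 * (n * length xs)"
        then have "stable (set xs) n v L" using c(2,3) sys by (simp add: stable_def)
        moreover have "u + (1 + t) \<le> 900 * ?N + 800 * (n * length xs)" using * u T by linarith
        ultimately show ?thesis using * M' L' by blast
      next
        assume *: "regs r' ''f'' = 1 \<and> admissible (set xs) n v L' \<and> potential n v L' < potential n v L \<and>
           t + 800 * (n * total_volume xs ys n v L') \<le> 830 * ?N + 800 * (n * total_volume xs ys n v L)"
        then have "u + (1 + t) + 800 * (n * total_volume xs ys n v L') \<le> 900 * ?N + 800 * (n * total_volume xs ys n v L)"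
          using u T by linarith
        then show ?thesis using * M' L' by blast
      qed
    qed
    then show ?thesis using True by simp
  qed
  have "runs W (refine H X T G Y S) s (\<lambda>t r. \<forall>u. u \<le> 0 \<longrightarrow> ?Q (u + t) r)"
    unfolding refine_def by (rule runs_SeqI_delay[OF 0 runs_SeqI_delay[OF 1 runs_SeqI_delay[OF 2 3]]])
  then show ?thesis by (rule runs_conseq) simp
qed

definition "refine_all H X T G Y S =
  Seq (Assign ''f'' (N 1)) (While (Eq (V ''f'') (N 1)) (refine H X T G Y S))"

text \<open>The round that changes nothing lowers no measure; one extra unit of potential and the
  term \<open>800 * b\<close> pay for it. The products are kept as atoms for linear
  arithmetic.\<close>

lemma time_exit:
  fixes N :: nat
  assumes "t + 999 * (N * p') + 800 * a' \<le> 999 * (N * p) + 800 * a" "u \<le> 900 * N + 800 * b" "1 \<le> N"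
  shows "t + u + 1 \<le> 999 * (N * (p + 1)) + 800 * a + 800 * b"
proof -
  have "N * (p + 1) = N * p + N" by simp
  then show ?thesis using assms by linarith
qed

text \<open>A drop of the potential releases \<open>999 * N\<close>, enough for the linear part
  \<open>900 * N\<close> of a round and its loop test; the rest is covered by the change from
  \<open>a1\<close> to \<open>a'\<close>.\<close>

lemma time_step:
  fixes N :: nat
  assumes "t + 999 * (N * p1) + 800 * a1 \<le> 999 * (N * p) + 800 * a" "u + 800 * a' \<le> 900 * N + 800 * a1" "p' < p1" "1 \<le> N"
  shows "t + u + 1 + 999 * (N * p') + 800 * a' \<le> 999 * (N * p) + 800 * a"
proof -
  have "N * (p' + 1) \<le> N * p1" using assms(3) by (intro mult_le_mono2) simp
  then have "N * p' + N \<le> N * p1" by simp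
  then show ?thesis using assms by linarith
qed

lemma runs_refine_all:
  assumes ctx: "ctx2 W n v xs H X T ys G Y S L s" and adm: "admissible (set xs) n v L" and xs: "xs \<noteq> []"
    and M: "\<forall>w. arrs s ''M'' w = 0"
  shows "runs W (refine_all H X T G Y S) s (\<lambda>t r.
    t \<le> 1000 * ((n + length xs + 1) * (potential n v L + 1)) + 800 * (n * total_volume xs ys n v L) + 800 * (n * length xs) \<and>
    (\<exists>L'. ctx2 W n v xs H X T ys G Y S L' r \<and> admissible (set xs) n v L' \<and> stable (set xs) n v L' \<and>
      potential n v L' \<le> potential n v L))"
proof -
  let ?ctx = "ctx2 W n v xs H X T ys G Y S" and ?N = "n + length xs + 1" and ?c = "refine H X T G Y S"
  let ?s = "s\<lparr>regs := (regs s)(''f'' := 1)\<rparr>"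
  let ?pot = "potential n v" and ?vol = "total_volume xs ys n v"
  let ?U = "999 * (?N * (?pot L + 1)) + 800 * (n * ?vol L) + 800 * (n * length xs)"
  have W: "4 * (n + length xs + 2) \<le> W" using ctx by (auto simp: ctx2_def ctx_def)
  \<comment> \<open>After the stable round the time bound has to hold outright; before it, time and
    the remaining measures together stay within the initial ones.\<close>
  define I where "I t r \<longleftrightarrow> (\<forall>w. arrs r ''M'' w = 0) \<and> (\<exists>L'. ?ctx L' r \<and> admissible (set xs) n v L' \<and> ?pot L' \<le> ?pot L \<and>
    (regs r ''f'' = 0 \<and> stable (set xs) n v L' \<and> t \<le> ?U \<or>
     regs r ''f'' = 1 \<and> t + 999 * (?N * ?pot L') + 800 * (n * ?vol L') \<le> 999 * (?N * ?pot L) + 800 * (n * ?vol L)))"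
    for t and r :: state
  have "runs W (While (Eq (V ''f'') (N 1)) ?c) ?s (\<lambda>t r. 1 + t \<le> ?U + 2 \<and>
    (\<exists>L'. ?ctx L' r \<and> admissible (set xs) n v L' \<and> stable (set xs) n v L' \<and> ?pot L' \<le> ?pot L))"
  proof (rule runs_While[where I = I and U = ?U])
    show "I 0 ?s" unfolding I_def using M adm ctx by (intro conjI exI[of _ L]) simp_all
    show "t \<le> ?U" if "I t r" for t r
      using that unfolding I_def by (auto simp: algebra_simps)
  next
    fix t r
    assume I: "I t r" and "bval (Eq (V ''f'') (N 1)) r"
    then obtain L1 where L1: "?ctx L1 r" "admissible (set xs) n v L1" "?pot L1 \<le> ?pot L" "\<forall>w. arrs r ''M'' w = 0"
      and t: "t + 999 * (?N * ?pot L1) + 800 * (n * ?vol L1) \<le> 999 * (?N * ?pot L) + 800 * (n * ?vol L)"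
      unfolding I_def by auto
    show "runs W ?c r (\<lambda>u. I (t + u + 1))"
    proof (rule runs_conseq[OF runs_refine[OF L1(1,2) xs L1(4)]])
      fix u :: nat and r' :: state
      assume "refine_outcome W n v xs H X T ys G Y S L1 u r'"
      then obtain L' where M': "\<forall>w. arrs r' ''M'' w = 0" and L': "?ctx L' r'" and
        cases: "regs r' ''f'' = 0 \<and> L' = L1 \<and> stable (set xs) n v L1 \<and> u \<le> 900 * ?N + 800 * (n * length xs) \<or>
         regs r' ''f'' = 1 \<and> admissible (set xs) n v L' \<and> ?pot L' < ?pot L1 \<and>
           u + 800 * (n * ?vol L') \<le> 900 * ?N + 800 * (n * ?vol L1)" by blast
      from cases show "I (t + u + 1) r'"
      proof
        assume *: "regs r' ''f'' = 0 \<and> L' = L1 \<and> stable (set xs) n v L1 \<and> u \<le> 900 * ?N + 800 * (n * length xs)"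
        then have u: "u \<le> 900 * ?N + 800 * (n * length xs)" by (elim conjE)
        have "t + u + 1 \<le> ?U" using t u by (rule time_exit) simp
        then show ?thesis unfolding I_def using * M' L' L1 by blast
      next
        assume *: "regs r' ''f'' = 1 \<and> admissible (set xs) n v L' \<and> ?pot L' < ?pot L1 \<and>
           u + 800 * (n * ?vol L') \<le> 900 * ?N + 800 * (n * ?vol L1)"
        then have u: "u + 800 * (n * ?vol L') \<le> 900 * ?N + 800 * (n * ?vol L1)" and p: "?pot L' < ?pot L1"
          by blast+
        have "t + u + 1 + 999 * (?N * ?pot L') + 800 * (n * ?vol L') \<le> 999 * (?N * ?pot L) + 800 * (n * ?vol L)"
          using t u p by (rule time_step) simp
        moreover have "?pot L' \<le> ?pot L" using * L1(3) by simp
        ultimately show ?thesis unfolding I_def using * M' L' by blast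
      qed
    qed
  next
    fix t r
    assume "I t r" and "\<not> bval (Eq (V ''f'') (N 1)) r"
    then show "1 + (t + 1) \<le> ?U + 2 \<and>
      (\<exists>L'. ?ctx L' r \<and> admissible (set xs) n v L' \<and> stable (set xs) n v L' \<and> ?pot L' \<le> ?pot L)"
      unfolding I_def by auto
  qed
  then have "runs W (refine_all H X T G Y S) s (\<lambda>t r. t \<le> ?U + 2 \<and>
    (\<exists>L'. ?ctx L' r \<and> admissible (set xs) n v L' \<and> stable (set xs) n v L' \<and> ?pot L' \<le> ?pot L))"
    using W by (simp add: refine_all_def)
  moreover have "?U + 2 \<le> 1000 * (?N * (?pot L + 1)) + 800 * (n * ?vol L) + 800 * (n * length xs)"
  proof -
    have "2 * 1 \<le> ?N * (?pot L + 1)" using xs by (intro mult_le_mono) (cases xs; simp)+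
    then show ?thesis by linarith
  qed
  ultimately show ?thesis by (elim runs_conseq) auto
qed

section \<open>Initialisation\<close>

definition "build_adjacency = For ''i'' (V ''m'')
  (Seq (Store ''X'' (V ''i'') (A ''H'' (A ''src'' (V ''i''))))
  (Seq (Store ''H'' (A ''src'' (V ''i'')) (Plus (V ''i'') (N 1)))
  (Seq (Store ''Y'' (V ''i'') (A ''G'' (A ''dst'' (V ''i''))))
    (Store ''G'' (A ''dst'' (V ''i'')) (Plus (V ''i'') (N 1))))))"

lemma mod_build_adjacency [simp]:
  "mod_regs build_adjacency = {''i''}" "mod_arrs build_adjacency = {''X'', ''H'', ''Y'', ''G''}"
  by (auto simp: build_adjacency_def)

lemma chain_cong: "(\<And>j. j \<in> set r \<Longrightarrow> nx' j = nx j) \<Longrightarrow> chain nx' e r = chain nx e r"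
  by (induction r arbitrary: e) auto

definition partial_adj :: "(nat \<Rightarrow> nat) \<Rightarrow> nat \<Rightarrow> (nat \<Rightarrow> nat) \<Rightarrow> (nat \<Rightarrow> nat) \<Rightarrow> bool" where
  "partial_adj key k nx hp \<longleftrightarrow> (\<forall>u. hp u \<le> k \<and> chain nx (hp u) (filter (\<lambda>j. key j = u) (rev [0..<k])))"

text \<open>Edge \<open>k\<close> is prepended to the list of its key; links of earlier edges have
  smaller indices and stay intact.\<close>

lemma partial_adj_Suc:
  assumes "partial_adj key k nx hp"
  shows "partial_adj key (Suc k) (nx(k := hp (key k))) (hp(key k := Suc k))"
proof -
  have "chain (nx(k := e)) e' (filter (\<lambda>j. key j = u) (rev [0..<k])) =
      chain nx e' (filter (\<lambda>j. key j = u) (rev [0..<k]))" for e e' u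
    by (rule chain_cong) auto
  with assms show ?thesis unfolding partial_adj_def by (auto simp: le_Suc_eq)
qed

lemma runs_build_adjacency:
  assumes s: "regs s ''m'' = length es" "\<And>i. i < length es \<Longrightarrow> arrs s ''src'' i = fst (es ! i)"
      "\<And>i. i < length es \<Longrightarrow> arrs s ''dst'' i = snd (es ! i)" "\<And>w. arrs s ''H'' w = 0" "\<And>w. arrs s ''G'' w = 0"
    and es: "set es \<subseteq> {..<n} \<times> {..<n}" and W: "n + length es + 1 < W"
  shows "runs W build_adjacency s (\<lambda>t r. t \<le> 6 * length es + 2 \<and>
    adj_repr n es ''H'' ''X'' ''dst'' r \<and> adj_repr n (map prod.swap es) ''G'' ''Y'' ''src'' r)"
proof -
  let ?m = "length es"
  let ?c = "Seq (Store ''X'' (V ''i'') (A ''H'' (A ''src'' (V ''i''))))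
    (Seq (Store ''H'' (A ''src'' (V ''i'')) (Plus (V ''i'') (N 1)))
    (Seq (Store ''Y'' (V ''i'') (A ''G'' (A ''dst'' (V ''i''))))
      (Store ''G'' (A ''dst'' (V ''i'')) (Plus (V ''i'') (N 1)))))"
  define src where "src = arrs s ''src''"
  define dst where "dst = arrs s ''dst''"
  have lt: "src i < n" "dst i < n" if "i < ?m" for i
    using that s(2,3) subsetD[OF es nth_mem[OF that]] by (simp_all add: src_def dst_def mem_Times_iff)
  define I where "I k r \<longleftrightarrow> partial_adj src k (arrs r ''X'') (arrs r ''H'') \<and> partial_adj dst k (arrs r ''Y'') (arrs r ''G'')"
    for k and r :: state
  show ?thesis
    unfolding build_adjacency_def
  proof (rule runs_For[where n = ?m and B = "\<lambda>_. 4" and I = I])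
    show "?m < W" "0 < W" using W by auto
    show "I 0 (s\<lparr>regs := (regs s)(''i'' := 0)\<rparr>)" using s by (simp add: I_def partial_adj_def)
  next
    fix r assume u: "unchanged (For ''i'' (V ''m'') ?c) s r"
    have r: "regs r ''m'' = ?m" "arrs r ''src'' = src" "arrs r ''dst'' = dst"
      using s(1) by (simp_all add: unchanged_regs[OF u] unchanged_arrs[OF u] src_def dst_def)
    then show "aval (V ''m'') r = ?m" by simp
    show "runs W ?c r (\<lambda>u r'. u \<le> 4 \<and> regs r' ''i'' = k \<and> I (Suc k) (r'\<lparr>regs := (regs r')(''i'' := Suc k)\<rparr>))"
      if k: "k < ?m" and I: "I k r" and i: "regs r ''i'' = k" for k
    proof -
      have "arrs r ''H'' (src k) \<le> k" "arrs r ''G'' (dst k) \<le> k" using I by (auto simp: I_def partial_adj_def)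
      then show ?thesis
        using k I i r lt[OF k] W partial_adj_Suc[of src k "arrs r ''X''" "arrs r ''H''"]
          partial_adj_Suc[of dst k "arrs r ''Y''" "arrs r ''G''"]
        by (simp add: I_def)
    qed
    show "t \<le> 6 * ?m + 2 \<and> adj_repr n es ''H'' ''X'' ''dst'' r \<and> adj_repr n (map prod.swap es) ''G'' ''Y'' ''src'' r"
      if I: "I ?m r" and t: "t \<le> (\<Sum>k<?m. 4) + 2 * ?m + 2" for t
    proof -
      have "outs es u = filter (\<lambda>j. src j = u) (rev [0..<?m])"
        "outs (map prod.swap es) u = filter (\<lambda>j. dst j = u) (rev [0..<?m])" for u
        unfolding outs_def using s(2,3) by (auto intro!: filter_cong simp: src_def dst_def)
      then show ?thesis using I t r s(2,3) by (auto simp: I_def partial_adj_def adj_repr_def src_def dst_def)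
    qed
  qed
qed

text \<open>Only targets of edges stay alive, so at most \<open>m\<close> vertices do. They share
  the label \<open>n\<close>, which is no vertex, and thus form one class without representative.
  The last store restores the label of \<open>v\<close>, which may be a target itself.\<close>

definition "init_labels =
  Seq (For ''i'' (V ''n'') (Store ''L'' (V ''i'') (V ''v'')))
  (Seq (For ''i'' (V ''m'') (Store ''L'' (A ''dst'' (V ''i'')) (V ''n'')))
    (Store ''L'' (V ''v'') (V ''v'')))"

lemma mod_init_labels [simp]: "mod_regs init_labels = {''i''}" "mod_arrs init_labels = {''L''}"
  by (auto simp: init_labels_def)

lemma runs_init_labels:
  assumes s: "regs s ''n'' = n" "regs s ''m'' = length es" "regs s ''v'' = v" "v < n"
      "\<And>i. i < length es \<Longrightarrow> arrs s ''dst'' i = snd (es ! i)"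
    and es: "set es \<subseteq> {..<n} \<times> {..<n}" and W: "n + length es + 1 < W"
  shows "runs W init_labels s (\<lambda>t r. t \<le> 3 * n + 3 * length es + 5 \<and>
    (\<forall>w<n. arrs r ''L'' w = (if w \<noteq> v \<and> w \<in> snd ` set es then n else v)) \<and> arrs r ''L'' v = v)"
proof -
  let ?c1 = "Store ''L'' (V ''i'') (V ''v'')" and ?c2 = "Store ''L'' (A ''dst'' (V ''i'')) (V ''n'')"
  let ?m = "length es"
  define P where "P r \<longleftrightarrow> regs r ''n'' = n \<and> regs r ''m'' = ?m \<and> regs r ''v'' = v \<and> arrs r ''dst'' = arrs s ''dst''" for r :: state
  have P_un: "P r'" if "P r" "unchanged (For ''i'' e c) r r'" "mod_arrs c \<subseteq> {''L''}" "mod_regs c = {}" for r r' e c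
  proof -
    have "''dst'' \<notin> mod_arrs c" by (rule contra_subsetD[OF that(3)]) simp
    then show ?thesis using that(1,4) unchanged_regs[OF that(2)] unchanged_arrs[OF that(2)] by (simp add: P_def)
  qed
  have 1: "runs W (For ''i'' (V ''n'') ?c1) s (\<lambda>t r. t \<le> 3 * n + 2 \<and> P r \<and> (\<forall>w<n. arrs r ''L'' w = v))"
  proof (rule runs_For[where n = n and B = "\<lambda>_. 1" and I = "\<lambda>k r. \<forall>w<k. arrs r ''L'' w = v"])
    show "n < W" "0 < W" using W by auto
    fix r assume u: "unchanged (For ''i'' (V ''n'') ?c1) s r"
    have Pr: "P r" by (rule P_un[OF _ u]) (use s in \<open>auto simp: P_def\<close>)
    then show "aval (V ''n'') r = n" by (simp add: P_def)
    show "runs W ?c1 r (\<lambda>u r'. u \<le> 1 \<and> regs r' ''i'' = k \<and>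
        (\<forall>w<Suc k. arrs (r'\<lparr>regs := (regs r')(''i'' := Suc k)\<rparr>) ''L'' w = v))"
      if "k < n" "\<forall>w<k. arrs r ''L'' w = v" "regs r ''i'' = k" for k
      using that Pr W s(4) by (auto simp: P_def less_Suc_eq)
    show "t \<le> 3 * n + 2 \<and> P r \<and> (\<forall>w<n. arrs r ''L'' w = v)"
      if "\<forall>w<n. arrs r ''L'' w = v" "t \<le> (\<Sum>k<n. 1) + 2 * n + 2" for t
      using that Pr by simp
  qed simp
  have 2: "runs W (For ''i'' (V ''m'') ?c2) s1 (\<lambda>t r. t \<le> 3 * ?m + 2 \<and> P r \<and>
      (\<forall>w<n. arrs r ''L'' w = (if w \<in> snd ` set es then n else v)))"
    if s1: "P s1 \<and> (\<forall>w<n. arrs s1 ''L'' w = v)" for s1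
  proof (rule runs_For[where n = ?m and B = "\<lambda>_. 1" and
      I = "\<lambda>k r. \<forall>w<n. arrs r ''L'' w = (if w \<in> (\<lambda>i. snd (es ! i)) ` {..<k} then n else v)"])
    show "?m < W" "0 < W" using W by auto
    fix r assume u: "unchanged (For ''i'' (V ''m'') ?c2) s1 r"
    have Pr: "P r" by (rule P_un[OF _ u]) (use s1 in auto)
    then show "aval (V ''m'') r = ?m" by (simp add: P_def)
    show "runs W ?c2 r (\<lambda>u r'. u \<le> 1 \<and> regs r' ''i'' = k \<and>
        (\<forall>w<n. arrs (r'\<lparr>regs := (regs r')(''i'' := Suc k)\<rparr>) ''L'' w =
          (if w \<in> (\<lambda>i. snd (es ! i)) ` {..<Suc k} then n else v)))"
      if k: "k < ?m" and I: "\<forall>w<n. arrs r ''L'' w = (if w \<in> (\<lambda>i. snd (es ! i)) ` {..<k} then n else v)"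
        and i: "regs r ''i'' = k" for k
    proof -
      have "snd (es ! k) < n" using subsetD[OF es nth_mem[OF k]] by (simp add: mem_Times_iff)
      then show ?thesis using k I i Pr W s(5) by (auto simp: P_def lessThan_Suc)
    qed
    show "t \<le> 3 * ?m + 2 \<and> P r \<and> (\<forall>w<n. arrs r ''L'' w = (if w \<in> snd ` set es then n else v))"
      if I: "\<forall>w<n. arrs r ''L'' w = (if w \<in> (\<lambda>i. snd (es ! i)) ` {..<?m} then n else v)"
        and t: "t \<le> (\<Sum>k<?m. 1) + 2 * ?m + 2" for t
    proof -
      have "(\<lambda>i. snd (es ! i)) ` {..<?m} = snd ` set es" unfolding set_conv_nth by auto
      then show ?thesis using I t Pr by simp
    qed
  qed (use s1 in simp)
  have 3: "runs W (Store ''L'' (V ''v'') (V ''v'')) r (\<lambda>t r. t \<le> 1 \<and>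
      (\<forall>w<n. arrs r ''L'' w = (if w \<noteq> v \<and> w \<in> snd ` set es then n else v)) \<and> arrs r ''L'' v = v)"
    if "P r \<and> (\<forall>w<n. arrs r ''L'' w = (if w \<in> snd ` set es then n else v))" for r
    using that s(4) W by (simp add: P_def)
  show ?thesis
    unfolding init_labels_def
    by (rule runs_conseq[OF runs_SeqI[OF 1 runs_SeqI[OF 2 3]]]) auto
qed

lemma sconn_in_edge:
  assumes "sconn E S" "v \<in> S" "w \<in> S" "w \<noteq> v"
  shows "w \<in> snd ` E"
proof -
  have "(v, w) \<in> rtrancl_on S E" using assms by (intro sconnD)
  then show ?thesis using assms(4) by (cases rule: rtrancl_on.cases) force+
qed

text \<open>In a biconnected set through \<open>v\<close> each other vertex is reached from
  \<open>v\<close>, hence has an incoming edge and is not discarded.\<close>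

lemma admissible_initial:
  assumes "\<And>w. w < n \<Longrightarrow> L w = (if w \<noteq> v \<and> w \<in> snd ` E then n else v)" "L v = v" "v < n"
  shows "admissible E n v L"
  unfolding admissible_def
proof (intro conjI allI impI)
  fix S assume S: "S \<subseteq> {..<n}" "biconn E S \<and> v \<in> S"
  have "L w = n" if w: "w \<in> S - {v}" for w
  proof -
    have "w \<in> snd ` E" using S w sconn_in_edge[of E S v w] by (auto simp: biconn_def)
    moreover have "w < n" using S w by auto
    ultimately show ?thesis using assms(1) w by simp
  qed
  then show "\<exists>l. l \<noteq> v \<and> (\<forall>w\<in>S - {v}. L w = l)" using assms(3) by (intro exI[of _ n]) simp
qed fact

section \<open>Output\<close>

definition "emit_class = For ''h'' (V ''n'')
  (If (Eq (A ''L'' (V ''h'')) (V ''i''))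
    (Seq (inc ''c'') (Store ''out'' (Plus (V ''o'') (V ''c'')) (V ''h'')))
    Skip)"

lemma mod_emit_class [simp]: "mod_regs emit_class = {''h'', ''c''}" "mod_arrs emit_class = {''out''}"
  by (auto simp: emit_class_def)

definition class_list :: "nat \<Rightarrow> (nat \<Rightarrow> nat) \<Rightarrow> nat \<Rightarrow> nat list" where
  "class_list n L l = filter (\<lambda>w. L w = l) [0..<n]"

lemma class_list: "set (class_list n L l) = class_of n L l" "distinct (class_list n L l)"
  "length (class_list n L l) = card (class_of n L l)" "length (class_list n L l) \<le> n"
proof -
  show s: "set (class_list n L l) = class_of n L l" and d: "distinct (class_list n L l)"
    by (auto simp: class_list_def class_of_def)
  show "length (class_list n L l) = card (class_of n L l)" using distinct_card[OF d] s by simp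
  show "length (class_list n L l) \<le> n"
    unfolding class_list_def by (metis length_filter_le length_upt minus_nat.diff_0)
qed

lemma runs_emit_class:
  assumes s: "regs s ''n'' = n" "regs s ''i'' = l" "regs s ''o'' = p" "regs s ''c'' = 1" "arrs s ''L'' = L"
    and W: "p + n + 2 < W"
  shows "runs W emit_class s (\<lambda>t r. t \<le> 5 * n + 2 \<and> regs r ''c'' = 1 + length (class_list n L l) \<and>
    (\<forall>j<length (class_list n L l). arrs r ''out'' (p + 2 + j) = class_list n L l ! j) \<and>
    (\<forall>j\<le>p + 1. arrs r ''out'' j = arrs s ''out'' j))"
proof -
  let ?c = "If (Eq (A ''L'' (V ''h'')) (V ''i''))
    (Seq (inc ''c'') (Store ''out'' (Plus (V ''o'') (V ''c'')) (V ''h''))) Skip"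
  define I where "I k r \<longleftrightarrow> regs r ''c'' = 1 + length (class_list k L l) \<and>
    (\<forall>j<length (class_list k L l). arrs r ''out'' (p + 2 + j) = class_list k L l ! j) \<and>
    (\<forall>j\<le>p + 1. arrs r ''out'' j = arrs s ''out'' j)" for k and r :: state
  show ?thesis
    unfolding emit_class_def
  proof (rule runs_For[where n = n and B = "\<lambda>_. 3" and I = I])
    show "n < W" "0 < W" using W by auto
    show "I 0 (s\<lparr>regs := (regs s)(''h'' := 0)\<rparr>)" using s by (simp add: I_def class_list_def)
  next
    fix r assume u: "unchanged (For ''h'' (V ''n'') ?c) s r"
    have r: "regs r ''n'' = n" "regs r ''i'' = l" "regs r ''o'' = p" "arrs r ''L'' = L"
      using s by (simp_all add: unchanged_regs[OF u] unchanged_arrs[OF u])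
    then show "aval (V ''n'') r = n" by simp
    show "runs W ?c r (\<lambda>u r'. u \<le> 3 \<and> regs r' ''h'' = k \<and> I (Suc k) (r'\<lparr>regs := (regs r')(''h'' := Suc k)\<rparr>))"
      if k: "k < n" and I: "I k r" and h: "regs r ''h'' = k" for k
    proof (cases "L k = l")
      case False
      then have "class_list (Suc k) L l = class_list k L l" by (simp add: class_list_def)
      with False I h r show ?thesis by (simp add: I_def)
    next
      case True
      then have cl: "class_list (Suc k) L l = class_list k L l @ [k]" by (simp add: class_list_def)
      have "length (class_list k L l) \<le> k" by (rule class_list)
      with True I h r W k show ?thesis by (auto simp: I_def cl nth_append less_Suc_eq)
    qed
    show "t \<le> 5 * n + 2 \<and> regs r ''c'' = 1 + length (class_list n L l) \<and>
      (\<forall>j<length (class_list n L l). arrs r ''out'' (p + 2 + j) = class_list n L l ! j) \<and>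
      (\<forall>j\<le>p + 1. arrs r ''out'' j = arrs s ''out'' j)"
      if "I n r" "t \<le> (\<Sum>k<n. 3) + 2 * n + 2" for t
      using that by (simp add: I_def)
  qed
qed

text \<open>Cell \<open>o\<close> is reserved for the size and cell \<open>o + 1\<close> receives
  \<open>v\<close>; the size \<open>c\<close> is written once the class has been listed. If the
  class has fewer than two vertices, \<open>o\<close> stays put and the cells written are
  overwritten or ignored.\<close>

definition "emit_rep =
  If (And (Eq (A ''L'' (V ''i'')) (V ''i'')) (Not (Eq (V ''i'') (V ''v''))))
    (Seq (Store ''out'' (Plus (V ''o'') (N 1)) (V ''v''))
    (Seq (Assign ''c'' (N 1))
    (Seq emit_class
      (If (Less (N 2) (V ''c''))
        (Seq (Store ''out'' (V ''o'') (V ''c''))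
        (Seq (Assign ''o'' (Plus (Plus (V ''o'') (V ''c'')) (N 1)))
          (inc ''j'')))
        Skip))))
    Skip"

definition "output_classes =
  Seq (Assign ''o'' (N 1))
  (Seq (Assign ''j'' (N 0))
  (Seq (For ''i'' (V ''n'') emit_rep)
    (Store ''out'' (N 0) (V ''j''))))"

lemma mod_emit_rep [simp]: "mod_regs emit_rep = {''h'', ''c'', ''o'', ''j''}" "mod_arrs emit_rep = {''out''}"
  by (auto simp: emit_rep_def)

definition component_lists :: "nat \<Rightarrow> nat \<Rightarrow> (nat \<Rightarrow> nat) \<Rightarrow> nat \<Rightarrow> nat list list" where
  "component_lists n v L k = map (\<lambda>l. v # class_list n L l)
     (filter (\<lambda>l. L l = l \<and> l \<noteq> v \<and> 2 \<le> card (class_of n L l)) [0..<k])"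

abbreviation encode_body :: "nat list list \<Rightarrow> nat list" where
  "encode_body xss \<equiv> concat (map (\<lambda>xs. length xs # xs) xss)"

text \<open>The bounds on \<open>j\<close> and \<open>o\<close> serve the word bound: output
  addresses are quadratic in \<open>n\<close>, whence the requirement
  \<open>(n + 3) * (n + 3) \<le> W\<close>.\<close>

definition out_inv where
  "out_inv n v L k r \<longleftrightarrow> regs r ''j'' = length (component_lists n v L k) \<and> regs r ''j'' \<le> k \<and>
     regs r ''o'' = 1 + length (encode_body (component_lists n v L k)) \<and> regs r ''o'' \<le> 1 + k * (n + 2) \<and>
     (\<forall>i<length (encode_body (component_lists n v L k)).
        arrs r ''out'' (1 + i) = encode_body (component_lists n v L k) ! i)"

lemma runs_emit_rep:
  assumes s: "regs s ''n'' = n" "regs s ''v'' = v" "regs s ''i'' = k" "arrs s ''L'' = L" "k < n" "v < n"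
    and I: "out_inv n v L k s" and W: "(n + 3) * (n + 3) \<le> W"
  shows "runs W emit_rep s (\<lambda>t r. t \<le> (if L k = k \<and> k \<noteq> v then 5 * n + 10 else 2) \<and> out_inv n v L (Suc k) r)"
proof (cases "L k = k \<and> k \<noteq> v")
  case False
  then have "component_lists n v L (Suc k) = component_lists n v L k" by (auto simp: component_lists_def)
  with I have "out_inv n v L (Suc k) s" by (simp add: out_inv_def)
  with False s show ?thesis by (auto simp: emit_rep_def)
next
  case True
  define p where "p = regs s ''o''"
  let ?w = "class_list n L k"
  have p: "1 \<le> p" "p \<le> 1 + k * (n + 2)" using I by (auto simp: out_inv_def p_def)
  have "k * (n + 2) + (n + 2) \<le> n * (n + 2)" using mult_le_mono1[of "Suc k" n "n + 2"] s(5) by simp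
  moreover have "n * (n + 2) + 4 * n + 9 = (n + 3) * (n + 3)" by (simp add: algebra_simps)
  ultimately have pW: "p + n + 2 < W" using p(2) W by simp
  let ?s = "s\<lparr>regs := (regs s)(''c'' := 1), arrs := (arrs s)(''out'' := (arrs s ''out'')(p + 1 := v))\<rparr>"
  let ?end = "If (Less (N 2) (V ''c'')) (Seq (Store ''out'' (V ''o'') (V ''c''))
    (Seq (Assign ''o'' (Plus (Plus (V ''o'') (V ''c'')) (N 1))) (inc ''j''))) Skip"
  have lw: "length ?w \<le> n" "length ?w = card (class_of n L k)" by (rule class_list)+
  have "runs W (Seq emit_class ?end) ?s (\<lambda>t r. t \<le> 5 * n + 2 + 4 \<and> out_inv n v L (Suc k) r)"
  proof (rule runs_SeqI)
    show "runs W emit_class ?s (\<lambda>t r. t \<le> 5 * n + 2 \<and> (regs r ''o'' = p \<and> regs r ''j'' = regs s ''j'' \<and>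
      regs r ''c'' = 1 + length ?w \<and>
      (\<forall>j<length ?w. arrs r ''out'' (p + 2 + j) = ?w ! j) \<and> arrs r ''out'' (p + 1) = v \<and>
      (\<forall>j<p. arrs r ''out'' j = arrs s ''out'' j)))"
    proof (rule runs_conseq[OF runs_emit_class[of ?s n k p L]])
      fix t :: nat and r
      assume u: "unchanged emit_class ?s r" and q: "t \<le> 5 * n + 2 \<and> regs r ''c'' = 1 + length ?w \<and>
        (\<forall>j<length ?w. arrs r ''out'' (p + 2 + j) = ?w ! j) \<and>
        (\<forall>j\<le>p + 1. arrs r ''out'' j = arrs ?s ''out'' j)"
      have "regs r ''o'' = p" "regs r ''j'' = regs s ''j''"
        using unchanged_regs[OF u] by (simp_all add: p_def)
      then show "t \<le> 5 * n + 2 \<and> (regs r ''o'' = p \<and> regs r ''j'' = regs s ''j'' \<and> regs r ''c'' = 1 + length ?w \<and>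
        (\<forall>j<length ?w. arrs r ''out'' (p + 2 + j) = ?w ! j) \<and> arrs r ''out'' (p + 1) = v \<and>
        (\<forall>j<p. arrs r ''out'' j = arrs s ''out'' j))" using q by auto
    qed (use s pW in \<open>simp_all add: p_def\<close>)
  next
    fix r :: state
    assume r: "regs r ''o'' = p \<and> regs r ''j'' = regs s ''j'' \<and> regs r ''c'' = 1 + length ?w \<and>
      (\<forall>j<length ?w. arrs r ''out'' (p + 2 + j) = ?w ! j) \<and> arrs r ''out'' (p + 1) = v \<and>
      (\<forall>j<p. arrs r ''out'' j = arrs s ''out'' j)"
    define xss where "xss = component_lists n v L k"
    have old: "regs s ''j'' = length xss" "length xss \<le> k" "p = 1 + length (encode_body xss)"
      "\<And>i. i < length (encode_body xss) \<Longrightarrow> arrs s ''out'' (1 + i) = encode_body xss ! i"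
      using I by (auto simp: out_inv_def xss_def p_def)
    show "runs W ?end r (\<lambda>t r. t \<le> 4 \<and> out_inv n v L (Suc k) r)"
    proof (cases "2 \<le> length ?w")
      case False
      then have "component_lists n v L (Suc k) = xss" using lw by (simp add: component_lists_def xss_def)
      then have "out_inv n v L (Suc k) r"
        using r old p by (auto simp: out_inv_def)
      then show ?thesis using False r by simp
    next
      case big: True
      then have cs: "component_lists n v L (Suc k) = xss @ [v # ?w]"
        using lw True by (simp add: component_lists_def xss_def)
      let ?r = "r\<lparr>regs := (regs r)(''o'' := p + (1 + length ?w) + 1, ''j'' := Suc (length xss)),
        arrs := (arrs r)(''out'' := (arrs r ''out'')(p := 1 + length ?w))\<rparr>"
      have "out_inv n v L (Suc k) ?r"
        unfolding out_inv_def cs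
      proof (intro conjI allI impI)
        show "regs ?r ''o'' \<le> 1 + Suc k * (n + 2)" using p(2) lw(1) by simp
        fix i assume i: "i < length (encode_body (xss @ [v # ?w]))"
        show "arrs ?r ''out'' (1 + i) = encode_body (xss @ [v # ?w]) ! i"
        proof (cases "i < length (encode_body xss)")
          case True
          then show ?thesis using r old(3,4) by (simp add: nth_append)
        next
          case False
          define d where "d = i - length (encode_body xss)"
          have d: "1 + i = p + d" using False old(3) by (simp add: d_def)
          have "encode_body (xss @ [v # ?w]) ! i = (Suc (length ?w) # v # ?w) ! d"
            using False by (simp add: nth_append d_def)
          moreover have "d < 2 + length ?w" using i False by (simp add: d_def)
          moreover have "arrs r ''out'' (p + 2 + j) = ?w ! j" if "j < length ?w" for j using r that by blast
          ultimately show ?thesis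
            unfolding d using r by (cases d; cases "d - 1") (auto simp: add.assoc)
        qed
      qed (use old in simp_all)
      moreover have "p + (length ?w + 2) < W" "Suc (length xss) < W" using pW lw(1) old(2) s(5) by simp_all
      ultimately show ?thesis using big r old(1) by simp
    qed
  qed
  then have *: "runs W (Seq emit_class ?end) ?s (\<lambda>t r. 3 + t \<le> 5 * n + 10 \<and> out_inv n v L (Suc k) r)"
    by (rule runs_conseq) simp
  define body where "body = Seq emit_class ?end"
  have er: "emit_rep = If (And (Eq (A ''L'' (V ''i'')) (V ''i'')) (Not (Eq (V ''i'') (V ''v''))))
    (Seq (Store ''out'' (Plus (V ''o'') (N 1)) (V ''v'')) (Seq (Assign ''c'' (N 1)) body)) Skip"
    by (simp add: emit_rep_def body_def)
  show ?thesis unfolding er using True s pW p *[folded body_def] by (simp flip: p_def)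
qed

text \<open>Only a representative triggers a pass over all vertices, and representatives other than
  \<open>v\<close> are alive. This keeps the output within \<open>n * m\<close> although a pass
  costs \<open>n\<close>.\<close>

lemma runs_output_classes:
  assumes s: "regs s ''n'' = n" "regs s ''v'' = v" "arrs s ''L'' = L" "v < n" and W: "(n + 3) * (n + 3) \<le> W"
  shows "runs W output_classes s (\<lambda>t r. t \<le> 4 * n + 5 + card (alive n v L) * (5 * n + 10) \<and>
    (\<forall>i<length (encode_lists (component_lists n v L n)). arrs r ''out'' i = encode_lists (component_lists n v L n) ! i))"
proof -
  have W': "n + 9 \<le> W" using W s(4) by (simp add: algebra_simps)
  let ?s = "s\<lparr>regs := (regs s)(''o'' := 1, ''j'' := 0)\<rparr>"
  let ?rep = "\<lambda>k. L k = k \<and> k \<noteq> v"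
  let ?B = "\<lambda>k. if ?rep k then 5 * n + 10 else 2"
  have P: "regs r ''n'' = n \<and> regs r ''v'' = v \<and> arrs r ''L'' = L"
    if "unchanged (For ''i'' (V ''n'') emit_rep) ?s r" for r
    using s unchanged_regs[OF that] unchanged_arrs[OF that] by simp
  have "runs W (For ''i'' (V ''n'') emit_rep) ?s (\<lambda>t r. t \<le> (\<Sum>k<n. ?B k) + 2 * n + 2 \<and> out_inv n v L n r)"
  proof (rule runs_For[where n = n and B = ?B and I = "\<lambda>k r. out_inv n v L k r"])
    show "n < W" "0 < W" using W' by auto
    show "out_inv n v L 0 (?s\<lparr>regs := (regs ?s)(''i'' := 0)\<rparr>)"
      by (simp add: out_inv_def component_lists_def)
    fix r assume u: "unchanged (For ''i'' (V ''n'') emit_rep) ?s r"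
    show "aval (V ''n'') r = n" using P[OF u] by simp
    show "runs W emit_rep r (\<lambda>u r'. u \<le> ?B k \<and> regs r' ''i'' = k \<and> out_inv n v L (Suc k) (r'\<lparr>regs := (regs r')(''i'' := Suc k)\<rparr>))"
      if k: "k < n" "out_inv n v L k r" "regs r ''i'' = k" for k
    proof (rule runs_conseq[OF runs_emit_rep[of r n v k L]])
      fix t :: nat and r'
      assume q: "t \<le> ?B k \<and> out_inv n v L (Suc k) r'" and u': "unchanged emit_rep r r'"
      have "regs r' ''i'' = k" using unchanged_regs[OF u', of "''i''"] k(3) by simp
      moreover have "out_inv n v L (Suc k) (r'\<lparr>regs := (regs r')(''i'' := Suc k)\<rparr>)"
        using q by (simp add: out_inv_def)
      ultimately show "t \<le> ?B k \<and> regs r' ''i'' = k \<and> out_inv n v L (Suc k) (r'\<lparr>regs := (regs r')(''i'' := Suc k)\<rparr>)"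
        using q by blast
    qed (use P[OF u] k s W in auto)
  qed auto
  note loop = this
  have B: "(\<Sum>k<n. ?B k) \<le> 2 * n + card (alive n v L) * (5 * n + 10)"
  proof -
    have "(\<Sum>k<n. ?B k) \<le> (\<Sum>k<n. 2 + (if ?rep k then 5 * n + 10 else 0))" by (intro sum_mono) auto
    also have "\<dots> = 2 * n + card {k \<in> {..<n}. ?rep k} * (5 * n + 10)"
      unfolding sum.distrib by (simp add: sum.If_cases Int_def)
    also have "card {k \<in> {..<n}. ?rep k} \<le> card (alive n v L)"
      by (intro card_mono) (auto simp: alive_def)
    finally show ?thesis by (simp add: mult_le_mono1)
  qed
  define xss where "xss = component_lists n v L n"
  let ?P = "\<lambda>t r. t \<le> 4 * n + 5 + card (alive n v L) * (5 * n + 10) \<and>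
      (\<forall>i<length (encode_lists xss). arrs r ''out'' i = encode_lists xss ! i)"
  have "runs W (For ''i'' (V ''n'') emit_rep) ?s (\<lambda>t r. runs W (Store ''out'' (N 0) (V ''j'')) r (\<lambda>u. ?P (1 + (1 + (t + u)))))"
  proof (rule runs_conseq[OF loop])
    fix t :: nat and r :: state
    assume "t \<le> (\<Sum>k<n. ?B k) + 2 * n + 2 \<and> out_inv n v L n r"
    then have t: "t \<le> (\<Sum>k<n. ?B k) + 2 * n + 2" and o: "out_inv n v L n r" by blast+
    have time: "1 + (1 + (t + 1)) \<le> 4 * n + 5 + card (alive n v L) * (5 * n + 10)" using t B by linarith
    have j: "regs r ''j'' = length xss" "length xss \<le> n" using o by (auto simp: out_inv_def xss_def)
    have "((arrs r ''out'')(0 := length xss)) i = encode_lists xss ! i" if "i < length (encode_lists xss)" for i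
    proof (cases i)
      case (Suc k)
      with that have "k < length (encode_body xss)" by (simp add: encode_lists_def)
      then have "arrs r ''out'' (1 + k) = encode_body xss ! k" using o by (simp add: out_inv_def xss_def)
      then show ?thesis using Suc by (simp add: encode_lists_def)
    qed (simp add: encode_lists_def)
    with time j W' show "runs W (Store ''out'' (N 0) (V ''j'')) r (\<lambda>u. ?P (1 + (1 + (t + u))))" by simp
  qed
  then show ?thesis using W' by (simp add: output_classes_def xss_def)
qed

lemma outputs_component_lists:
  assumes "L v = v" and out: "\<And>i. i < length (encode_lists (component_lists n v L n)) \<Longrightarrow>
      arrs s ''out'' i = encode_lists (component_lists n v L n) ! i"
  shows "outputs_family s ((\<lambda>l. insert v (class_of n L l)) ` {l. l < n \<and> L l = l \<and> l \<noteq> v \<and> 2 \<le> card (class_of n L l)})"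
  unfolding outputs_family_def
proof (intro exI[of _ "component_lists n v L n"] conjI ballI allI impI)
  let ?ls = "filter (\<lambda>l. L l = l \<and> l \<noteq> v \<and> 2 \<le> card (class_of n L l)) [0..<n]"
  have eq: "map set (component_lists n v L n) = map (\<lambda>l. insert v (class_of n L l)) ?ls"
    by (simp add: component_lists_def class_list)
  show "set (map set (component_lists n v L n)) =
      (\<lambda>l. insert v (class_of n L l)) ` {l. l < n \<and> L l = l \<and> l \<noteq> v \<and> 2 \<le> card (class_of n L l)}"
    unfolding eq by auto
  \<comment> \<open>A representative lies in its own class, so different representatives give
    different sets.\<close>
  have "inj_on (\<lambda>l. insert v (class_of n L l)) (set ?ls)"
  proof (rule inj_onI)
    fix k l assume kl: "k \<in> set ?ls" "l \<in> set ?ls" "insert v (class_of n L k) = insert v (class_of n L l)"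
    then have "k \<in> insert v (class_of n L k)" by (auto simp: class_of_def)
    with kl show "k = l" by (auto simp: class_of_def)
  qed
  then show "distinct (map set (component_lists n v L n))" unfolding eq by (simp add: distinct_map)
  show "distinct xs" if "xs \<in> set (component_lists n v L n)" for xs
    using that assms(1) class_list[of n L] by (auto simp: component_lists_def class_of_def)
qed (rule out)

section \<open>The whole program and its running time\<close>

definition "two_vccs_program =
  If (Eq (V ''m'') (N 0)) Skip
    (Seq build_adjacency
    (Seq init_labels
    (Seq (refine_all ''H'' ''X'' ''dst'' ''G'' ''Y'' ''src'')
      output_classes)))"

lemma kvccs_2_no_edges:
  assumes "pair_wf_digraph G" "parcs G = {}"
  shows "{C \<in> kvccs 2 (with_proj G). v \<in> C} = {}"
proof -
  interpret pair_wf_digraph G by fact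
  have False if C: "C \<in> kvccs 2 (with_proj G)" "v \<in> C" for C
  proof -
    from C(1) have b: "biconn {} C" using assms(2) by (simp add: kvccs_2_iff)
    then have "\<not> C \<subseteq> {v}" using card_mono[of "{v}" C] by (auto simp: biconn_def)
    then obtain w where "w \<in> C" "w \<noteq> v" by auto
    with sconn_in_edge[of "{}" C v w] b C(2) show False by (auto simp: biconn_def)
  qed
  then show ?thesis by auto
qed

lemma two_vccs_program_correct:
  fixes G :: "nat pair_pre_digraph"
  assumes G: "pair_fin_digraph G" "pverts G = {..<n}" "set es = parcs G" and v: "v < n"
    and W: "4 * (n + length es + 2) \<le> W" "(n + 3) * (n + 3) \<le> W" and ne: "es \<noteq> []"
  shows "runs W two_vccs_program (initial_state n es v) (\<lambda>t s. t \<le> 20000 * (n * length es) \<and>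
    outputs_family s {C \<in> kvccs 2 (with_proj G). v \<in> C})"
proof -
  interpret pair_fin_digraph G by fact
  let ?m = "length es" and ?s = "initial_state n es v" and ?ys = "map prod.swap es"
  have E: "set es \<subseteq> {..<n} \<times> {..<n}"
    using in_arcsD1 in_arcsD2 G(2,3) by fastforce
  have m: "1 \<le> ?m" using ne by (cases es) auto
  have sys: "set ?ys = (set es)\<inverse>" by auto
  let ?ctx = "ctx2 W n v es ''H'' ''X'' ''dst'' ?ys ''G'' ''Y'' ''src''"
  define L0 where "L0 w = (if w < n then if w \<noteq> v \<and> w \<in> snd ` set es then n else v else w)" for w
  define R where "R r \<longleftrightarrow> regs r ''n'' = n \<and> regs r ''m'' = ?m \<and> regs r ''v'' = v \<and> (\<forall>w. arrs r ''M'' w = 0) \<and>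
    (\<forall>i<?m. arrs r ''src'' i = fst (es ! i)) \<and> (\<forall>i<?m. arrs r ''dst'' i = snd (es ! i))" for r :: state
  define adj where "adj r \<longleftrightarrow> adj_repr n es ''H'' ''X'' ''dst'' r \<and> adj_repr n ?ys ''G'' ''Y'' ''src'' r" for r :: state
  have Rs: "R ?s" by (simp add: R_def initial_state_def)
  have R_un: "R r'" if "R r" "unchanged c r r'" "{''n'', ''m'', ''v''} \<inter> mod_regs c = {}" "{''M'', ''src'', ''dst''} \<inter> mod_arrs c = {}" for c r r'
    using that(1,3,4) unchanged_regs[OF that(2)] unchanged_arrs[OF that(2)] by (simp add: R_def)
  have 1: "runs W build_adjacency ?s (\<lambda>t r. t \<le> 6 * ?m + 2 \<and> (R r \<and> adj r))"
    by (rule runs_conseq[OF runs_build_adjacency[of ?s es n]])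
      (use W E R_un[OF Rs] in \<open>simp_all add: initial_state_def adj_def\<close>)
  have 2: "runs W init_labels r (\<lambda>t r. t \<le> 3 * n + 3 * ?m + 5 \<and> (R r \<and> (\<exists>L. ?ctx L r \<and> (\<forall>w<n. L w = L0 w))))"
    if r: "R r \<and> adj r" for r
  proof (rule runs_conseq[OF runs_init_labels[of r n es v]])
    fix t :: nat and r' :: state
    assume u: "unchanged init_labels r r'" and q: "t \<le> 3 * n + 3 * ?m + 5 \<and>
      (\<forall>w<n. arrs r' ''L'' w = (if w \<noteq> v \<and> w \<in> snd ` set es then n else v)) \<and> arrs r' ''L'' v = v"
    have R': "R r'" using r by (intro R_un[OF _ u]) auto
    have "adj_repr n es ''H'' ''X'' ''dst'' r'" "adj_repr n ?ys ''G'' ''Y'' ''src'' r'"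
      using r adj_repr_unchanged[OF u] by (simp_all add: adj_def)
    moreover have "set ?ys \<subseteq> {..<n} \<times> {..<n}" using E by auto
    ultimately have "?ctx (arrs r' ''L'') r'"
      using q R' W(1) E v sys by (simp add: ctx2_def ctx_def R_def del: set_map)
    then show "t \<le> 3 * n + 3 * ?m + 5 \<and> (R r' \<and> (\<exists>L. ?ctx L r' \<and> (\<forall>w<n. L w = L0 w)))"
      using q R' by (intro conjI exI[of _ "arrs r' ''L''"]) (auto simp: L0_def)
  qed (use r v E W in \<open>auto simp: R_def\<close>)
  define stop where "stop L r \<longleftrightarrow> ?ctx L r \<and> admissible (set es) n v L \<and> stable (set es) n v L \<and> card (alive n v L) \<le> 2 * ?m" for L r
  have 3: "runs W (refine_all ''H'' ''X'' ''dst'' ''G'' ''Y'' ''src'') r (\<lambda>t r. t \<le> 12000 * (n * ?m) \<and> (\<exists>L. stop L r))"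
    if r: "R r \<and> (\<exists>L. ?ctx L r \<and> (\<forall>w<n. L w = L0 w))" for r
  proof -
    from r obtain L where L: "?ctx L r" "\<And>w. w < n \<Longrightarrow> L w = L0 w" by blast
    have Lv: "L v = v" using L(1) by (auto simp: ctx2_def ctx_def)
    have adm: "admissible (set es) n v L"
      by (rule admissible_initial[of n L v "set es", OF _ Lv v]) (use L(2) in \<open>simp add: L0_def\<close>)
    \<comment> \<open>Here the initial discards pay off: the number of alive vertices is bounded by
      the number of edges.\<close>
    have "alive n v L \<subseteq> snd ` set es"
      using L(2) by (auto simp: alive_def L0_def split: if_splits)
    then have "card (alive n v L) \<le> card (snd ` set es)" by (intro card_mono) auto
    also have "\<dots> \<le> ?m" by (meson card_image_le card_length finite_set le_trans)
    finally have am: "card (alive n v L) \<le> ?m" .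
    have "alive n v L \<subseteq> {..<n}" by (auto simp: alive_def)
    then have an: "card (alive n v L) \<le> n" using card_mono[of "{..<n}"] by fastforce
    have "card {w \<in> alive n v L. L w \<noteq> w} \<le> card (alive n v L)" by (intro card_mono) auto
    \<comment> \<open>Both bounds are needed: in \<open>(n + ?m + 1) * (potential n v L + 1)\<close>
      the factor \<open>n\<close> meets the bound \<open>2 * ?m\<close> and the factor
      \<open>?m\<close> the bound \<open>2 * n\<close>.\<close>
    then have pot: "potential n v L \<le> 2 * ?m" "potential n v L \<le> 2 * n" using am an by (auto simp: potential_def)
    have vol: "total_volume es ?ys n v L \<le> 2 * ?m"
      unfolding total_volume_def volume_def
      using sum_deg_le[of "alive n v L" es] sum_deg_le[of "alive n v L" ?ys] by simp
    have nm: "n \<le> n * ?m" "?m \<le> n * ?m" "1 \<le> n * ?m" using v m by auto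
    have "n * potential n v L \<le> 2 * (n * ?m)" using mult_le_mono2[OF pot(1), of n] by (simp add: ac_simps)
    moreover have "?m * potential n v L \<le> 2 * (n * ?m)"
      using mult_le_mono2[OF pot(2), of ?m] by (simp add: ac_simps)
    moreover have "n * total_volume es ?ys n v L \<le> 2 * (n * ?m)"
      using mult_le_mono2[OF vol, of n] by (simp add: ac_simps)
    moreover have "potential n v L \<le> 2 * (n * ?m)" using pot(1) nm(2) by linarith
    moreover have "(n + ?m + 1) * (potential n v L + 1) =
        n * potential n v L + ?m * potential n v L + potential n v L + n + ?m + 1"
      by (simp add: algebra_simps)
    ultimately have *: "1000 * ((n + ?m + 1) * (potential n v L + 1)) + 800 * (n * total_volume es ?ys n v L) + 800 * (n * ?m) \<le> 12000 * (n * ?m)"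
      using nm by linarith
    show ?thesis
    proof (rule runs_conseq[OF runs_refine_all[OF L(1) adm ne]])
      show "\<forall>w. arrs r ''M'' w = 0" using r by (simp add: R_def)
      fix t :: nat and r' :: state
      assume "t \<le> 1000 * ((n + ?m + 1) * (potential n v L + 1)) + 800 * (n * total_volume es ?ys n v L) + 800 * (n * ?m) \<and>
        (\<exists>L'. ?ctx L' r' \<and> admissible (set es) n v L' \<and> stable (set es) n v L' \<and> potential n v L' \<le> potential n v L)"
      then obtain L' where t: "t \<le> 1000 * ((n + ?m + 1) * (potential n v L + 1)) + 800 * (n * total_volume es ?ys n v L) + 800 * (n * ?m)"
        and L': "?ctx L' r'" "admissible (set es) n v L'" "stable (set es) n v L'" "potential n v L' \<le> potential n v L" by blast
      \<comment> \<open>The final labelling inherits its bound from the potential, which never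
        increases; the output phase relies on it.\<close>
      have "card (alive n v L') \<le> 2 * ?m" using L'(4) pot by (simp add: potential_def)
      then have "stop L' r'" using L' by (simp add: stop_def)
      then show "t \<le> 12000 * (n * ?m) \<and> (\<exists>L. stop L r')" using t * by (meson le_trans)
    qed
  qed
  let ?F = "{C \<in> kvccs 2 (with_proj G). v \<in> C}"
  have 4: "runs W output_classes r (\<lambda>t r. t \<le> 40 * (n * ?m) \<and> outputs_family r ?F)" if r: "\<exists>L. stop L r" for r
  proof -
    from r obtain L where L: "stop L r" ..
    have c: "regs r ''n'' = n" "regs r ''v'' = v" "arrs r ''L'' = L" "L v = v" using L by (auto simp: stop_def ctx2_def ctx_def)
    have "card (alive n v L) * (5 * n + 10) \<le> (2 * ?m) * (15 * n)"
      using L v by (intro mult_le_mono) (auto simp: stop_def)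
    moreover have "n \<le> n * ?m" "1 \<le> n * ?m" using v m by auto
    moreover have "(2 * ?m) * (15 * n) = 30 * (n * ?m)" by simp
    ultimately have t: "4 * n + 5 + card (alive n v L) * (5 * n + 10) \<le> 40 * (n * ?m)" by linarith
    have F: "?F = (\<lambda>l. insert v (class_of n L l)) ` {l. l < n \<and> L l = l \<and> l \<noteq> v \<and> 2 \<le> card (class_of n L l)}"
      by (rule kvccs_2_containing) (use L G v in \<open>auto simp: stop_def stable_def intro: pair_wf_digraph_axioms\<close>)
    show ?thesis
      by (rule runs_conseq[OF runs_output_classes[OF c(1-3) v W(2)]])
        (use t outputs_component_lists[of L v n] c(4) in \<open>auto simp: F\<close>)
  qed
  have "n \<le> n * ?m" "?m \<le> n * ?m" "1 \<le> n * ?m" using v m by auto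
  then have "1 + (6 * ?m + 2 + (3 * n + 3 * ?m + 5 + (12000 * (n * ?m) + 40 * (n * ?m)))) \<le> 20000 * (n * ?m)" by linarith
  then have "runs W (Seq build_adjacency (Seq init_labels (Seq (refine_all ''H'' ''X'' ''dst'' ''G'' ''Y'' ''src'') output_classes))) ?s
    (\<lambda>t r. 1 + t \<le> 20000 * (n * ?m) \<and> outputs_family r ?F)"
    by (intro runs_conseq[OF runs_SeqI[OF 1 runs_SeqI[OF 2 runs_SeqI[OF 3 4]]]]) auto
  moreover have "regs ?s ''m'' \<noteq> 0" using ne by (simp add: initial_state_def)
  ultimately show ?thesis unfolding two_vccs_program_def by (simp del: runs_Seq)
qed

theorem theorem2:
  shows "\<exists>(prog :: com) (d :: nat) (c :: nat).
    \<forall>(G :: nat pair_pre_digraph) (n :: nat) (m :: nat) (es :: (nat \<times> nat) list) (v :: nat).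
      pair_fin_digraph G \<and> pverts G = {..<n} \<and> card (parcs G) = m \<and>
      set es = parcs G \<and> distinct es \<and> v \<in> pverts G \<longrightarrow>
      (\<exists>t s. exec ((n + m + 2) ^ d) prog (initial_state n es v) t s \<and>
             t \<le> c * (n * m + 1) \<and>
             outputs_family s {C \<in> kvccs 2 (with_proj G). v \<in> C})"
proof (rule exI[of _ two_vccs_program], rule exI[of _ 4], rule exI[of _ 20000], intro allI impI, elim conjE)
  fix G :: "nat pair_pre_digraph" and n m :: nat and es :: "(nat \<times> nat) list" and v :: nat
  assume G: "pair_fin_digraph G" "pverts G = {..<n}" "set es = parcs G"
    and m: "card (parcs G) = m" "distinct es" and v: "v \<in> pverts G"
  interpret pair_fin_digraph G by fact
  let ?F = "{C \<in> kvccs 2 (with_proj G). v \<in> C}" and ?W = "(n + m + 2) ^ 4"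
  have len: "length es = m" using m G(3) distinct_card by metis
  have "runs ?W two_vccs_program (initial_state n es v) (\<lambda>t s. t \<le> 20000 * (n * m + 1) \<and> outputs_family s ?F)"
  proof (cases "es = []")
    case True
    then have "parcs G = {}" using G(3) by simp
    then have F: "?F = {}" by (intro kvccs_2_no_edges pair_wf_digraph_axioms)
    \<comment> \<open>Initially \<open>out\<close> is 0 everywhere, and a 0 in its first cell
      already encodes the empty family.\<close>
    have "outputs_family (initial_state n es v) {}"
      unfolding outputs_family_def
      by (rule exI[of _ "[]"]) (simp add: encode_lists_def initial_state_def)
    with True show ?thesis unfolding F two_vccs_program_def by (simp add: initial_state_def)
  next
    case False
    then have m1: "1 \<le> m" using len by (cases es) auto
    define a where "a = n + m + 2"
    \<comment> \<open>The exponent 4 comes from here: \<open>a * a\<close> dominates the quadratic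
      output addresses, using an edge to get \<open>n + 3 \<le> a\<close>, and a further factor
      \<open>a * a\<close>, at least 4, gives the constant in \<open>4 * a\<close>.\<close>
    have a: "2 \<le> a" "n + 3 \<le> a" using m1 by (auto simp: a_def)
    have sq: "4 * 1 \<le> a * a" using mult_le_mono[OF a(1) a(1)] by simp
    have "4 * a \<le> (a * a) * (a * a)"
    proof -
      have "a \<le> a * a" by simp
      with mult_le_mono[OF sq this] show ?thesis by simp
    qed
    moreover have "(n + 3) * (n + 3) \<le> (a * a) * (a * a)"
    proof -
      have "(n + 3) * (n + 3) \<le> a * a" using a(2) by (intro mult_le_mono)
      also have "\<dots> \<le> (a * a) * (a * a)" by simp
      finally show ?thesis .
    qed
    moreover have "a ^ 4 = (a * a) * (a * a)" by (simp add: power4_eq_xxxx mult.assoc)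
    ultimately have "4 * a \<le> a ^ 4" "(n + 3) * (n + 3) \<le> a ^ 4" by (simp_all only:)
    then have W: "4 * (n + length es + 2) \<le> ?W" "(n + 3) * (n + 3) \<le> ?W" by (simp_all only: a_def len)
    have "v < n" using v G(2) by auto
    from two_vccs_program_correct[OF G this W False] show ?thesis
      by (rule runs_conseq) (simp add: len)
  qed
  then show "\<exists>t s. exec ?W two_vccs_program (initial_state n es v) t s \<and> t \<le> 20000 * (n * m + 1) \<and> outputs_family s ?F"
    unfolding runs_def .
qed

end
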